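(* Suppose that $\mathbf q\in\mathcal Q$ and $\mathbb E_{\nu_{\mathbf q}}[s_\infty(1)^2]<\infty$. Then for any $k\in\mathbb N$ with $q_k>0$, any $u,v\in\mathbb R$ and any $0\le a\le1$, $$\varlimsup_{n\to\infty}\mathbb E_{\nu_{\mathbf q}}\left[\left|\frac1nY^{(\lfloor n^au\rfloor)}_k(n^2)-\frac1nY^{(\lfloor n^av\rfloor)}_k(n^2)\right|^2\right]=0.$$
   Context: **Dynamics.** $\Omega$ is the set of $\eta\in\{0,1\}^{\mathbb Z}$ such that $\lim_{x\to\infty}\frac1x\sum_{y=1}^x\eta(y)$ and $\lim_{x\to\infty}\frac1x\sum_{y=1}^x\eta(-y)$ exist and are $<\frac12$. A site $x$ is a record of $\eta\in\Omega$ if $\max_{z\le x}\sum_{y=z}^x(2\eta(y)-1)\le-1$. Records are numbered increasingly $\cdots<s_\infty(\eta,-1)<s_\infty(\eta,0)<s_\infty(\eta,1)<\cdots$ with $s_\infty(\eta,0)$ the largest record $\le0$. The box-ball dynamics $T:\Omega\to\Omega$ is $T\eta(x)=0$ if $x$ is a record and $T\eta(x)=1-\eta(x)$ otherwise. $\Omega_0=\{\eta\in\Omega: s_\infty(\eta,0)=0\}$. **Solitons.** For each $i$, the finite word $(\eta(x):s_\infty(\eta,i)<x<s_\infty(\eta,i+1))$ is decomposed into solitons by the Takahashi–Satsuma algorithm: select the leftmost run (maximal block of consecutive equal letters) whose subsequent run is at least as long; if its length is $k$, group its $k$ sites with the first $k$ sites of the subsequent run; these $2k$ sites form a $k$-soliton;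 remove them and repeat until no $1$s remain. $\Gamma_k(\eta)$ is the set of all $k$-solitons $\gamma\subset\mathbb Z$ of $\eta$; $X(\gamma):=(\inf\gamma)-1$, $\bar X(\gamma):=\sup\gamma$. For $\gamma\in\Gamma_k(\eta)$ there is a unique $\gamma(1)\in\Gamma_k(T\eta)$ whose sites carrying a $1$ (in $T\eta$) are exactly the sites of $\gamma$ carrying a $0$ (in $\eta$); iterating gives $\gamma(n)\in\Gamma_k(T^n\eta)$, $\gamma(0)=\gamma$. **Solitons with volume.** $\gamma,\gamma'\in\Gamma_k(\eta)$ with $X(\gamma)<X(\gamma')$ are connected if $[\bar X(\gamma),X(\gamma')]$ contains no record and no site of an $\ell$-soliton with $\ell\ge k+1$; $Con(\gamma)$ is the set of $k$-solitons connected to $\gamma$ (including $\gamma$). $\Gamma^*_k(\eta)$ is the set consisting of the leftmost element (smallest $X$) of each class $Con(\gamma)$. $\gamma^{(0)}_k$ is the element of $\Gamma_k^*$ with largest $X$ among those with $X<s_\infty(\eta,0)$, and $\gamma^{(i)}_k$, $i\in\mathbb Z$, numbers $\Gamma^*_k$ increasingly in $X$. $X^{(i)}_k(\eta,n):=X(\gamma^{(i)}_k(n))$, $Y^{(i)}_k(\eta,n):=X^{(i)}_k(\eta,n)-X^{(i)}_k(\eta,0)$. **Seat numbers.** Consider a carrier with seats labelled by $\mathbb N$, all empty at records. Scanning sites from left to right: at a site with $\eta(x)=1$ the ball is put on the empty seat with smallest label; at a site with $\eta(x)=0$, if some seat is occupied, the ball on the occupied seat with smallest label is removed. $\eta^{\uparrow}_k(x)=1$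 (resp. $\eta^{\downarrow}_k(x)=1$) if seat $k$ gets filled (resp. emptied) at $x$, and $0$ otherwise; $r(\eta,x)=1$ if $x$ is a record, else $0$. $\xi_k(\eta,\cdot)$ is defined by $\xi_k(\eta,s_\infty(\eta,0))=0$ and $\xi_k(\eta,x)-\xi_k(\eta,x-1)=r(\eta,x)+\sum_{\ell\ge1}(\eta^\uparrow_{k+\ell}(x)+\eta^\downarrow_{k+\ell}(x))$; $s_k(\eta,x)=\min\{y:\xi_k(\eta,y)=x\}$; $\zeta_k(\eta,i)=\sum_{y=s_k(\eta,i)+1}^{s_k(\eta,i+1)}(\eta^\uparrow_k(y)-\eta^\uparrow_{k+1}(y))$. **$\mathbf q$-statistics.** $\mathcal Q=\{\mathbf q=(q_k)_{k\in\mathbb N}\in[0,1)^{\mathbb N}:\sum_k kq_k<\infty\}$. For $\mathbf q\in\mathcal Q$, $\nu_{\mathbf q}$ is the probability measure on $\Omega_0$ under which $(\zeta_k(i))_{k\in\mathbb N,i\in\mathbb Z}$ are independent with $\nu_{\mathbf q}(\zeta_k(i)=m)=q_k^m(1-q_k)$, $m\ge0$ (elements of $\Omega_0$ are determined by $\zeta$). $s_\infty(1)$ denotes the random variable $s_\infty(\eta,1)$. *)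

theory Defs
  imports "HOL-Probability.Probability"
begin

section \<open>Configurations, records and the box-ball dynamics\<close>

text \<open>Throughout, \<^prop>\<open>\<eta> x\<close> means that site \<open>x\<close> carries a ball, i.e. \<open>\<eta>(x) = 1\<close>.  Soliton sizes
  and seat labels range over the positive integers, so the value \<open>0\<close> of type \<^typ>\<open>nat\<close> is never
  used for them.\<close>

type_synonym config = "int \<Rightarrow> bool"

definition Omega :: "config set" where
  "Omega = {\<eta>.
     (\<exists>l<1/2. (\<lambda>n. (\<Sum>y=1..n. of_bool (\<eta> (int y))) / real n) \<longlonglongrightarrow> l) \<and>
     (\<exists>l<1/2. (\<lambda>n. (\<Sum>y=1..n. of_bool (\<eta> (- int y))) / real n) \<longlonglongrightarrow> l)}"

text \<open>The bound on the maximum over \<open>z \<le> x\<close> is written out pointwise; on \<^const>\<open>Omega\<close> the maximum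
  is attained, because the sums tend to \<open>-\<infinity>\<close> as \<open>z \<rightarrow> -\<infinity>\<close>.\<close>

definition is_record :: "config \<Rightarrow> int \<Rightarrow> bool" where
  "is_record \<eta> x \<longleftrightarrow> (\<forall>z\<le>x. (\<Sum>y=z..x. 2 * of_bool (\<eta> y) - 1 :: int) \<le> -1)"

definition s_inf :: "config \<Rightarrow> int \<Rightarrow> int" where
  "s_inf \<eta> = (THE s. strict_mono s \<and> range s = {x. is_record \<eta> x} \<and>
                    s 0 = (GREATEST x. is_record \<eta> x \<and> x \<le> 0))"

definition bbs :: "config \<Rightarrow> config" where
  "bbs \<eta> x = (if is_record \<eta> x then False else \<not> \<eta> x)"

definition Omega0 :: "config set" where
  "Omega0 = {\<eta> \<in> Omega. s_inf \<eta> 0 = 0}"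


section \<open>Solitons\<close>

text \<open>Words are lists of sites; the letter at site \<open>x\<close> is \<^term>\<open>\<eta> x\<close>.\<close>

function runs :: "config \<Rightarrow> int list \<Rightarrow> int list list" where
  "runs \<eta> [] = []"
| "runs \<eta> (x # w) =
     (x # takeWhile (\<lambda>y. \<eta> y = \<eta> x) w) # runs \<eta> (dropWhile (\<lambda>y. \<eta> y = \<eta> x) w)"
  by pat_completeness auto
termination
  by (relation "Wellfounded.measure (\<lambda>(\<eta>, w). length w)")
    (auto simp: less_Suc_eq_le length_dropWhile_le)

text \<open>The sites grouped by one step of the Takahashi--Satsuma algorithm, or \<^term>\<open>[]\<close> if no run is
  followed by a run that is at least as long.\<close>

fun ts_select :: "int list list \<Rightarrow> int list" where
  "ts_select (r # r' # rs) =
     (if length r \<le> length r' then r @ take (length r) r' else ts_select (r' # rs))"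
| "ts_select _ = []"

lemma concat_runs: "concat (runs \<eta> w) = w"
  by (induction \<eta> w rule: runs.induct) auto

lemma set_ts_select: "set (ts_select rs) \<subseteq> set (concat rs)"
  by (induction rs rule: ts_select.induct) (auto dest: in_set_takeD)

lemma set_ts_select_runs: "set (ts_select (runs \<eta> w)) \<subseteq> set w"
  using set_ts_select[of "runs \<eta> w"] by (simp add: concat_runs)

text \<open>On the words between consecutive records, which contain as many zeros as ones and hence remain
  so during the algorithm, \<^const>\<open>ts_select\<close> succeeds as long as a one is left; the test for
  \<^term>\<open>[]\<close> only makes the function total.\<close>

function ts_solitons :: "config \<Rightarrow> int list \<Rightarrow> int set set" where
  "ts_solitons \<eta> w =
     (let g = ts_select (runs \<eta> w) in
      if g = [] \<or> (\<forall>x\<in>set w. \<not> \<eta> x) then {}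
      else insert (set g) (ts_solitons \<eta> (filter (\<lambda>x. x \<notin> set g) w)))"
  by auto
termination
proof (relation "Wellfounded.measure (\<lambda>(\<eta>, w). length w)", goal_cases)
  case (2 \<eta> w g)
  then have "hd g \<in> set g" by simp
  moreover from this have "hd g \<in> set w"
    using 2 set_ts_select_runs by blast
  ultimately show ?case by (auto intro!: length_filter_less)
qed simp

declare ts_solitons.simps [simp del]

definition solitons :: "nat \<Rightarrow> config \<Rightarrow> int set set" where
  "solitons k \<eta> =
     {\<gamma>. card \<gamma> = 2 * k \<and> (\<exists>i. \<gamma> \<in> ts_solitons \<eta> [s_inf \<eta> i + 1..s_inf \<eta> (i + 1) - 1])}"

definition lpos :: "int set \<Rightarrow> int" where
  "lpos \<gamma> = Inf \<gamma> - 1"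

definition rpos :: "int set \<Rightarrow> int" where
  "rpos \<gamma> = Sup \<gamma>"

definition soliton_next :: "nat \<Rightarrow> config \<Rightarrow> int set \<Rightarrow> int set" where
  "soliton_next k \<eta> \<gamma> =
     (THE \<gamma>'. \<gamma>' \<in> solitons k (bbs \<eta>) \<and> {x\<in>\<gamma>'. bbs \<eta> x} = {x\<in>\<gamma>. \<not> \<eta> x})"

primrec soliton_at :: "nat \<Rightarrow> config \<Rightarrow> int set \<Rightarrow> nat \<Rightarrow> int set" where
  "soliton_at k \<eta> \<gamma> 0 = \<gamma>"
| "soliton_at k \<eta> \<gamma> (Suc n) = soliton_next k ((bbs ^^ n) \<eta>) (soliton_at k \<eta> \<gamma> n)"


section \<open>Solitons with volume\<close>

definition soliton_conn :: "nat \<Rightarrow> config \<Rightarrow> int set \<Rightarrow> int set \<Rightarrow> bool" where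
  "soliton_conn k \<eta> \<gamma> \<gamma>' \<longleftrightarrow> lpos \<gamma> < lpos \<gamma>' \<and>
     (\<forall>x\<in>{rpos \<gamma>..lpos \<gamma>'}. \<not> is_record \<eta> x \<and> (\<forall>l\<ge>k+1. \<forall>\<delta>\<in>solitons l \<eta>. x \<notin> \<delta>))"

definition Con :: "nat \<Rightarrow> config \<Rightarrow> int set \<Rightarrow> int set set" where
  "Con k \<eta> \<gamma> = {\<gamma>' \<in> solitons k \<eta>. \<gamma>' = \<gamma> \<or> soliton_conn k \<eta> \<gamma> \<gamma>' \<or> soliton_conn k \<eta> \<gamma>' \<gamma>}"

definition lead_solitons :: "nat \<Rightarrow> config \<Rightarrow> int set set" where
  "lead_solitons k \<eta> = {\<gamma> \<in> solitons k \<eta>. \<forall>\<gamma>'\<in>Con k \<eta> \<gamma>. lpos \<gamma> \<le> lpos \<gamma>'}"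

text \<open>The enumeration \<open>i \<mapsto> \<gamma>\<^sub>k\<^sup>(\<^sup>i\<^sup>)\<close>.\<close>

definition lead :: "nat \<Rightarrow> config \<Rightarrow> int \<Rightarrow> int set" where
  "lead k \<eta> = (THE g. range g = lead_solitons k \<eta> \<and> strict_mono (\<lambda>i. lpos (g i)) \<and>
     lpos (g 0) < s_inf \<eta> 0 \<and>
     (\<forall>\<gamma>\<in>lead_solitons k \<eta>. lpos \<gamma> < s_inf \<eta> 0 \<longrightarrow> lpos \<gamma> \<le> lpos (g 0)))"

definition X_pos :: "nat \<Rightarrow> int \<Rightarrow> config \<Rightarrow> nat \<Rightarrow> int" where
  "X_pos k i \<eta> n = lpos (soliton_at k \<eta> (lead k \<eta> i) n)"

definition Y_disp :: "nat \<Rightarrow> int \<Rightarrow> config \<Rightarrow> nat \<Rightarrow> int" where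
  "Y_disp k i \<eta> n = X_pos k i \<eta> n - X_pos k i \<eta> 0"


section \<open>Seat numbers\<close>

text \<open>The carrier is represented by the set of labels of its occupied seats.\<close>

definition seat_step :: "bool \<Rightarrow> nat set \<Rightarrow> nat set" where
  "seat_step b C =
     (if b then insert (LEAST l. l \<ge> 1 \<and> l \<notin> C) C
      else if C \<noteq> {} then C - {LEAST l. l \<in> C} else C)"

text \<open>The state just after site \<open>x\<close> has been scanned, starting from the empty carrier at the last
  record not exceeding \<open>x\<close>.\<close>

definition carrier_at :: "config \<Rightarrow> int \<Rightarrow> nat set" where
  "carrier_at \<eta> x =
     fold (\<lambda>y. seat_step (\<eta> y)) [(GREATEST y. is_record \<eta> y \<and> y \<le> x) + 1..x] {}"

definition seat_up :: "nat \<Rightarrow> config \<Rightarrow> int \<Rightarrow> int" where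
  "seat_up k \<eta> x = of_bool (k \<notin> carrier_at \<eta> (x - 1) \<and> k \<in> carrier_at \<eta> x)"

definition seat_down :: "nat \<Rightarrow> config \<Rightarrow> int \<Rightarrow> int" where
  "seat_down k \<eta> x = of_bool (k \<in> carrier_at \<eta> (x - 1) \<and> k \<notin> carrier_at \<eta> x)"

definition xi :: "nat \<Rightarrow> config \<Rightarrow> int \<Rightarrow> int" where
  "xi k \<eta> = (THE f. f (s_inf \<eta> 0) = 0 \<and>
     (\<forall>x. f x - f (x - 1) = of_bool (is_record \<eta> x) +
            (\<Sum>l. seat_up (k + Suc l) \<eta> x + seat_down (k + Suc l) \<eta> x)))"

definition s_seat :: "nat \<Rightarrow> config \<Rightarrow> int \<Rightarrow> int" where
  "s_seat k \<eta> i = (LEAST y. xi k \<eta> y = i)"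

definition zeta :: "nat \<Rightarrow> config \<Rightarrow> int \<Rightarrow> int" where
  "zeta k \<eta> i = (\<Sum>y = s_seat k \<eta> i + 1..s_seat k \<eta> (i + 1). seat_up k \<eta> y - seat_up (k + 1) \<eta> y)"


section \<open>The measures \<open>\<nu>\<^sub>q\<close>\<close>

definition q_params :: "(nat \<Rightarrow> real) set" where
  "q_params = {q. (\<forall>k\<ge>1. 0 \<le> q k \<and> q k < 1) \<and> summable (\<lambda>k. real k * q k)}"

text \<open>\<open>is_nu q \<nu>\<close> states that \<open>\<nu>\<close> is the measure \<open>\<nu>\<^sub>q\<close>: a probability measure on \<^const>\<open>Omega0\<close> with
  the trace of the product \<open>\<sigma>\<close>-algebra.\<close>

definition is_nu :: "(nat \<Rightarrow> real) \<Rightarrow> config measure \<Rightarrow> bool" where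
  "is_nu q \<nu> \<longleftrightarrow>
     prob_space \<nu> \<and>
     sets \<nu> = sets (restrict_space (Pi\<^sub>M UNIV (\<lambda>_. count_space UNIV)) Omega0) \<and>
     prob_space.indep_vars \<nu> (\<lambda>_. count_space UNIV) (\<lambda>(k, i) \<eta>. zeta k \<eta> i) ({1..} \<times> UNIV) \<and>
     (\<forall>k\<ge>1. \<forall>i. \<forall>m::nat.
        measure \<nu> {\<eta> \<in> space \<nu>. zeta k \<eta> i = int m} = q k ^ m * (1 - q k))"

end

theory Submission
  imports Defs
begin

text \<open>
  Delete from a configuration every site whose letter differs from that of
  its left neighbour.  These are exactly the sites at which seat \<open>1\<close> is filled or emptied, so what
  remains (the \<^emph>\<open>slots\<close>, relabelled by the integers) is a configuration in which all seats have moved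
  down by one and all solitons have shrunk by one unit.  Between two consecutive slots the deleted
  letters alternate: they are a number of pairs, the \<open>1\<close>-solitons of that slot, and one more site if
  the letters of the two slots differ (\<open>slot_map.gap\<close>).  The deletion commutes with the dynamics as
  soon as the slots that are records are moved one site to the right, and the number of pairs
  attached to a slot does not change (\<open>slot_map.bbs_contract\<close>, \<open>slot_map.gap_pairs_bbs\<close>).  Iterating
  the deletion gives, for every size, labels of the slots in which the counts \<open>\<zeta>\<close> are constant in
  time, and a tagged soliton keeps the label \<open>J\<close> of its slot for ever (\<open>X_pos_tower\<close>).

  Take two tagged solitons of size \<open>k + 1\<close> with labels \<open>J < J'\<close>, and let \<open>W l\<close> be the length of the
  window between them after \<open>l\<close> deletions.  Then \<open>W (k + 1) = J' - J\<close> at all times, and counting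
  the deleted sites gives \<open>W l = 2 W (l + 1) + 2 S l - W (l + 2)\<close>, where \<open>S l\<close> is the sum of the counts of
  \<open>(l + 1)\<close>-solitons over \<open>W (l + 1)\<close> consecutive slots (\<open>position_recursion\<close>).  By the law of large
  numbers \<open>S l\<close> is close to \<open>\<alpha> l W (l + 1)\<close>, wherever the window lies.  So the lengths at two
  different times are almost solutions of the same linear recursion of second order, they agree at
  level \<open>k + 1\<close>, and \<open>W L - W (L + 1)\<close> is at most about \<open>W 0 / L\<close> since \<open>W\<close> is almost convex and decreasing.
  The Wronskian of the two solutions is almost constant in the level and small at level \<open>L\<close>;
  hence the solutions almost agree at level \<open>k + 2\<close> too, and then at level \<open>0\<close> (\<open>window_stability\<close>).
  Thus the distance of the two tagged solitons changes by \<open>o(n)\<close> when the window has length \<open>O(n)\<close>.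

  For the expectation one needs the law of large numbers uniformly over all windows that can occur.
  Large deviation bounds for independent geometric variables, applied to each size separately, show
  that a scale \<open>m\<close> is atypical with exponentially small probability (\<open>atypical_rare\<close>).  If all scales
  from \<open>M\<close> on are typical, then the difference of the two displacements is at most \<open>\<delta> n\<close> when
  \<open>M \<le> n\<close>, and at most \<open>C (M + n\<^sup>2) \<le> 2 C M\<^sup>2\<close> when \<open>n < M\<close> (\<open>tagged_estimate\<close>); and the fourth moment
  of \<open>M\<close>, restricted to \<open>n < M\<close>, tends to \<open>0\<close>.
\<close>

section \<open>Increasing enumerations of sets of integers\<close>

definition enumerates :: "(int \<Rightarrow> int) \<Rightarrow> int set \<Rightarrow> bool" where
  "enumerates s S \<longleftrightarrow> strict_mono s \<and> range s = S"

text \<open>The generalized inverse of an enumeration: \<open>s (idx s x)\<close> is the last enumerated point not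
  beyond \<open>x\<close>, so \<open>idx s\<close> and \<open>s\<close> form a Galois connection (\<open>le_idx_iff\<close>).\<close>

definition idx :: "(int \<Rightarrow> int) \<Rightarrow> int \<Rightarrow> int" where
  "idx s x = (GREATEST i. s i \<le> x)"

lemma int_Greatest:
  fixes P :: "int \<Rightarrow> bool"
  assumes "P a" and "\<And>x. P x \<Longrightarrow> x \<le> b"
  shows "P (GREATEST x. P x)" and "\<And>x. P x \<Longrightarrow> x \<le> (GREATEST x. P x)"
proof -
  let ?A = "{x. P x \<and> a \<le> x}"
  have "?A \<subseteq> {a..b}" using assms by auto
  hence fin: "finite ?A" by (rule finite_subset) simp
  have ne: "?A \<noteq> {}" using assms by auto
  let ?m = "Max ?A"
  have m: "P ?m" using Max_in[OF fin ne] by auto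
  have le: "x \<le> ?m" if "P x" for x
  proof (cases "a \<le> x")
    case True thus ?thesis using that fin by (intro Max_ge) auto
  next
    case False thus ?thesis using Max_in[OF fin ne] by auto
  qed
  have "(GREATEST x. P x) = ?m" using m le by (intro Greatest_equality)
  with m le show "P (GREATEST x. P x)" and "\<And>x. P x \<Longrightarrow> x \<le> (GREATEST x. P x)" by auto
qed

lemma strict_mono_int_diff:
  fixes s :: "int \<Rightarrow> int"
  assumes "strict_mono s" "i \<le> j"
  shows "j - i \<le> s j - s i"
  using assms(2)
proof (induction j rule: int_ge_induct)
  case (step j)
  have "s j < s (j + 1)" using assms(1) by (simp add: strict_mono_def)
  thus ?case using step by simp
qed simp

lemma strict_mono_intI:
  fixes s :: "int \<Rightarrow> int"
  assumes "\<And>i. s i < s (i + 1)"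
  shows "strict_mono s"
proof (rule strict_monoI)
  fix i j :: int assume "i < j"
  hence "i + 1 \<le> j" by simp
  thus "s i < s j"
  proof (induction j rule: int_ge_induct)
    case (step j) thus ?case using assms[of j] by simp
  qed (use assms in simp)
qed

lemma idx_props:
  fixes s :: "int \<Rightarrow> int"
  assumes "strict_mono s"
  shows idx_le: "s (idx s x) \<le> x" and le_idx: "s i \<le> x \<Longrightarrow> i \<le> idx s x"
proof -
  define a where "a = min 0 (x - s 0)"
  have a: "s a \<le> x"
    using strict_mono_int_diff[OF assms, of a 0] by (auto simp: a_def min_def split: if_splits)
  define b where "b = max 0 (x - s 0)"
  have b: "i \<le> b" if "s i \<le> x" for i
    using strict_mono_int_diff[OF assms, of 0 i] that by (cases "0 \<le> i") (auto simp: b_def)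
  show "s (idx s x) \<le> x" unfolding idx_def by (rule int_Greatest(1)[of "\<lambda>i. s i \<le> x", OF a b])
  show "s i \<le> x \<Longrightarrow> i \<le> idx s x" unfolding idx_def
    by (rule int_Greatest(2)[of "\<lambda>i. s i \<le> x", OF a b])
qed

lemma le_idx_iff: "strict_mono s \<Longrightarrow> i \<le> idx s x \<longleftrightarrow> s i \<le> x"
  by (meson idx_le le_idx order_trans strict_mono_less_eq)

lemma idx_less_iff: "strict_mono s \<Longrightarrow> idx s x < i \<longleftrightarrow> x < s i"
  using le_idx_iff[of s i x] by linarith

lemma less_idx_Suc: "strict_mono s \<Longrightarrow> x < s (idx s x + 1)"
  using idx_less_iff[of s x "idx s x + 1"] by simp

lemma idx_apply [simp]: "strict_mono s \<Longrightarrow> idx s (s i) = i"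
  using le_idx_iff[of s i "s i"] le_idx_iff[of s "idx s (s i)" "s i"] idx_le[of s "s i"]
    strict_mono_less_eq[of s "idx s (s i)" i] by simp

lemma idx_mono: "strict_mono s \<Longrightarrow> x \<le> y \<Longrightarrow> idx s x \<le> idx s y"
  by (meson idx_le le_idx order_trans)

lemma idx_increment:
  assumes "enumerates s S"
  shows "idx s x = idx s (x - 1) + of_bool (x \<in> S)"
proof -
  have sm: "strict_mono s" and ra: "range s = S" using assms by (auto simp: enumerates_def)
  show ?thesis
  proof (cases "x \<in> S")
    case True
    then obtain i where i: "x = s i" using ra by auto
    have "idx s (x - 1) < i" using i idx_less_iff[OF sm] by simp
    moreover have "i - 1 \<le> idx s (x - 1)"
      using strict_mono_int_diff[OF sm, of "i - 1" i] i le_idx_iff[OF sm] by simp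
    ultimately show ?thesis using True i sm by simp
  next
    case False
    have "s (idx s x) \<noteq> x" using False ra by (metis rangeI)
    hence "s (idx s x) \<le> x - 1" using idx_le[OF sm, of x] by simp
    hence "idx s x \<le> idx s (x - 1)" using le_idx_iff[OF sm] by simp
    thus ?thesis using idx_mono[OF sm, of "x - 1" x] False by simp
  qed
qed

lemma apply_idx: "enumerates s S \<Longrightarrow> x \<in> S \<Longrightarrow> s (idx s x) = x"
  by (auto simp: enumerates_def)

lemma idx_unique: "strict_mono s \<Longrightarrow> s i \<le> x \<Longrightarrow> x < s (i + 1) \<Longrightarrow> idx s x = i"
  using le_idx_iff[of s i x] idx_less_iff[of s x "i + 1"] by simp

lemma enumerates_no_between:
  "enumerates s S \<Longrightarrow> s i < x \<Longrightarrow> x < s (i + 1) \<Longrightarrow> x \<notin> S"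
  using apply_idx[of s S x] idx_unique[of s i x] by (auto simp: enumerates_def)

lemma strict_mono_surj_int:
  fixes f :: "int \<Rightarrow> int"
  assumes "strict_mono f" "surj f" "f 0 = 0"
  shows "f i = i"
proof -
  have step: "f (i + 1) = f i + 1" for i
  proof (rule ccontr)
    assume *: "f (i + 1) \<noteq> f i + 1"
    have "f i < f (i + 1)" using assms(1) by (simp add: strict_mono_def)
    hence lt: "f i + 1 < f (i + 1)" using * by simp
    obtain j where j: "f j = f i + 1" using assms(2) by (metis surjD)
    have "i < j" using j assms(1) by (metis less_add_one strict_mono_less)
    moreover have "j < i + 1" using j lt assms(1) by (metis strict_mono_less)
    ultimately show False by simp
  qed
  show ?thesis
  proof (induction i rule: int_induct[of _ 0])
    case (step2 i) thus ?case using step[of "i - 1"] by simp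
  qed (use assms step in auto)
qed

text \<open>An enumeration of a set that is unbounded in both directions is determined by its value at
  \<open>0\<close>.  This evaluates the definite descriptions behind \<^const>\<open>s_inf\<close> and \<^const>\<open>lead\<close>.\<close>

lemma enumerates_unique:
  assumes "enumerates s S" "enumerates t S" "s 0 = t 0"
  shows "s = t"
proof -
  have s: "strict_mono s" "range s = S" and t: "strict_mono t" "range t = S"
    using assms by (auto simp: enumerates_def)
  define f where "f i = idx s (t i)" for i
  have sf: "s (f i) = t i" for i unfolding f_def using apply_idx[OF assms(1)] t by auto
  have "strict_mono f"
    using t(1) s(1) by (metis sf strict_mono_def strict_mono_less)
  moreover have "surj f"
  proof -
    have "\<exists>i. f i = j" for j
    proof -
      obtain i where "t i = s j" using s t by (metis rangeE rangeI)
      thus ?thesis using s(1) by (intro exI[of _ i]) (simp add: f_def)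
    qed
    thus ?thesis by (metis surjI surj_def)
  qed
  moreover have "f 0 = 0" by (simp add: f_def flip: assms(3)) (use s in simp)
  ultimately have "f i = i" for i by (rule strict_mono_surj_int)
  thus ?thesis using sf by auto
qed

lemma enumerates_exists:
  fixes S :: "int set"
  assumes up: "\<And>x. \<exists>y\<in>S. x \<le> y" and down: "\<And>x. \<exists>y\<in>S. y \<le> x" and x0: "x0 \<in> S"
  shows "\<exists>s. enumerates s S \<and> s 0 = x0"
proof -
  define A B where "A = {n::nat. x0 + int n \<in> S}" and "B = {n::nat. x0 - int n \<in> S}"
  have iA: "infinite A"
  proof (subst infinite_nat_iff_unbounded_le, rule allI)
    fix m obtain y where "y \<in> S" "x0 + int m \<le> y" using up by blast
    thus "\<exists>n\<ge>m. n \<in> A" by (intro exI[of _ "nat (y - x0)"]) (auto simp: A_def)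
  qed
  have iB: "infinite B"
  proof (subst infinite_nat_iff_unbounded_le, rule allI)
    fix m obtain y where "y \<in> S" "y \<le> x0 - int m" using down by blast
    thus "\<exists>n\<ge>m. n \<in> B" by (intro exI[of _ "nat (x0 - y)"]) (auto simp: B_def)
  qed
  have A0: "enumerate A 0 = 0" using x0 by (simp add: A_def enumerate_0 Least_equality)
  have B0: "enumerate B 0 = 0" using x0 by (simp add: B_def enumerate_0 Least_equality)
  define s where "s i = (if 0 \<le> i then x0 + int (enumerate A (nat i))
                         else x0 - int (enumerate B (nat (- i))))" for i :: int
  have sm: "strict_mono s"
  proof (rule strict_mono_intI)
    fix i :: int
    consider "0 \<le> i" | "i = -1" | "i < -1" by linarith
    thus "s i < s (i + 1)"
    proof cases
      case 1
      have "enumerate A (nat i) < enumerate A (nat (i + 1))"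
        using 1 by (intro enumerate_mono iA) auto
      thus ?thesis using 1 by (simp add: s_def)
    next
      case 2
      have "enumerate B 0 < enumerate B 1" by (intro enumerate_mono iB) auto
      thus ?thesis using 2 A0 B0 by (simp add: s_def)
    next
      case 3
      have "enumerate B (nat (- (i + 1))) < enumerate B (nat (- i))"
        using 3 by (intro enumerate_mono iB) auto
      thus ?thesis using 3 by (simp add: s_def)
    qed
  qed
  have "range s = S"
  proof (intro equalityI subsetI)
    fix y assume "y \<in> range s"
    then obtain i where "y = s i" by auto
    moreover have "enumerate A (nat i) \<in> A" "enumerate B (nat (-i)) \<in> B"
      using iA iB by (simp_all add: enumerate_in_set)
    ultimately show "y \<in> S" by (auto simp: s_def A_def B_def split: if_splits)
  next
    fix y assume y: "y \<in> S"
    show "y \<in> range s"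
    proof (cases "x0 \<le> y")
      case True
      hence "nat (y - x0) \<in> A" using y by (simp add: A_def)
      then obtain n where "enumerate A n = nat (y - x0)" using enumerate_Ex iA by blast
      hence "s (int n) = y" using True by (simp add: s_def)
      thus ?thesis by blast
    next
      case False
      hence "nat (x0 - y) \<in> B" using y by (simp add: B_def)
      then obtain n where n: "enumerate B n = nat (x0 - y)" using enumerate_Ex iB by blast
      have "n \<noteq> 0"
      proof
        assume "n = 0"
        thus False using B0 n False by simp
      qed
      hence "s (- int n) = y" using False n by (simp add: s_def)
      thus ?thesis by blast
    qed
  qed
  moreover have "s 0 = x0" by (simp add: s_def A0)
  ultimately show ?thesis using sm by (auto simp: enumerates_def)
qed

section \<open>Paths and records\<close>

definition walk :: "config \<Rightarrow> int \<Rightarrow> int" where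
  "walk \<eta> x = (\<Sum>y\<in>{0<..x}. 2 * of_bool (\<eta> y) - 1) - (\<Sum>y\<in>{x<..0}. 2 * of_bool (\<eta> y) - 1)"

lemma walk_step: "walk \<eta> x = walk \<eta> (x - 1) + (2 * of_bool (\<eta> x) - 1)"
proof (cases "x \<ge> 1")
  case True
  hence "{0<..x} = insert x {0<..x-1}" "{x<..0} = {}" "{x-1<..0} = {}" by auto
  thus ?thesis by (simp add: walk_def)
next
  case False
  hence "{x-1<..0} = insert x {x<..0}" "{0<..x} = {}" "{0<..x-1} = {}" by auto
  thus ?thesis by (simp add: walk_def)
qed

lemma walk_0 [simp]: "walk \<eta> 0 = 0" by (simp add: walk_def)

lemma walk_sum: "z \<le> x + 1 \<Longrightarrow> (\<Sum>y=z..x. 2 * of_bool (\<eta> y) - 1) = walk \<eta> x - walk \<eta> (z - 1)"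
proof (induction "nat (x + 1 - z)" arbitrary: x)
  case 0
  hence "z = x + 1" by simp
  thus ?case by simp
next
  case (Suc n)
  hence "{z..x} = insert x {z..x-1}" by auto
  thus ?case using Suc(1)[of "x - 1"] Suc(2,3) walk_step[of \<eta> x] by simp
qed

text \<open>In terms of the walk with steps \<open>+1\<close> at balls and \<open>-1\<close> at empty sites, records are the strict
  minima over the past.\<close>

lemma is_record_iff: "is_record \<eta> x \<longleftrightarrow> (\<forall>z<x. walk \<eta> x < walk \<eta> z)"
proof -
  have "is_record \<eta> x \<longleftrightarrow> (\<forall>z\<le>x. walk \<eta> x - walk \<eta> (z - 1) \<le> -1)"
    unfolding is_record_def using walk_sum[of _ x \<eta>] by simp
  also have "\<dots> \<longleftrightarrow> (\<forall>z<x. walk \<eta> x < walk \<eta> z)"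
  proof safe
    fix z assume "\<forall>z\<le>x. walk \<eta> x - walk \<eta> (z - 1) \<le> -1" "z < x"
    thus "walk \<eta> x < walk \<eta> z" by (auto dest: spec[of _ "z + 1"])
  next
    fix z assume "\<forall>z<x. walk \<eta> x < walk \<eta> z" "z \<le> x"
    thus "walk \<eta> x - walk \<eta> (z - 1) \<le> -1" by (auto dest: spec[of _ "z - 1"])
  qed
  finally show ?thesis .
qed

lemma recordD: "is_record \<eta> x \<Longrightarrow> \<not> \<eta> x" "is_record \<eta> x \<Longrightarrow> \<not> \<eta> (x - 1)"
proof -
  assume r: "is_record \<eta> x"
  show "\<not> \<eta> x" using r walk_step[of \<eta> x] by (auto simp: is_record_iff dest: spec[of _ "x - 1"])
  show "\<not> \<eta> (x - 1)"
    using r walk_step[of \<eta> x] walk_step[of \<eta> "x - 1"]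
      r[unfolded is_record_iff, rule_format, of "x - 2"] r[unfolded is_record_iff, rule_format, of "x - 1"]
    by (auto split: if_splits simp: of_bool_def)
qed

lemma record_Suc: "is_record \<eta> (x - 1) \<Longrightarrow> \<not> \<eta> x \<Longrightarrow> is_record \<eta> x"
  unfolding is_record_iff
proof (intro allI impI)
  fix z assume *: "\<forall>z<x - 1. walk \<eta> (x - 1) < walk \<eta> z" "\<not> \<eta> x" "z < x"
  thus "walk \<eta> x < walk \<eta> z"
  proof (cases "z = x - 1")
    case False
    hence "z < x - 1" using * by simp
    hence "walk \<eta> (x - 1) < walk \<eta> z" using *(1) by blast
    thus ?thesis using walk_step[of \<eta> x] * by simp
  qed (use walk_step[of \<eta> x] * in simp)
qed

definition recurrent :: "config \<Rightarrow> bool" where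
  "recurrent \<eta> \<longleftrightarrow> (\<forall>x. \<exists>y\<le>x. is_record \<eta> y) \<and> (\<forall>x. \<exists>y\<ge>x. is_record \<eta> y)"

text \<open>The value of the walk at the last record is its running minimum, and the height above this
  minimum is the load of the carrier.\<close>

definition last_record :: "config \<Rightarrow> int \<Rightarrow> int" where
  "last_record \<eta> x = (GREATEST y. is_record \<eta> y \<and> y \<le> x)"

lemma last_record:
  assumes "recurrent \<eta>"
  shows "is_record \<eta> (last_record \<eta> x)" "last_record \<eta> x \<le> x"
    "\<And>y. is_record \<eta> y \<Longrightarrow> y \<le> x \<Longrightarrow> y \<le> last_record \<eta> x"
proof -
  obtain a where a: "is_record \<eta> a \<and> a \<le> x" using assms by (auto simp: recurrent_def)
  note G = int_Greatest[of "\<lambda>y. is_record \<eta> y \<and> y \<le> x" a x, OF a]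
  show "is_record \<eta> (last_record \<eta> x)" "last_record \<eta> x \<le> x"
    using G(1) by (auto simp: last_record_def)
  show "\<And>y. is_record \<eta> y \<Longrightarrow> y \<le> x \<Longrightarrow> y \<le> last_record \<eta> x"
    using G(2) by (auto simp: last_record_def)
qed

lemma last_record_record: "recurrent \<eta> \<Longrightarrow> is_record \<eta> x \<Longrightarrow> last_record \<eta> x = x"
  using last_record(2,3)[of \<eta> x] by (meson order.antisym order_refl)

lemma last_record_step:
  "recurrent \<eta> \<Longrightarrow> \<not> is_record \<eta> x \<Longrightarrow> last_record \<eta> x = last_record \<eta> (x - 1)"
proof (rule order.antisym)
  assume r: "recurrent \<eta>" and n: "\<not> is_record \<eta> x"
  have "last_record \<eta> x \<noteq> x" using last_record(1)[OF r, of x] n by auto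
  thus "last_record \<eta> x \<le> last_record \<eta> (x - 1)"
    using last_record[OF r, of x] last_record(3)[OF r, of _ "x - 1"] by auto
  show "last_record \<eta> (x - 1) \<le> last_record \<eta> x"
    using last_record[OF r, of "x - 1"] last_record(3)[OF r, of _ "x"] by auto
qed

text \<open>A first site below the level of the last record would itself be a later record.\<close>

lemma walk_last_record_le:
  assumes "recurrent \<eta>" "z \<le> x"
  shows "walk \<eta> (last_record \<eta> x) \<le> walk \<eta> z"
proof (rule ccontr)
  let ?r = "last_record \<eta> x"
  define W where "W = {w. w \<le> x \<and> walk \<eta> w < walk \<eta> ?r}"
  assume "\<not> ?thesis"
  hence ne: "W \<noteq> {}" using assms by (auto simp: W_def)
  have gt: "?r < w" if "w \<in> W" for w
  proof (rule ccontr)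
    assume "\<not> ?r < w"
    hence "w < ?r \<or> w = ?r" by linarith
    thus False
      using that last_record(1)[OF assms(1), of x, unfolded is_record_iff, rule_format, of w]
      by (auto simp: W_def)
  qed
  have "W \<subseteq> {?r..x}" using gt by (force simp: W_def)
  hence fW: "finite W" by (rule finite_subset) simp
  define m where "m = Min W"
  have m: "m \<in> W" unfolding m_def using fW ne by (rule Min_in)
  have "is_record \<eta> m" unfolding is_record_iff
  proof (intro allI impI)
    fix v assume v: "v < m"
    hence "v \<notin> W" using Min_le[OF fW, of v] by (auto simp: m_def)
    thus "walk \<eta> m < walk \<eta> v" using v m by (auto simp: W_def)
  qed
  thus False using last_record(3)[OF assms(1), of m x] gt[OF m] m by (auto simp: W_def)
qed

lemma record_walk_step:
  assumes "recurrent \<eta>" "is_record \<eta> x"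
  shows "walk \<eta> (last_record \<eta> (x - 1)) = walk \<eta> x + 1" "walk \<eta> (x - 1) = walk \<eta> x + 1"
proof -
  show a: "walk \<eta> (x - 1) = walk \<eta> x + 1" using walk_step[of \<eta> x] recordD(1)[OF assms(2)] by simp
  have "walk \<eta> (last_record \<eta> (x - 1)) \<le> walk \<eta> (x - 1)" by (rule walk_last_record_le[OF assms(1)]) simp
  moreover have "walk \<eta> x < walk \<eta> (last_record \<eta> (x - 1))"
    using assms(2) last_record(2)[OF assms(1), of "x - 1"] by (auto simp: is_record_iff)
  ultimately show "walk \<eta> (last_record \<eta> (x - 1)) = walk \<eta> x + 1" using a by simp
qed

section \<open>Configurations that stay recurrent under the dynamics\<close>

text \<open>On the left the walk has an asymptotic slope, which its running minimum shares; on the right it is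
  unbounded below.  In this form stability under the dynamics is immediate from \<open>walk_bbs\<close>.\<close>

definition sloped :: "config \<Rightarrow> bool" where
  "sloped \<eta> \<longleftrightarrow>
     (\<exists>\<rho>>0. \<forall>\<delta>>0. \<exists>C. \<forall>x\<le>0. \<bar>real_of_int (walk \<eta> x) + \<rho> * real_of_int x\<bar> \<le> C - \<delta> * real_of_int x) \<and>
     (\<forall>B. \<exists>x. walk \<eta> x \<le> B)"

lemma sloped_left:
  assumes "sloped \<eta>"
  shows "\<exists>z0. \<forall>z\<le>z0. B \<le> walk \<eta> z"
proof -
  obtain \<rho> where \<rho>: "\<rho> > 0" "\<forall>\<delta>>0. \<exists>C. \<forall>x\<le>0. \<bar>real_of_int (walk \<eta> x) + \<rho> * real_of_int x\<bar> \<le> C - \<delta> * real_of_int x"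
    using assms by (auto simp: sloped_def)
  from \<rho>(2)[rule_format, of "\<rho> / 2"] \<rho>(1) obtain C where
    C: "\<And>x. x \<le> 0 \<Longrightarrow> \<bar>real_of_int (walk \<eta> x) + \<rho> * real_of_int x\<bar> \<le> C - \<rho> / 2 * real_of_int x" by auto
  define z0 where "z0 = min 0 (- \<lceil>(C + B) * 2 / \<rho>\<rceil>)"
  have "B \<le> walk \<eta> z" if "z \<le> z0" for z
  proof -
    have "z \<le> 0" and zz: "\<lceil>(C + B) * 2 / \<rho>\<rceil> \<le> - z"
      using that by (auto simp: z0_def)
    from zz have "(C + B) * 2 / \<rho> \<le> - real_of_int z" by (simp add: ceiling_le_iff)
    hence "C + B \<le> - (\<rho> / 2) * real_of_int z" using \<rho>(1) by (simp add: field_simps)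
    thus ?thesis using C[OF \<open>z \<le> 0\<close>] by (simp add: abs_le_iff algebra_simps)
  qed
  thus ?thesis by blast
qed

lemma sloped_recurrent:
  assumes "sloped \<eta>"
  shows "recurrent \<eta>"
  unfolding recurrent_def
proof (intro conjI allI)
  fix X :: int
  obtain z0 where z0: "\<And>z. z \<le> z0 \<Longrightarrow> walk \<eta> X + 1 \<le> walk \<eta> z" using sloped_left[OF assms] by blast
  define W where "W = walk \<eta> ` {z0..X}"
  have zX: "z0 \<le> X" using z0[of X] by (cases "z0 \<le> X") auto
  have W: "finite W" "W \<noteq> {}" using zX by (auto simp: W_def)
  define m where "m = Min W"
  define Z where "Z = {z. z \<le> X \<and> walk \<eta> z = m}"
  have mX: "m \<le> walk \<eta> X" unfolding m_def using W zX by (intro Min_le) (auto simp: W_def)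
  have Zsub: "Z \<subseteq> {z0..X}"
  proof
    fix z assume "z \<in> Z"
    thus "z \<in> {z0..X}" using z0[of z] mX by (cases "z \<le> z0") (auto simp: Z_def)
  qed
  have fZ: "finite Z" by (rule finite_subset[OF Zsub]) simp
  have neZ: "Z \<noteq> {}" using Min_in[OF W] by (auto simp: W_def Z_def m_def)
  have ge: "m \<le> walk \<eta> z" if "z \<le> X" for z
  proof (cases "z0 \<le> z")
    case True thus ?thesis unfolding m_def using W that by (intro Min_le) (auto simp: W_def)
  next
    case False thus ?thesis using z0[of z] mX by simp
  qed
  have mz: "Min Z \<in> Z" using fZ neZ by (rule Min_in)
  have "is_record \<eta> (Min Z)" unfolding is_record_iff
  proof (intro allI impI)
    fix z assume z: "z < Min Z"
    hence "z \<notin> Z" using Min_le[OF fZ, of z] by auto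
    moreover have "z \<le> X" using z mz by (auto simp: Z_def)
    ultimately show "walk \<eta> (Min Z) < walk \<eta> z" using ge[of z] mz by (auto simp: Z_def)
  qed
  thus "\<exists>y\<le>X. is_record \<eta> y" using mz by (auto simp: Z_def)
  
  obtain x where x: "walk \<eta> x \<le> m - 1" using assms unfolding sloped_def by blast
  have Xx: "X < x" using ge[of x] x by (cases "x \<le> X") auto
  define V where "V = {y. walk \<eta> y < m \<and> y \<le> x}"
  have "V \<subseteq> {X..x}"
  proof
    fix y assume "y \<in> V"
    thus "y \<in> {X..x}" using ge[of y] by (cases "y \<le> X") (auto simp: V_def)
  qed
  hence fV: "finite V" by (rule finite_subset) simp
  have neV: "V \<noteq> {}" using x by (auto simp: V_def)
  have mv: "Min V \<in> V" using fV neV by (rule Min_in)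
  have "is_record \<eta> (Min V)" unfolding is_record_iff
  proof (intro allI impI)
    fix z assume z: "z < Min V"
    hence "z \<notin> V" using Min_le[OF fV, of z] by auto
    thus "walk \<eta> (Min V) < walk \<eta> z" using z mv by (auto simp: V_def)
  qed
  moreover have "X \<le> Min V" using mv ge[of "Min V"] by (cases "Min V \<le> X") (auto simp: V_def)
  ultimately show "\<exists>y\<ge>X. is_record \<eta> y" by auto
qed

text \<open>The dynamics reflects the walk at its running minimum (a discrete Pitman transform).\<close>

lemma walk_bbs:
  assumes "recurrent \<eta>"
  shows "\<exists>c. \<forall>x. walk (bbs \<eta>) x = 2 * walk \<eta> (last_record \<eta> x) - walk \<eta> x + c"
proof -
  define d where "d x = walk (bbs \<eta>) x - 2 * walk \<eta> (last_record \<eta> x) + walk \<eta> x" for x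
  have step: "d x = d (x - 1)" for x
  proof (cases "is_record \<eta> x")
    case True
    have "\<not> bbs \<eta> x" using True by (simp add: bbs_def)
    thus ?thesis
      using record_walk_step[OF assms True] walk_step[of "bbs \<eta>" x]
        last_record_record[OF assms True]
      unfolding d_def by simp
  next
    case False
    have b: "bbs \<eta> x \<longleftrightarrow> \<not> \<eta> x" using False by (simp add: bbs_def)
    show ?thesis
      using walk_step[of "bbs \<eta>" x] walk_step[of \<eta> x] last_record_step[OF assms False] b
      unfolding d_def by (cases "\<eta> x") simp_all
  qed
  have all: "d x = d 0" for x
  proof (induction x rule: int_induct[of _ 0])
    case (step1 i) thus ?case using step[of "i + 1"] by simp
  next
    case (step2 i) thus ?case using step[of i] by simp
  qed simp
  have "walk (bbs \<eta>) x = 2 * walk \<eta> (last_record \<eta> x) - walk \<eta> x + d 0" for x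
    using all[of x] unfolding d_def[of x] by linarith
  thus ?thesis by blast
qed

text \<open>On the left the running minimum \<open>I\<close> and the walk \<open>S\<close> have the same slope, hence so has
  \<open>2 I - S\<close>; on the right \<open>2 I - S \<le> S\<close>.\<close>

lemma sloped_bbs:
  assumes "sloped \<eta>"
  shows "sloped (bbs \<eta>)"
proof -
  note rec = sloped_recurrent[OF assms]
  obtain c where c: "\<And>x. walk (bbs \<eta>) x = 2 * walk \<eta> (last_record \<eta> x) - walk \<eta> x + c"
    using walk_bbs[OF rec] by auto
  have le: "walk \<eta> (last_record \<eta> x) \<le> walk \<eta> x" for x by (rule walk_last_record_le[OF rec]) simp
  obtain \<rho> where \<rho>: "\<rho> > 0" and H: "\<And>\<delta>. \<delta> > 0 \<Longrightarrow>
      \<exists>C. \<forall>x\<le>0. \<bar>real_of_int (walk \<eta> x) + \<rho> * real_of_int x\<bar> \<le> C - \<delta> * real_of_int x"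
    using assms unfolding sloped_def by blast
  have "\<exists>C. \<forall>x\<le>0. \<bar>real_of_int (walk (bbs \<eta>) x) + \<rho> * real_of_int x\<bar> \<le> C - \<delta> * real_of_int x"
    if "\<delta> > 0" for \<delta>
  proof -
    define d where "d = min \<rho> (\<delta> / 3)"
    have d: "d > 0" "d \<le> \<rho>" "3 * d \<le> \<delta>" using that \<rho> by (auto simp: d_def)
    from H[OF d(1)] obtain C where
      C: "\<And>x. x \<le> 0 \<Longrightarrow> \<bar>real_of_int (walk \<eta> x) + \<rho> * real_of_int x\<bar> \<le> C - d * real_of_int x" by auto
    have "\<bar>real_of_int (walk (bbs \<eta>) x) + \<rho> * real_of_int x\<bar> \<le> (3 * C + \<bar>real_of_int c\<bar>) - \<delta> * real_of_int x"
      if x: "x \<le> 0" for x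
    proof -
      define I where "I = real_of_int (walk \<eta> (last_record \<eta> x))"
      define r where "r = real_of_int (last_record \<eta> x)"
      have r: "r \<le> real_of_int x" "last_record \<eta> x \<le> x" using last_record(2)[OF rec] by (auto simp: r_def)
      have "\<bar>I + \<rho> * r\<bar> \<le> C - d * r" using C[of "last_record \<eta> x"] r x by (simp add: I_def r_def)
      hence "I \<ge> - (\<rho> - d) * r - C" by (simp add: abs_le_iff algebra_simps)
      moreover have "(\<rho> - d) * (real_of_int x - r) \<ge> 0" using d r by simp
      ultimately have lo: "I + \<rho> * real_of_int x \<ge> d * real_of_int x - C" by (simp add: algebra_simps)
      have hi: "I \<le> real_of_int (walk \<eta> x)" using le[of x] by (simp add: I_def)
      have w: "real_of_int (walk (bbs \<eta>) x) = 2 * I - real_of_int (walk \<eta> x) + real_of_int c"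
        using c[of x] by (simp add: I_def)
      have "\<delta> * real_of_int x \<le> 3 * (d * real_of_int x)"
      proof -
        have "\<delta> * real_of_int x \<le> (3 * d) * real_of_int x"
          using d x by (intro mult_right_mono_neg) auto
        thus ?thesis by simp
      qed
      thus ?thesis using lo hi w C[OF x] by (simp add: abs_le_iff) linarith
    qed
    thus ?thesis by blast
  qed
  moreover have "\<exists>x. walk (bbs \<eta>) x \<le> B" for B
  proof -
    obtain x where "walk \<eta> x \<le> B - c" using assms unfolding sloped_def by blast
    thus ?thesis using c[of x] le[of x] by (intro exI[of _ x]) simp
  qed
  ultimately show ?thesis using \<rho> by (auto simp: sloped_def)
qed

lemma density_bound:
  fixes f :: "nat \<Rightarrow> real"
  assumes "(\<lambda>n. f n / real n) \<longlonglongrightarrow> l" "\<delta> > 0"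
  shows "\<exists>C. \<forall>n. \<bar>f n - l * real n\<bar> \<le> C + \<delta> * real n"
proof -
  obtain N where N: "\<And>n. n \<ge> N \<Longrightarrow> \<bar>f n / real n - l\<bar> < \<delta>"
    using assms by (auto simp: lim_sequentially dist_real_def)
  define C where "C = (\<Sum>n\<le>N. \<bar>f n - l * real n\<bar>)"
  have "\<bar>f n - l * real n\<bar> \<le> C + \<delta> * real n" for n
  proof (cases "n \<le> N")
    case True
    hence "\<bar>f n - l * real n\<bar> \<le> C" unfolding C_def by (intro member_le_sum) auto
    thus ?thesis using assms(2) by (smt (verit) mult_nonneg_nonneg of_nat_0_le_iff)
  next
    case False
    hence n: "n \<ge> N" "real n > 0" by auto
    have "\<bar>f n - l * real n\<bar> = \<bar>f n / real n - l\<bar> * real n" using n by (simp add: abs_if field_simps)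
    also have "\<dots> \<le> \<delta> * real n" using N[OF n(1)] n by (intro mult_right_mono) auto
    finally show ?thesis using sum_nonneg[of "{..N}" "\<lambda>n. \<bar>f n - l * real n\<bar>"] by (auto simp: C_def intro: order_trans)
  qed
  thus ?thesis by blast
qed

lemma walk_pos: "real_of_int (walk \<eta> (int n)) = 2 * (\<Sum>y=1..n. of_bool (\<eta> (int y))) - real n"
proof (induction n)
  case (Suc n)
  have "real_of_int (walk \<eta> (int (Suc n))) = real_of_int (walk \<eta> (int n)) + (2 * of_bool (\<eta> (int (Suc n))) - 1)"
    using walk_step[of \<eta> "int (Suc n)"] by (simp add: of_bool_def)
  thus ?case using Suc by (simp add: algebra_simps del: sum_of_bool_eq)
qed simp

lemma walk_neg:
  "real_of_int (walk \<eta> (- int n)) =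
     real n - 2 * (\<Sum>y=1..n. of_bool (\<eta> (- int y))) + 2 * of_bool (\<eta> (- int n)) - 2 * of_bool (\<eta> 0)"
proof (induction n)
  case (Suc n)
  have "- int (Suc n) = - int n - 1" by simp
  hence "walk \<eta> (- int (Suc n)) = walk \<eta> (- int n) - (2 * of_bool (\<eta> (- int n)) - 1)"
    using walk_step[of \<eta> "- int n"] by presburger
  hence "real_of_int (walk \<eta> (- int (Suc n))) = real_of_int (walk \<eta> (- int n)) - (2 * of_bool (\<eta> (- int n)) - 1)"
    by (simp add: of_bool_def)
  thus ?case using Suc by (simp add: algebra_simps del: sum_of_bool_eq)
qed simp

lemma Omega_sloped:
  assumes "\<eta> \<in> Omega"
  shows "sloped \<eta>"
proof -
  obtain l1 l2 where l1: "l1 < 1/2" "(\<lambda>n. (\<Sum>y=1..n. of_bool (\<eta> (int y))) / real n) \<longlonglongrightarrow> l1"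
    and l2: "l2 < 1/2" "(\<lambda>n. (\<Sum>y=1..n. of_bool (\<eta> (- int y))) / real n) \<longlonglongrightarrow> l2"
    using assms by (auto simp: Omega_def)
  have "\<exists>C. \<forall>x\<le>0. \<bar>real_of_int (walk \<eta> x) + (1 - 2 * l2) * real_of_int x\<bar> \<le> C - \<delta> * real_of_int x"
    if d: "\<delta> > 0" for \<delta>
  proof -
    obtain C where C: "\<And>n. \<bar>(\<Sum>y=1..n. of_bool (\<eta> (- int y))) - l2 * real n\<bar> \<le> C + \<delta>/2 * real n"
      using density_bound[OF l2(2), of "\<delta>/2"] d by auto
    have "\<bar>real_of_int (walk \<eta> x) + (1 - 2 * l2) * real_of_int x\<bar> \<le> 2 * C + 4 - \<delta> * real_of_int x"
      if "x \<le> 0" for x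
    proof -
      define n where "n = nat (- x)"
      have x: "x = - int n" using that by (simp add: n_def)
      define s :: real where "s = (\<Sum>y=1..n. of_bool (\<eta> (- int y)))"
      have "\<bar>s - l2 * real n\<bar> \<le> C + \<delta>/2 * real n" using C[of n] by (simp add: s_def)
      moreover have "real_of_int (walk \<eta> x) + (1 - 2 * l2) * real_of_int x
        = - 2 * (s - l2 * real n) + 2 * of_bool (\<eta> (- int n)) - 2 * of_bool (\<eta> 0)"
        using walk_neg[of \<eta> n] by (simp add: x s_def algebra_simps)
      ultimately show ?thesis by (auto simp: x abs_le_iff of_bool_def)
    qed
    thus ?thesis by blast
  qed
  moreover have "1 - 2 * l2 > 0" using l2 by simp
  moreover have "\<exists>x. walk \<eta> x \<le> B" for B
  proof -
    define d where "d = (1/2 - l1) / 2"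
    have d: "d > 0" using l1 by (simp add: d_def)
    obtain C where C: "\<And>n. \<bar>(\<Sum>y=1..n. of_bool (\<eta> (int y))) - l1 * real n\<bar> \<le> C + d * real n"
      using density_bound[OF l1(2) d] by auto
    obtain n :: nat where n: "(2 * C - B) / (2 * d) \<le> real n" using real_arch_simple by blast
    hence "2 * C - B \<le> 2 * d * real n" using d by (simp add: field_simps)
    moreover have "real_of_int (walk \<eta> (int n)) \<le> 2 * C + 2 * d * real n + (2 * l1 - 1) * real n"
      using C[of n] walk_pos[of \<eta> n] by (simp add: abs_le_iff algebra_simps)
    moreover have "(2 * l1 - 1) * real n = - (4 * d * real n)" by (simp add: d_def field_simps)
    ultimately have "real_of_int (walk \<eta> (int n)) \<le> B" by linarith
    thus ?thesis by (intro exI[of _ "int n"]) simp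
  qed
  ultimately show ?thesis unfolding sloped_def by blast
qed

lemma sloped_iterate: "sloped \<eta> \<Longrightarrow> sloped ((bbs ^^ n) \<eta>)"
  by (induction n) (auto intro: sloped_bbs)

section \<open>The enumeration of the records\<close>

lemma s_inf:
  assumes "recurrent \<eta>"
  shows "enumerates (s_inf \<eta>) {x. is_record \<eta> x}" "s_inf \<eta> 0 = last_record \<eta> 0"
proof -
  let ?S = "{x. is_record \<eta> x}"
  have "\<exists>s. enumerates s ?S \<and> s 0 = last_record \<eta> 0"
    using assms last_record(1)[OF assms, of 0] by (intro enumerates_exists) (auto simp: recurrent_def)
  then obtain s where s: "enumerates s ?S" "s 0 = last_record \<eta> 0" by blast
  have "s_inf \<eta> = s" unfolding s_inf_def
  proof (rule the_equality)
    show "strict_mono s \<and> range s = ?S \<and> s 0 = (GREATEST x. is_record \<eta> x \<and> x \<le> 0)"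
      using s by (auto simp: enumerates_def last_record_def)
  next
    fix t :: "int \<Rightarrow> int" assume "strict_mono t \<and> range t = ?S \<and> t 0 = (GREATEST x. is_record \<eta> x \<and> x \<le> 0)"
    thus "t = s" using s by (intro enumerates_unique[of t ?S]) (auto simp: enumerates_def last_record_def)
  qed
  thus "enumerates (s_inf \<eta>) ?S" "s_inf \<eta> 0 = last_record \<eta> 0" using s by auto
qed

definition consecutive :: "config \<Rightarrow> int \<Rightarrow> int \<Rightarrow> bool" where
  "consecutive \<eta> r r' \<longleftrightarrow> is_record \<eta> r \<and> is_record \<eta> r' \<and> r < r' \<and> (\<forall>x. r < x \<and> x < r' \<longrightarrow> \<not> is_record \<eta> x)"

lemma consecutive_iff:
  assumes "recurrent \<eta>"
  shows "consecutive \<eta> r r' \<longleftrightarrow> (\<exists>i. r = s_inf \<eta> i \<and> r' = s_inf \<eta> (i + 1))"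
proof -
  note e = s_inf(1)[OF assms]
  have sm: "strict_mono (s_inf \<eta>)" and ra: "range (s_inf \<eta>) = {x. is_record \<eta> x}"
    using e by (auto simp: enumerates_def)
  show ?thesis
  proof
    assume c: "consecutive \<eta> r r'"
    then obtain i j where ij: "r = s_inf \<eta> i" "r' = s_inf \<eta> j" using ra by (force simp: consecutive_def)
    have "i < j" using c ij sm by (simp add: consecutive_def strict_mono_less)
    moreover have "\<not> i + 1 < j"
    proof
      assume "i + 1 < j"
      hence "r < s_inf \<eta> (i + 1)" "s_inf \<eta> (i + 1) < r'" using ij sm by (auto simp: strict_mono_less)
      moreover have "is_record \<eta> (s_inf \<eta> (i + 1))" using ra by auto
      ultimately show False using c by (auto simp: consecutive_def)
    qed
    ultimately have "j = i + 1" by simp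
    thus "\<exists>i. r = s_inf \<eta> i \<and> r' = s_inf \<eta> (i + 1)" using ij by auto
  next
    assume "\<exists>i. r = s_inf \<eta> i \<and> r' = s_inf \<eta> (i + 1)"
    then obtain i where i: "r = s_inf \<eta> i" "r' = s_inf \<eta> (i + 1)" by blast
    have "is_record \<eta> r" "is_record \<eta> r'" using ra i by auto
    moreover have "r < r'" using i sm by (simp add: strict_mono_less)
    ultimately show "consecutive \<eta> r r'"
      using enumerates_no_between[OF e] i by (auto simp: consecutive_def)
  qed
qed

lemma consecutive_exists:
  assumes "recurrent \<eta>" "\<not> is_record \<eta> x"
  shows "\<exists>r r'. consecutive \<eta> r r' \<and> r < x \<and> x < r'"
proof -
  note e = s_inf(1)[OF assms(1)]
  have sm: "strict_mono (s_inf \<eta>)" and ra: "range (s_inf \<eta>) = {x. is_record \<eta> x}"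
    using e by (auto simp: enumerates_def)
  define i where "i = idx (s_inf \<eta>) x"
  have "s_inf \<eta> i \<le> x" "x < s_inf \<eta> (i + 1)" using idx_le[OF sm] less_idx_Suc[OF sm] by (auto simp: i_def)
  moreover have "is_record \<eta> (s_inf \<eta> i)" using ra by auto
  hence "s_inf \<eta> i \<noteq> x" using assms(2) by auto
  ultimately have "s_inf \<eta> i < x" "x < s_inf \<eta> (i + 1)" by auto
  moreover have "consecutive \<eta> (s_inf \<eta> i) (s_inf \<eta> (i + 1))" using consecutive_iff[OF assms(1)] by blast
  ultimately show ?thesis by blast
qed

lemma solitons_consecutive:
  assumes "recurrent \<eta>"
  shows "solitons k \<eta> =
    {\<gamma>. card \<gamma> = 2 * k \<and> (\<exists>r r'. consecutive \<eta> r r' \<and> \<gamma> \<in> ts_solitons \<eta> [r + 1..r' - 1])}"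
  unfolding solitons_def using consecutive_iff[OF assms] by auto

section \<open>Removal of the first seat\<close>

text \<open>A ball lands on seat \<open>1\<close> exactly when it comes after an empty site, and seat \<open>1\<close> is emptied exactly
  when an empty site comes after a ball.  The other sites are the records and those of the seats
  beyond the first.\<close>

definition slots :: "config \<Rightarrow> int set" where
  "slots \<eta> = {x. \<eta> x = \<eta> (x - 1)}"

text \<open>The number of pairs of deleted sites between two consecutive slots; this is the count
  \<open>\<zeta>\<close> at the lowest level (\<open>zeta_tower\<close>).\<close>

definition gap_pairs :: "(int \<Rightarrow> int) \<Rightarrow> int \<Rightarrow> int" where
  "gap_pairs s i = (s (i + 1) - s i - 1) div 2"

lemma record_slot: "is_record \<eta> x \<Longrightarrow> x \<in> slots \<eta>"
  using recordD[of \<eta> x] by (simp add: slots_def)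

lemma slot_map_exists:
  assumes "recurrent \<eta>"
  shows "\<exists>s. enumerates s (slots \<eta>) \<and> (is_record \<eta> 0 \<longrightarrow> s 0 = 0)"
proof -
  define x0 where "x0 = last_record \<eta> 0"
  have "x0 \<in> slots \<eta>" using last_record(1)[OF assms] record_slot by (auto simp: x0_def)
  then obtain s where "enumerates s (slots \<eta>)" "s 0 = x0"
    using enumerates_exists[of "slots \<eta>" x0] assms record_slot unfolding recurrent_def by blast
  thus ?thesis using last_record_record[OF assms, of 0] by (auto simp: x0_def)
qed

text \<open>The enumeration \<open>s\<close> of the slots is not anchored, so that one can follow its labels in time.
  The contracted configuration is \<open>\<omega> = \<eta> \<circ> s\<close>.\<close>

locale slot_map =
  fixes \<eta> :: config and s :: "int \<Rightarrow> int"
  assumes recurrent: "recurrent \<eta>" and enum: "enumerates s (slots \<eta>)"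
begin

definition \<omega> :: config where "\<omega> = \<eta> \<circ> s"

lemma mono: "strict_mono s" and range_s: "range s = slots \<eta>"
  using enum by (auto simp: enumerates_def)

lemma s_less: "s i < s j \<longleftrightarrow> i < j" and s_le: "s i \<le> s j \<longleftrightarrow> i \<le> j"
  using mono by (auto simp: strict_mono_less strict_mono_less_eq)

lemma s_slot: "\<eta> (s i) = \<eta> (s i - 1)"
  using range_s by (auto simp: slots_def)

lemma between: "s i < x \<Longrightarrow> x < s (i + 1) \<Longrightarrow> \<eta> x \<noteq> \<eta> (x - 1)"
  using enumerates_no_between[OF enum, of i x] by (simp add: slots_def)

lemma alternating:
  assumes "s i \<le> x" "x < s (i + 1)"
  shows "\<eta> x \<longleftrightarrow> (\<omega> i \<longleftrightarrow> even (x - s i))"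
  using assms
proof (induction x rule: int_ge_induct)
  case base thus ?case by (simp add: \<omega>_def)
next
  case (step x)
  have "\<eta> (x + 1) \<noteq> \<eta> x" using between[of i "x + 1"] step by simp
  moreover have "even (x + 1 - s i) \<longleftrightarrow> odd (x - s i)" by presburger
  ultimately show ?case using step by auto
qed

text \<open>The letters alternate strictly inside a gap, and the slot that ends the gap repeats the letter
  before it.  So the parity of the gap tells whether the two slots differ.\<close>

lemma gap: "s (i + 1) = s i + 1 + 2 * gap_pairs s i + of_bool (\<omega> (i + 1) \<noteq> \<omega> i)"
proof -
  have lt: "s i < s (i + 1)" by (simp add: s_less)
  define m where "m = s (i + 1) - s i - 1"
  have "\<omega> (i + 1) \<longleftrightarrow> (\<omega> i \<longleftrightarrow> even m)"
    using alternating[of i "s (i + 1) - 1"] s_slot[of "i + 1"] lt by (simp add: \<omega>_def m_def algebra_simps)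
  hence "of_bool (\<omega> (i + 1) \<noteq> \<omega> i) = m mod 2" by (auto simp: of_bool_def even_iff_mod_2_eq_zero)
  moreover have "m = 2 * (m div 2) + m mod 2" by simp
  ultimately show ?thesis by (simp add: gap_pairs_def m_def)
qed

lemma gap_pairs_nonneg: "0 \<le> gap_pairs s i"
  using s_less[of i "i + 1"] by (simp add: gap_pairs_def)

lemma idx_slot: "x \<in> slots \<eta> \<Longrightarrow> s (idx s x) = x"
  using apply_idx[OF enum] .

lemma idx_step: "idx s x = idx s (x - 1) + of_bool (\<eta> x = \<eta> (x - 1))"
  using idx_increment[OF enum, of x] by (simp add: slots_def)

text \<open>Inside a gap the walk oscillates by one around a constant; subtracting the letter itself (the
  occupation of seat \<open>1\<close>) removes the oscillation.\<close>

lemma walk_contract: "\<exists>c. \<forall>x. walk \<eta> x - of_bool (\<eta> x) = walk \<omega> (idx s x) + c"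
proof -
  define d where "d x = walk \<eta> x - of_bool (\<eta> x) - walk \<omega> (idx s x)" for x
  have step: "d x = d (x - 1)" for x
  proof (cases "\<eta> x = \<eta> (x - 1)")
    case True
    have i: "idx s x = idx s (x - 1) + 1" using idx_step[of x] True by simp
    have "\<omega> (idx s x) = \<eta> x" using idx_slot[of x] True by (simp add: \<omega>_def slots_def)
    thus ?thesis using walk_step[of \<eta> x] walk_step[of \<omega> "idx s x"] i True by (simp add: d_def)
  next
    case False
    have i: "idx s x = idx s (x - 1)" using idx_step[of x] False by simp
    have "\<eta> (x - 1) \<longleftrightarrow> \<not> \<eta> x" using False by auto
    thus ?thesis using walk_step[of \<eta> x] i by (simp add: d_def of_bool_def)
  qed
  have all: "d x = d 0" for x
  proof (induction x rule: int_induct[of _ 0])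
    case (step1 i) thus ?case using step[of "i + 1"] by simp
  next
    case (step2 i) thus ?case using step[of i] by simp
  qed simp
  have "walk \<eta> x - of_bool (\<eta> x) = walk \<omega> (idx s x) + d 0" for x
    using all[of x] unfolding d_def[of x] by linarith
  thus ?thesis by blast
qed

lemma record_iff: "is_record \<omega> i \<longleftrightarrow> is_record \<eta> (s i)"
proof -
  obtain c where c: "\<And>x. walk \<eta> x - of_bool (\<eta> x) = walk \<omega> (idx s x) + c" using walk_contract by blast
  show ?thesis
  proof
    assume r: "is_record \<eta> (s i)"
    show "is_record \<omega> i" unfolding is_record_iff
    proof (intro allI impI)
      fix j assume "j < i"
      hence lt: "s j < s i" by (simp add: s_less)
      have ri: "walk \<eta> (s i) = walk \<omega> i + c" using c[of "s i"] recordD(1)[OF r] mono by simp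
      have rj: "walk \<eta> (s j) - of_bool (\<eta> (s j)) = walk \<omega> j + c" using c[of "s j"] mono by simp
      have "walk \<eta> (s i) < walk \<eta> (s j)" "walk \<eta> (s i) < walk \<eta> (s j - 1)"
        using r lt by (auto simp: is_record_iff)
      thus "walk \<omega> i < walk \<omega> j" using ri rj walk_step[of \<eta> "s j"] by (cases "\<eta> (s j)") auto
    qed
  next
    assume r: "is_record \<omega> i"
    have n: "\<not> \<eta> (s i)" using recordD(1)[OF r] by (simp add: \<omega>_def)
    show "is_record \<eta> (s i)" unfolding is_record_iff
    proof (intro allI impI)
      fix z assume "z < s i"
      hence "idx s z < i" using idx_less_iff[OF mono] by simp
      hence "walk \<omega> i < walk \<omega> (idx s z)" using r by (simp add: is_record_iff)
      thus "walk \<eta> (s i) < walk \<eta> z" using c[of z] c[of "s i"] n mono by (cases "\<eta> z") auto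
    qed
  qed
qed

lemma record_idx: "is_record \<eta> x \<Longrightarrow> is_record \<omega> (idx s x)"
  using record_iff idx_slot record_slot by simp

lemma recurrent_\<omega>: "recurrent \<omega>"
  unfolding recurrent_def
proof (intro conjI allI)
  fix i
  obtain y where y: "is_record \<eta> y" "y \<le> s i" using recurrent by (auto simp: recurrent_def)
  hence "idx s y \<le> i" using idx_mono[OF mono y(2)] mono by simp
  thus "\<exists>j\<le>i. is_record \<omega> j" using record_idx y by blast
  obtain y where y: "is_record \<eta> y" "s i \<le> y" using recurrent by (auto simp: recurrent_def)
  hence "i \<le> idx s y" using le_idx_iff[OF mono] by simp
  thus "\<exists>j\<ge>i. is_record \<omega> j" using record_idx y by blast
qed

subsection \<open>Compatibility with the dynamics\<close>

text \<open>The slots after one step of the dynamics, with labels that follow the solitons.\<close>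

definition s' :: "int \<Rightarrow> int" where "s' i = s i + of_bool (is_record \<omega> i)"

text \<open>Away from records the dynamics flips all letters, which preserves slots.  A record site, which the
  dynamics keeps empty, is no longer a slot unless the site before it is a record as well; and the
  site after a record becomes a slot, since it is empty afterwards in any case.\<close>

lemma slots_bbs: "x \<in> slots (bbs \<eta>) \<longleftrightarrow> (x \<in> slots \<eta> \<and> \<not> is_record \<eta> x) \<or> is_record \<eta> (x - 1)"
proof -
  consider "is_record \<eta> (x - 1)" | "\<not> is_record \<eta> (x - 1)" "is_record \<eta> x"
    | "\<not> is_record \<eta> (x - 1)" "\<not> is_record \<eta> x" by blast
  thus ?thesis
  proof cases
    case 1 thus ?thesis using record_Suc[of \<eta> x] by (auto simp: slots_def bbs_def)
  next
    case 2 thus ?thesis using recordD(2)[of \<eta> x] by (simp add: slots_def bbs_def)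
  next
    case 3 thus ?thesis by (simp add: slots_def bbs_def)
  qed
qed

lemma s'_mono: "s' i < s' (i + 1)"
proof (cases "is_record \<omega> i \<and> \<not> is_record \<omega> (i + 1)")
  case True
  hence "\<not> \<omega> i" "\<omega> (i + 1)" using recordD(1)[of \<omega> i] record_Suc[of \<omega> "i + 1"] by auto
  thus ?thesis using gap[of i] gap_pairs_nonneg[of i] by (simp add: s'_def)
next
  case False
  thus ?thesis using s_less[of i "i + 1"] by (auto simp: s'_def)
qed

lemma range_s': "range s' = slots (bbs \<eta>)"
proof (intro equalityI subsetI)
  fix x assume "x \<in> range s'"
  then obtain i where i: "x = s' i" by auto
  show "x \<in> slots (bbs \<eta>)"
  proof (cases "is_record \<omega> i")
    case True
    hence "is_record \<eta> (x - 1)" using i record_iff by (simp add: s'_def)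
    thus ?thesis by (simp add: slots_bbs)
  next
    case False
    hence "x = s i" "\<not> is_record \<eta> x" using i record_iff by (simp_all add: s'_def)
    thus ?thesis using range_s by (auto simp: slots_bbs)
  qed
next
  fix x assume "x \<in> slots (bbs \<eta>)"
  hence "(x \<in> slots \<eta> \<and> \<not> is_record \<eta> x) \<or> is_record \<eta> (x - 1)" by (simp add: slots_bbs)
  thus "x \<in> range s'"
  proof
    assume *: "x \<in> slots \<eta> \<and> \<not> is_record \<eta> x"
    hence "s' (idx s x) = x" using record_iff[of "idx s x"] idx_slot[of x] by (simp add: s'_def)
    thus ?thesis by (metis rangeI)
  next
    assume *: "is_record \<eta> (x - 1)"
    hence "s' (idx s (x - 1)) = x"
      using record_idx[OF *] idx_slot[OF record_slot[OF *]] by (simp add: s'_def)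
    thus ?thesis by (metis rangeI)
  qed
qed

lemma enum_s': "enumerates s' (slots (bbs \<eta>))"
  unfolding enumerates_def using range_s' s'_mono by (intro conjI strict_mono_intI) auto

text \<open>Deletion and dynamics commute when the labels are moved by \<open>s'\<close>.\<close>

lemma bbs_contract: "bbs \<omega> = bbs \<eta> \<circ> s'"
proof
  fix i
  show "bbs \<omega> i = (bbs \<eta> \<circ> s') i"
  proof (cases "is_record \<omega> i")
    case True
    hence "is_record \<eta> (s i)" using record_iff by simp
    hence "\<not> bbs \<eta> (s i + 1)" using record_Suc[of \<eta> "s i + 1"] by (auto simp: bbs_def)
    thus ?thesis using True by (simp add: s'_def bbs_def)
  next
    case False
    hence "\<not> is_record \<eta> (s i)" using record_iff by simp
    thus ?thesis using False by (simp add: s'_def bbs_def \<omega>_def)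
  qed
qed

text \<open>A gap changes its length only at the border between a record and a non-record, by one site, and
  this is exactly the change of the letters at its ends.\<close>

lemma gap_pairs_bbs: "gap_pairs s' i = gap_pairs s i"
proof -
  have g: "s (i + 1) = s i + 1 + 2 * gap_pairs s i + of_bool (\<omega> (i + 1) \<noteq> \<omega> i)" by (rule gap)
  show ?thesis
  proof (cases "is_record \<omega> i = is_record \<omega> (i + 1)")
    case True thus ?thesis by (simp add: gap_pairs_def s'_def)
  next
    case False
    hence "is_record \<omega> i \<and> \<not> is_record \<omega> (i + 1) \<or> \<not> is_record \<omega> i \<and> is_record \<omega> (i + 1)" by auto
    thus ?thesis
    proof
      assume *: "is_record \<omega> i \<and> \<not> is_record \<omega> (i + 1)"
      hence "\<not> \<omega> i" "\<omega> (i + 1)" using recordD(1)[of \<omega> i] record_Suc[of \<omega> "i + 1"] by auto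
      hence "s' (i + 1) - s' i - 1 = 2 * gap_pairs s i" using g * by (simp add: s'_def)
      thus ?thesis by (simp add: gap_pairs_def[of s'])
    next
      assume *: "\<not> is_record \<omega> i \<and> is_record \<omega> (i + 1)"
      hence "\<not> \<omega> i" "\<not> \<omega> (i + 1)" using recordD[of \<omega> "i + 1"] by auto
      hence "s' (i + 1) - s' i - 1 = 2 * gap_pairs s i + 1" using g * by (simp add: s'_def)
      thus ?thesis by (simp add: gap_pairs_def[of s'])
    qed
  qed
qed

lemma consecutive_contract:
  assumes "consecutive \<eta> r r'"
  shows "consecutive \<omega> (idx s r) (idx s r')"
proof -
  have r: "is_record \<eta> r" "is_record \<eta> r'" "r < r'" using assms by (auto simp: consecutive_def)
  have sr: "s (idx s r) = r" "s (idx s r') = r'" using r idx_slot record_slot by auto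
  have "\<not> is_record \<omega> j" if j: "idx s r < j" "j < idx s r'" for j
  proof -
    have "r < s j" "s j < r'" using j sr s_less by metis+
    thus ?thesis using assms record_iff by (auto simp: consecutive_def)
  qed
  moreover have "idx s r < idx s r'" using r(3) sr s_less by metis
  ultimately show ?thesis using r record_idx by (auto simp: consecutive_def)
qed

lemma consecutive_expand:
  assumes "consecutive \<omega> i j"
  shows "consecutive \<eta> (s i) (s j)"
proof -
  have "\<not> is_record \<eta> x" if x: "s i < x" "x < s j" for x
  proof
    assume r: "is_record \<eta> x"
    have "s (idx s x) = x" using idx_slot record_slot r by auto
    hence "i < idx s x" "idx s x < j" using x s_less by metis+
    thus False using assms record_idx[OF r] by (auto simp: consecutive_def)
  qed
  thus ?thesis using assms record_iff s_less by (auto simp: consecutive_def)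
qed

end

lemma (in slot_map) slot_map_bbs:
  "recurrent (bbs \<eta>) \<Longrightarrow> slot_map (bbs \<eta>) s'"
  using enum_s' by unfold_locales

section \<open>The Takahashi--Satsuma algorithm under removal of the first seat\<close>

text \<open>The three functions read a word of sites from left to right.  The argument \<open>c\<close> is the letter of
  the last slot before the word, which for a word between two records is that of a record, so
  \<open>False\<close>.  The first collects the slots, the second the pairs of deleted sites, and the third the
  remaining deleted sites \<open>x\<close> together with the slot \<open>y\<close> right after them.\<close>

fun contract :: "config \<Rightarrow> bool \<Rightarrow> int list \<Rightarrow> int list" where
  "contract \<eta> c [] = []"
| "contract \<eta> c (x # w) = (if \<eta> x = c then x # contract \<eta> c w else contract \<eta> (\<eta> x) w)"

fun pairs :: "config \<Rightarrow> bool \<Rightarrow> int list \<Rightarrow> int set set" where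
  "pairs \<eta> c [] = {}"
| "pairs \<eta> c [x] = {}"
| "pairs \<eta> c (x # y # w) =
     (if \<eta> x = c then pairs \<eta> c (y # w)
      else if \<eta> y = c then insert {x, y} (pairs \<eta> c w) else pairs \<eta> (\<eta> y) w)"

fun heads :: "config \<Rightarrow> bool \<Rightarrow> int list \<Rightarrow> (int \<times> int) set" where
  "heads \<eta> c [] = {}"
| "heads \<eta> c [x] = {}"
| "heads \<eta> c (x # y # w) =
     (if \<eta> x = c then heads \<eta> c (y # w)
      else if \<eta> y = c then heads \<eta> c w else insert (x, y) (heads \<eta> (\<eta> y) w))"

text \<open>A soliton \<open>\<delta>\<close> of the contracted word gains one site in front of each of its two runs.\<close>

definition add_heads :: "(int \<times> int) set \<Rightarrow> int set \<Rightarrow> int set" where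
  "add_heads H \<delta> = \<delta> \<union> {x. \<exists>y\<in>\<delta>. (x, y) \<in> H}"

text \<open>The load of the carrier stays nonnegative and ends at \<open>0\<close>, when it starts at \<open>n\<close>.\<close>

fun balanced :: "config \<Rightarrow> int \<Rightarrow> int list \<Rightarrow> bool" where
  "balanced \<eta> n [] \<longleftrightarrow> n = 0"
| "balanced \<eta> n (x # w) \<longleftrightarrow>
     0 \<le> n + (2 * of_bool (\<eta> x) - 1) \<and> balanced \<eta> (n + (2 * of_bool (\<eta> x) - 1)) w"

abbreviation monochrome :: "config \<Rightarrow> bool \<Rightarrow> int list \<Rightarrow> bool" where
  "monochrome \<eta> a u \<equiv> \<forall>x\<in>set u. \<eta> x = a"

text \<open>Alternating runs of strictly decreasing lengths, all longer than \<open>k\<close>, after a last letter \<open>c\<close>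
  and ending with the letter \<open>c'\<close>: this is what lies before the run selected by the
  Takahashi--Satsuma algorithm.\<close>

fun decreasing_runs :: "config \<Rightarrow> nat \<Rightarrow> bool \<Rightarrow> int list list \<Rightarrow> bool \<Rightarrow> bool" where
  "decreasing_runs \<eta> k c [] c' \<longleftrightarrow> c' = c"
| "decreasing_runs \<eta> k c (r # rs) c' \<longleftrightarrow> k < length r \<and> monochrome \<eta> (\<not> c) r \<and>
     (rs \<noteq> [] \<longrightarrow> length (hd rs) < length r) \<and> decreasing_runs \<eta> k (\<not> c) rs c'"

lemma runs_append:
  assumes "u \<noteq> []" "monochrome \<eta> a u"
  shows "runs \<eta> (u @ v) = (u @ takeWhile (\<lambda>y. \<eta> y = a) v) # runs \<eta> (dropWhile (\<lambda>y. \<eta> y = a) v)"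
proof (cases u)
  case (Cons x u')
  hence "\<eta> x = a" "\<forall>y\<in>set u'. \<eta> y = a" using assms by auto
  thus ?thesis using Cons by (simp add: takeWhile_append2 dropWhile_append2)
qed (use assms in simp)

lemma runs_append_switch:
  assumes "u \<noteq> []" "monochrome \<eta> a u" "v \<noteq> [] \<longrightarrow> \<eta> (hd v) \<noteq> a"
  shows "runs \<eta> (u @ v) = u # runs \<eta> v"
  using runs_append[OF assms(1,2), of v] assms(3) by (cases v) auto

lemma runs_Cons_split:
  assumes "w \<noteq> []"
  obtains r v where "w = r @ v" "r \<noteq> []" "monochrome \<eta> (\<eta> (hd w)) r"
    "v \<noteq> [] \<longrightarrow> \<eta> (hd v) = (\<not> \<eta> (hd w))" "runs \<eta> w = r # runs \<eta> v" "length v < length w"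
proof -
  obtain x w' where w: "w = x # w'" using assms by (cases w) auto
  let ?r = "x # takeWhile (\<lambda>y. \<eta> y = \<eta> x) w'" and ?v = "dropWhile (\<lambda>y. \<eta> y = \<eta> x) w'"
  have "w = ?r @ ?v" using w by simp
  moreover have "monochrome \<eta> (\<eta> (hd w)) ?r" using w by (auto dest: set_takeWhileD)
  moreover have "?v \<noteq> [] \<longrightarrow> \<eta> (hd ?v) = (\<not> \<eta> (hd w))" using w hd_dropWhile[of "\<lambda>y. \<eta> y = \<eta> x" w'] by auto
  moreover have "runs \<eta> w = ?r # runs \<eta> ?v" using w by simp
  moreover have "length ?v < length w" using w by (simp add: le_imp_less_Suc length_dropWhile_le)
  ultimately show ?thesis using that[of ?r ?v] by blast
qed

lemma select_split:
  assumes "ts_select (runs \<eta> w) \<noteq> []"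
  shows "\<exists>rs A B post c'. w = concat rs @ A @ B @ post \<and> decreasing_runs \<eta> (length A) (\<not> \<eta> (hd w)) rs c' \<and> A \<noteq> []
    \<and> monochrome \<eta> (\<not> c') A \<and> monochrome \<eta> c' B \<and> length A = length B \<and> ts_select (runs \<eta> w) = A @ B
    \<and> hd (rs @ [A]) = hd (runs \<eta> w)"
  using assms
proof (induction "length w" arbitrary: w rule: less_induct)
  case less
  have "w \<noteq> []" using less.prems by auto
  from this obtain r v where rv: "w = r @ v" "r \<noteq> []" "monochrome \<eta> (\<eta> (hd w)) r"
    "v \<noteq> [] \<longrightarrow> \<eta> (hd v) = (\<not> \<eta> (hd w))" "runs \<eta> w = r # runs \<eta> v" "length v < length w"
    by (rule runs_Cons_split)
  have "v \<noteq> []" using less.prems rv(5) by auto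
  from this obtain r' v' where rv': "v = r' @ v'" "r' \<noteq> []" "monochrome \<eta> (\<eta> (hd v)) r'"
    "runs \<eta> v = r' # runs \<eta> v'" by (rule runs_Cons_split)
  have hv: "\<eta> (hd v) = (\<not> \<eta> (hd w))" using rv(4) \<open>v \<noteq> []\<close> by simp
  show ?case
  proof (cases "length r \<le> length r'")
    case True
    let ?B = "take (length r) r'" and ?post = "drop (length r) r' @ v'"
    have "w = concat [] @ r @ ?B @ ?post" using rv(1) rv'(1) by simp
    moreover have "monochrome \<eta> (\<not> \<eta> (hd w)) ?B" using rv'(3) hv by (auto dest: in_set_takeD)
    moreover have "ts_select (runs \<eta> w) = r @ ?B" using True rv(5) rv'(4) by simp
    moreover have "length r = length ?B" using True by simp
    moreover have "decreasing_runs \<eta> (length r) (\<not> \<eta> (hd w)) [] (\<not> \<eta> (hd w))" by simp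
    moreover have "monochrome \<eta> (\<not> \<not> \<eta> (hd w)) r" using rv(3) by simp
    moreover have "hd ([] @ [r]) = hd (runs \<eta> w)" using rv(5) by simp
    ultimately show ?thesis using rv(2) by blast
  next
    case False
    hence sel: "ts_select (runs \<eta> w) = ts_select (runs \<eta> v)" using rv(5) rv'(4) by simp
    obtain rs A B post c' where IH: "v = concat rs @ A @ B @ post" "decreasing_runs \<eta> (length A) (\<not> \<eta> (hd v)) rs c'"
      "A \<noteq> []" "monochrome \<eta> (\<not> c') A" "monochrome \<eta> c' B" "length A = length B" "ts_select (runs \<eta> v) = A @ B"
      "hd (rs @ [A]) = hd (runs \<eta> v)"
      using less.hyps[OF rv(6)] less.prems sel by auto
    have h: "hd (rs @ [A]) = r'" using IH(8) by (simp only: rv'(4) list.sel)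
    have "length A < length r"
    proof (cases rs)
      case Nil thus ?thesis using h False by simp
    next
      case (Cons a list)
      thus ?thesis using h False IH(2) by simp
    qed
    moreover have "rs \<noteq> [] \<longrightarrow> length (hd rs) < length r" using h False by (cases rs) auto
    ultimately have "decreasing_runs \<eta> (length A) (\<not> \<eta> (hd w)) (r # rs) c'" using IH(2) rv(3) hv by simp
    moreover have "w = concat (r # rs) @ A @ B @ post" by (subst rv(1), subst IH(1)) simp
    moreover have "ts_select (runs \<eta> w) = A @ B" using sel IH(7) by simp
    moreover have "hd ((r # rs) @ [A]) = hd (runs \<eta> w)" by (simp only: rv(5) list.sel append_Cons)
    ultimately show ?thesis using IH(3-6) by blast
  qed
qed

lemma select_intro:
  assumes "decreasing_runs \<eta> (length A) c rs c'" "A \<noteq> []" "monochrome \<eta> (\<not> c') A" "monochrome \<eta> c' B" "length A = length B"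
  shows "ts_select (runs \<eta> (concat rs @ A @ B @ post)) = A @ B"
  using assms(1)
proof (induction rs arbitrary: c)
  case Nil
  have B: "B \<noteq> []" using assms by auto
  hence "\<eta> (hd (B @ post)) = c'" using assms(4) by (cases B) auto
  hence "runs \<eta> (A @ B @ post) = A # runs \<eta> (B @ post)"
    using assms by (intro runs_append_switch[of A _ "\<not> c'"]) auto
  moreover obtain u where "runs \<eta> (B @ post) = (B @ takeWhile (\<lambda>y. \<eta> y = c') post) # u"
    using runs_append[OF B assms(4)] by blast
  ultimately show ?case using assms by simp
next
  case (Cons r rs)
  let ?v = "concat rs @ A @ B @ post"
  have IH: "ts_select (runs \<eta> ?v) = A @ B" using Cons.IH[of "\<not> c"] Cons.prems by simp
  have r: "r \<noteq> []" "monochrome \<eta> (\<not> c) r" using Cons.prems by auto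
  define A0 where "A0 = hd (rs @ [A])"
  have A0: "A0 \<noteq> []" "monochrome \<eta> c A0" "length A0 < length r"
    using Cons.prems assms by (cases rs; auto simp: A0_def)+
  obtain v' where v': "?v = A0 @ v'" "v' \<noteq> [] \<longrightarrow> \<eta> (hd v') \<noteq> c"
  proof (cases rs)
    case Nil
    have "\<eta> (hd (B @ post)) = c'" using assms by (cases B) auto
    thus ?thesis using that[of "B @ post"] Nil Cons.prems by (auto simp: A0_def)
  next
    case (Cons r1 rs1)
    note c1 = Cons
    have "\<eta> (hd (concat rs1 @ A @ B @ post)) = (\<not> c)"
    proof (cases rs1)
      case Nil thus ?thesis using c1 Cons.prems assms \<open>decreasing_runs \<eta> (length A) c (r # rs) c'\<close> by (cases A) auto
    next
      case (Cons r2 rs2)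
      thus ?thesis using c1 \<open>decreasing_runs \<eta> (length A) c (r # rs) c'\<close> by (cases r2) auto
    qed
    thus ?thesis using that[of "concat rs1 @ A @ B @ post"] c1 by (auto simp: A0_def)
  qed
  have "\<eta> (hd ?v) \<noteq> (\<not> c)" using v' A0 by (cases A0) auto
  hence "runs \<eta> (r @ ?v) = r # runs \<eta> ?v" using r by (intro runs_append_switch[of r \<eta> "\<not> c"]) blast+
  moreover have "runs \<eta> ?v = A0 # runs \<eta> v'" using v' A0 by (metis runs_append_switch)
  ultimately show ?case using IH A0(3) by simp
qed

lemma contract_const: "monochrome \<eta> c u \<Longrightarrow> contract \<eta> c (u @ v) = u @ contract \<eta> c v"
  by (induction u) auto

lemma pairs_skip: "\<eta> x = c \<Longrightarrow> pairs \<eta> c (x # w) = pairs \<eta> c w"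
  by (cases w) auto

lemma heads_skip: "\<eta> x = c \<Longrightarrow> heads \<eta> c (x # w) = heads \<eta> c w"
  by (cases w) auto

lemma pairs_const: "monochrome \<eta> c u \<Longrightarrow> pairs \<eta> c (u @ v) = pairs \<eta> c v"
  by (induction u) (auto simp: pairs_skip)

lemma heads_const: "monochrome \<eta> c u \<Longrightarrow> heads \<eta> c (u @ v) = heads \<eta> c v"
  by (induction u) (auto simp: heads_skip)

lemma run_effect:
  assumes "2 \<le> length r" "monochrome \<eta> (\<not> c) r"
  shows "contract \<eta> c (r @ v) = tl r @ contract \<eta> (\<not> c) v"
    "pairs \<eta> c (r @ v) = pairs \<eta> (\<not> c) v"
    "heads \<eta> c (r @ v) = insert (r ! 0, r ! 1) (heads \<eta> (\<not> c) v)"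
proof -
  obtain x y u where r: "r = x # y # u" using assms(1) by (cases r; cases "tl r") auto
  have l: "\<eta> x = (\<not> c)" "\<eta> y = (\<not> c)" "monochrome \<eta> (\<not> c) u" using assms r by auto
  show "contract \<eta> c (r @ v) = tl r @ contract \<eta> (\<not> c) v"
    using l r contract_const[OF l(3)] by simp
  show "pairs \<eta> c (r @ v) = pairs \<eta> (\<not> c) v" using l r pairs_const[OF l(3)] by simp
  show "heads \<eta> c (r @ v) = insert (r ! 0, r ! 1) (heads \<eta> (\<not> c) v)"
    using l r heads_const[OF l(3)] by simp
qed

lemma set_first_two:
  assumes "2 \<le> length r"
  shows "set r = insert (r ! 0) (set (tl r))" "r ! 1 \<in> set (tl r)"
proof -
  obtain x y u where "r = x # y # u" using assms by (cases r; cases "tl r") auto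
  thus "set r = insert (r ! 0) (set (tl r))" "r ! 1 \<in> set (tl r)" by auto
qed

text \<open>Runs of length at least two are only shortened by one: they contribute no pair, and reading can
  restart behind them with their letter.\<close>

lemma desc_effect:
  assumes "decreasing_runs \<eta> k c rs c'" "1 \<le> k"
  shows "contract \<eta> c (concat rs @ v) = concat (map tl rs) @ contract \<eta> c' v"
    "pairs \<eta> c (concat rs @ v) = pairs \<eta> c' v"
    "heads \<eta> c (concat rs @ v) = (\<lambda>r. (r ! 0, r ! 1)) ` set rs \<union> heads \<eta> c' v"
  using assms(1)
proof (induction rs arbitrary: c)
  case (Cons r rs)
  { case 1
    hence r: "2 \<le> length r" "monochrome \<eta> (\<not> c) r" using assms(2) by auto
    show ?case using run_effect(1)[OF r] Cons(1)[of "\<not> c"] 1 by simp }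
  { case 2
    hence r: "2 \<le> length r" "monochrome \<eta> (\<not> c) r" using assms(2) by auto
    show ?case using run_effect(2)[OF r] Cons(2)[of "\<not> c"] 2 by simp }
  { case 3
    hence r: "2 \<le> length r" "monochrome \<eta> (\<not> c) r" using assms(2) by auto
    show ?case using run_effect(3)[OF r] Cons(3)[of "\<not> c"] 3 by simp }
qed auto

lemma desc_tl: "decreasing_runs \<eta> (Suc k) c rs c' \<Longrightarrow> decreasing_runs \<eta> k c (map tl rs) c'"
proof (induction rs arbitrary: c)
  case (Cons r rs)
  have "monochrome \<eta> (\<not> c) (tl r)" using Cons.prems by (cases r) auto
  moreover have "map tl rs \<noteq> [] \<longrightarrow> length (hd (map tl rs)) < length (tl r)"
  proof (cases rs)
    case (Cons r2 rs2)
    thus ?thesis using Cons.prems \<open>decreasing_runs \<eta> (Suc k) c (r # rs) c'\<close> by auto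
  qed simp
  ultimately show ?case using Cons by auto
qed simp

lemma balanced_const: "monochrome \<eta> a u \<Longrightarrow> balanced \<eta> n (u @ v) \<Longrightarrow>
    balanced \<eta> (n + (2 * of_bool a - 1) * int (length u)) v"
proof (induction u arbitrary: n)
  case (Cons x u)
  have "balanced \<eta> ((n + (2 * of_bool a - 1)) + (2 * of_bool a - 1) * int (length u)) v"
    using Cons by auto
  thus ?case by (simp add: algebra_simps)
qed simp

lemma balanced_replace:
  "balanced \<eta> n (u @ v) \<Longrightarrow> (\<And>m. balanced \<eta> m v \<Longrightarrow> balanced \<eta> m v') \<Longrightarrow> balanced \<eta> n (u @ v')"
  by (induction u arbitrary: n) auto

text \<open>A soliton returns the carrier to its load before it, so it can be cut out.\<close>

lemma balanced_remove:
  assumes "balanced \<eta> n (u @ A @ B @ v)" "monochrome \<eta> (\<not> a) A" "monochrome \<eta> a B" "length A = length B"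
  shows "balanced \<eta> n (u @ v)"
proof (rule balanced_replace[OF assms(1)])
  fix m assume "balanced \<eta> m (A @ B @ v)"
  from balanced_const[OF assms(3) balanced_const[OF assms(2) this]] show "balanced \<eta> m v"
    using assms(4) by (cases a) auto
qed

lemma balanced_sum: "balanced \<eta> n w \<Longrightarrow> n + (\<Sum>x\<leftarrow>w. 2 * of_bool (\<eta> x) - 1) = 0"
  by (induction \<eta> n w rule: balanced.induct) auto

lemma balanced_hd: "balanced \<eta> 0 w \<Longrightarrow> w \<noteq> [] \<Longrightarrow> \<eta> (hd w)"
  by (cases w) (auto simp: of_bool_def split: if_splits)

lemma sum_const: "monochrome \<eta> a u \<Longrightarrow> (\<Sum>x\<leftarrow>u. 2 * of_bool (\<eta> x) - 1 :: int) = (2 * of_bool a - 1) * int (length u)"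
  by (induction u) (auto simp: algebra_simps)

text \<open>If no run is followed by one at least as long, then the run lengths decrease strictly, and the
  alternating sum of a decreasing sequence has the sign of its first term.  Hence the algorithm does
  not stop on a nonempty balanced word.\<close>

lemma select_empty_sum:
  assumes "w \<noteq> []" "ts_select (runs \<eta> w) = []"
  shows "(\<eta> (hd w) \<longrightarrow> 0 < (\<Sum>x\<leftarrow>w. 2 * of_bool (\<eta> x) - 1 :: int) \<and>
             (\<Sum>x\<leftarrow>w. 2 * of_bool (\<eta> x) - 1) \<le> int (length (hd (runs \<eta> w)))) \<and>
         (\<not> \<eta> (hd w) \<longrightarrow> (\<Sum>x\<leftarrow>w. 2 * of_bool (\<eta> x) - 1 :: int) < 0 \<and>
             - int (length (hd (runs \<eta> w))) \<le> (\<Sum>x\<leftarrow>w. 2 * of_bool (\<eta> x) - 1))"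
  using assms
proof (induction "length w" arbitrary: w rule: less_induct)
  case less
  from less.prems(1) obtain r v where rv: "w = r @ v" "r \<noteq> []" "monochrome \<eta> (\<eta> (hd w)) r"
    "v \<noteq> [] \<longrightarrow> \<eta> (hd v) = (\<not> \<eta> (hd w))" "runs \<eta> w = r # runs \<eta> v" "length v < length w"
    by (rule runs_Cons_split)
  have sw: "(\<Sum>x\<leftarrow>w. 2 * of_bool (\<eta> x) - 1 :: int)
      = (2 * of_bool (\<eta> (hd w)) - 1) * int (length r) + (\<Sum>x\<leftarrow>v. 2 * of_bool (\<eta> x) - 1)"
    using sum_const[OF rv(3)] by (subst rv(1)) simp
  have lr: "0 < length r" using rv(2) by simp
  show ?case
  proof (cases "v = []")
    case True
    thus ?thesis using sw lr rv(5) by auto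
  next
    case False
    from this obtain r' v' where rv': "v = r' @ v'" "runs \<eta> v = r' # runs \<eta> v'"
      by (rule runs_Cons_split)
    have lt: "length r' < length r"
    proof (rule ccontr)
      assume "\<not> ?thesis"
      hence "ts_select (runs \<eta> w) = r @ take (length r) r'" using rv(5) rv'(2) by simp
      thus False using less.prems(2) rv(2) by simp
    qed
    hence "ts_select (runs \<eta> v) = []" using less.prems rv(5) rv'(2) by simp
    note IH = less.hyps[OF rv(6) False this]
    show ?thesis using IH sw lt rv(4,5) rv'(2) False by (cases "\<eta> (hd w)") auto
  qed
qed

text \<open>One step of the algorithm on a balanced word: the selected soliton is \<open>A @ B\<close>.\<close>

lemma ts_step:
  assumes "balanced \<eta> 0 w" "w \<noteq> []" "distinct w"
  obtains rs A B post c where "w = concat rs @ A @ B @ post" "decreasing_runs \<eta> (length A) False rs c" "A \<noteq> []"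
    "monochrome \<eta> (\<not> c) A" "monochrome \<eta> c B" "length A = length B"
    "ts_solitons \<eta> w = insert (set A \<union> set B) (ts_solitons \<eta> (concat rs @ post))"
    "balanced \<eta> 0 (concat rs @ post)"
proof -
  have h: "\<eta> (hd w)" using balanced_hd assms by blast
  have ne: "ts_select (runs \<eta> w) \<noteq> []"
    using select_empty_sum[OF assms(2)] balanced_sum[OF assms(1)] h by fastforce
  obtain rs A B post c where *: "w = concat rs @ A @ B @ post" "decreasing_runs \<eta> (length A) False rs c" "A \<noteq> []"
    "monochrome \<eta> (\<not> c) A" "monochrome \<eta> c B" "length A = length B" "ts_select (runs \<eta> w) = A @ B"
    using select_split[OF ne] h by auto
  have one: "\<not> (\<forall>x\<in>set w. \<not> \<eta> x)" using h assms(2) by (meson hd_in_set)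
  have "filter (\<lambda>x. x \<notin> set (A @ B)) (concat rs) = concat rs" "filter (\<lambda>x. x \<notin> set (A @ B)) post = post"
    using assms(3) unfolding *(1) by (intro filter_True; fastforce)+
  hence fil: "filter (\<lambda>x. x \<notin> set (A @ B)) w = concat rs @ post"
    unfolding *(1) by (simp add: filter_empty_conv)
  have "ts_solitons \<eta> w = insert (set A \<union> set B) (ts_solitons \<eta> (concat rs @ post))"
    using one ne fil by (subst ts_solitons.simps) (auto simp: *(7) Let_def)
  moreover have "balanced \<eta> 0 (concat rs @ post)"
    using balanced_remove[of \<eta> 0 "concat rs" A B post] assms(1) * by auto
  ultimately show ?thesis using that[OF *(1-6)] by blast
qed

lemma ts_Nil [simp]: "ts_solitons \<eta> [] = {}"
  by (subst ts_solitons.simps) simp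

lemma ts_subset: "\<gamma> \<in> ts_solitons \<eta> w \<Longrightarrow> \<gamma> \<subseteq> set w"
proof (induction "length w" arbitrary: w rule: less_induct)
  case less
  let ?g = "ts_select (runs \<eta> w)"
  have c: "\<not> (?g = [] \<or> (\<forall>x\<in>set w. \<not> \<eta> x))"
    using less.prems by (subst (asm) ts_solitons.simps) (auto simp: Let_def split: if_splits)
  hence "\<gamma> = set ?g \<or> \<gamma> \<in> ts_solitons \<eta> (filter (\<lambda>x. x \<notin> set ?g) w)"
    using less.prems by (subst (asm) ts_solitons.simps) (auto simp: Let_def split: if_splits)
  thus ?case
  proof
    assume g: "\<gamma> \<in> ts_solitons \<eta> (filter (\<lambda>x. x \<notin> set ?g) w)"
    have "hd ?g \<in> set ?g" using c by auto
    hence "hd ?g \<in> set w" using set_ts_select_runs by blast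
    hence "length (filter (\<lambda>x. x \<notin> set ?g) w) < length w"
      using c by (intro length_filter_less[of "hd ?g"]) auto
    from less.hyps[OF this g] show ?case by auto
  qed (use set_ts_select_runs in auto)
qed

lemma ts_partition:
  assumes "balanced \<eta> 0 w" "distinct w"
  shows "\<Union>(ts_solitons \<eta> w) = set w" "disjoint (ts_solitons \<eta> w)"
    "\<And>\<gamma>. \<gamma> \<in> ts_solitons \<eta> w \<Longrightarrow> (\<exists>x\<in>\<gamma>. \<eta> x) \<and> (\<exists>x\<in>\<gamma>. \<not> \<eta> x) \<and> even (card \<gamma>) \<and> finite \<gamma>"
proof -
  have "\<Union>(ts_solitons \<eta> w) = set w \<and> disjoint (ts_solitons \<eta> w) \<and>
    (\<forall>\<gamma>\<in>ts_solitons \<eta> w. (\<exists>x\<in>\<gamma>. \<eta> x) \<and> (\<exists>x\<in>\<gamma>. \<not> \<eta> x) \<and> even (card \<gamma>) \<and> finite \<gamma>)"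
    using assms
  proof (induction "length w" arbitrary: w rule: less_induct)
    case less
    show ?case
    proof (cases "w = []")
      case False
      from less.prems(1) False less.prems(2)
      obtain rs A B post c where *: "w = concat rs @ A @ B @ post" "A \<noteq> []"
        "monochrome \<eta> (\<not> c) A" "monochrome \<eta> c B" "length A = length B"
        "ts_solitons \<eta> w = insert (set A \<union> set B) (ts_solitons \<eta> (concat rs @ post))"
        "balanced \<eta> 0 (concat rs @ post)" by (rule ts_step)
      have d: "distinct (concat rs @ post)" "distinct (A @ B)" "set (A @ B) \<inter> set (concat rs @ post) = {}"
        using less.prems(2) unfolding *(1) by auto
      have "length (concat rs @ post) < length w" using *(2) by (simp add: *(1))
      note IH = less.hyps[OF this *(7) d(1)]
      have AB: "A \<noteq> []" "B \<noteq> []" using * by auto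
      have "\<exists>x\<in>set A \<union> set B. \<eta> x" "\<exists>x\<in>set A \<union> set B. \<not> \<eta> x"
        using AB *(3,4) by (cases c; metis UnI1 UnI2 hd_in_set)+
      moreover have "card (set A \<union> set B) = 2 * length A"
        using distinct_card[OF d(2)] *(5) by simp
      moreover have "disjoint (ts_solitons \<eta> w)"
      proof -
        have "\<And>\<gamma>. \<gamma> \<in> ts_solitons \<eta> (concat rs @ post) \<Longrightarrow> \<gamma> \<inter> (set A \<union> set B) = {}"
          using ts_subset d(3) by fastforce
        thus ?thesis using IH unfolding *(6) by (auto simp: disjoint_def)
      qed
      ultimately show ?thesis using IH unfolding *(6) by (auto simp: *(1))
    qed (simp add: disjoint_def)
  qed
  thus "\<Union>(ts_solitons \<eta> w) = set w" "disjoint (ts_solitons \<eta> w)"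
    "\<And>\<gamma>. \<gamma> \<in> ts_solitons \<eta> w \<Longrightarrow> (\<exists>x\<in>\<gamma>. \<eta> x) \<and> (\<exists>x\<in>\<gamma>. \<not> \<eta> x) \<and> even (card \<gamma>) \<and> finite \<gamma>"
    by auto
qed

lemma contract_subset: "set (contract \<eta> c w) \<subseteq> set w"
  by (induction \<eta> c w rule: contract.induct) auto

lemma distinct_contract: "distinct w \<Longrightarrow> distinct (contract \<eta> c w)"
  by (induction \<eta> c w rule: contract.induct) (auto dest: subsetD[OF contract_subset])

lemma heads_subset: "(x, y) \<in> heads \<eta> c w \<Longrightarrow> x \<in> set w \<and> y \<in> set w"
  by (induction \<eta> c w rule: heads.induct) (auto split: if_splits)

text \<open>The algorithm commutes with the deletion of seat \<open>1\<close>.  By induction on the word: cutting out a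
  \<open>1\<close>-soliton changes only the set of pairs.  A larger selected soliton \<open>A @ B\<close> becomes
  \<open>tl A @ tl B\<close>, which is what the algorithm selects in the contracted word, because all runs up to
  and including \<open>B\<close> lose one site and no run before \<open>B\<close> disappears.\<close>

theorem ts_contract:
  assumes "balanced \<eta> 0 w" "distinct w"
  shows "ts_solitons \<eta> w =
      pairs \<eta> False w \<union> add_heads (heads \<eta> False w) ` ts_solitons \<eta> (contract \<eta> False w)"
    and "\<And>\<delta>. \<delta> \<in> ts_solitons \<eta> (contract \<eta> False w) \<Longrightarrow>
      card (add_heads (heads \<eta> False w) \<delta>) = card \<delta> + 2"
proof -
  have "ts_solitons \<eta> w =
      pairs \<eta> False w \<union> add_heads (heads \<eta> False w) ` ts_solitons \<eta> (contract \<eta> False w) \<and>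
     (\<forall>\<delta> \<in> ts_solitons \<eta> (contract \<eta> False w). card (add_heads (heads \<eta> False w) \<delta>) = card \<delta> + 2)"
    using assms
  proof (induction "length w" arbitrary: w rule: less_induct)
    case less
    show ?case
    proof (cases "w = []")
      case False
      from less.prems(1) False less.prems(2)
      obtain rs A B post c where w: "w = concat rs @ A @ B @ post" and ds: "decreasing_runs \<eta> (length A) False rs c"
        and A: "A \<noteq> []" "monochrome \<eta> (\<not> c) A" and B: "monochrome \<eta> c B" "length A = length B"
        and ts: "ts_solitons \<eta> w = insert (set A \<union> set B) (ts_solitons \<eta> (concat rs @ post))"
        and bal: "balanced \<eta> 0 (concat rs @ post)" by (rule ts_step)
      let ?w' = "concat rs @ post"
      have d: "distinct ?w'" "distinct (A @ B)" "set (A @ B) \<inter> set ?w' = {}"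
        using less.prems(2) unfolding w by auto
      have "length ?w' < length w" using A by (simp add: w)
      note IH = less.hyps[OF this bal d(1)]
      have k: "1 \<le> length A" using A by (cases A) auto
      note e = desc_effect[OF ds k]
      show ?thesis
      proof (cases "length A = 1")
        case True
        then obtain x y where xy: "A = [x]" "B = [y]" using B(2)
          by (metis One_nat_def length_0_conv length_Suc_conv)
        have "\<eta> x \<noteq> c" "\<eta> y = c" using A B xy by auto
        hence "contract \<eta> False w = contract \<eta> False ?w'" "heads \<eta> False w = heads \<eta> False ?w'"
          "pairs \<eta> False w = insert {x, y} (pairs \<eta> False ?w')"
          unfolding w e xy by auto
        thus ?thesis using IH ts xy by auto
      next
        case False
        hence k2: "2 \<le> length A" using k by linarith
        have cA: "monochrome \<eta> (\<not> c) A" and cB: "monochrome \<eta> (\<not> \<not> c) B" using A B by auto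
        note eA = run_effect[OF k2 cA] and eB = run_effect[of B \<eta> "\<not> c", OF _ cB]
        have kB: "2 \<le> length B" using k2 B by simp
        have con: "contract \<eta> False w = concat (map tl rs) @ tl A @ tl B @ contract \<eta> c post"
          and con': "contract \<eta> False ?w' = concat (map tl rs) @ contract \<eta> c post"
          unfolding w e eA eB(1)[OF kB] by simp_all
        have prs: "pairs \<eta> False w = pairs \<eta> False ?w'"
          unfolding w e eA eB(2)[OF kB] by simp
        have hds: "heads \<eta> False w = heads \<eta> False ?w' \<union> {(A ! 0, A ! 1), (B ! 0, B ! 1)}"
          unfolding w e eA eB(3)[OF kB] by auto
        let ?v = "contract \<eta> False w" and ?v' = "contract \<eta> False ?w'"
        have dv: "distinct ?v" by (rule distinct_contract[OF less.prems(2)])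
        have tlA: "tl A \<noteq> []" "tl B \<noteq> []"
        proof -
          have "0 < length (tl A)" "0 < length (tl B)" using k2 kB by simp_all
          thus "tl A \<noteq> []" "tl B \<noteq> []" by blast+
        qed
        have ds': "decreasing_runs \<eta> (length (tl A)) False (map tl rs) c"
        proof -
          have "Suc (length (tl A)) = length A" using k by simp
          thus ?thesis using desc_tl[of \<eta> "length (tl A)" False rs c] ds by (simp only:)
        qed
        have sel: "ts_select (runs \<eta> ?v) = tl A @ tl B"
          unfolding con using A B by (intro select_intro[OF ds' tlA(1)]) (auto dest: list.set_sel(2)[rotated])
        have fil: "filter (\<lambda>x. x \<notin> set (tl A @ tl B)) ?v = ?v'"
        proof -
          have "filter (\<lambda>x. x \<notin> set (tl A @ tl B)) (concat (map tl rs)) = concat (map tl rs)"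
            "filter (\<lambda>x. x \<notin> set (tl A @ tl B)) (contract \<eta> c post) = contract \<eta> c post"
            using dv unfolding con by (intro filter_True; fastforce)+
          thus ?thesis unfolding con con' by (simp add: filter_empty_conv)
        qed
        have "\<exists>x\<in>set (tl A) \<union> set (tl B). \<eta> x"
          using tlA A(2) B(1) by (cases c) (metis UnI1 UnI2 hd_in_set list.set_sel(2) tl_Nil)+
        hence one: "\<not> (\<forall>x\<in>set ?v. \<not> \<eta> x)" unfolding con by auto
        have tsv: "ts_solitons \<eta> ?v = insert (set (tl A) \<union> set (tl B)) (ts_solitons \<eta> ?v')"
          using one fil tlA by (subst ts_solitons.simps) (auto simp: sel Let_def)
        have AA: "set A = insert (A ! 0) (set (tl A))" "A ! 1 \<in> set (tl A)"
          using set_first_two[OF k2] by blast+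
        have BB: "set B = insert (B ! 0) (set (tl B))" "B ! 1 \<in> set (tl B)"
          using set_first_two[OF kB] by blast+
        have hw: "\<And>x y. (x, y) \<in> heads \<eta> False ?w' \<Longrightarrow> y \<notin> set A \<and> y \<notin> set B"
          using heads_subset[of _ _ \<eta> False ?w'] d(3) by fastforce
        have lg: "add_heads (heads \<eta> False w) (set (tl A) \<union> set (tl B)) = set A \<union> set B"
          using hw AA BB unfolding hds add_heads_def by fastforce
        have ldel: "add_heads (heads \<eta> False w) \<delta> = add_heads (heads \<eta> False ?w') \<delta>"
          if "\<delta> \<in> ts_solitons \<eta> ?v'" for \<delta>
        proof -
          have "\<delta> \<subseteq> set ?w'" using ts_subset[OF that] contract_subset by blast
          hence "A ! 1 \<notin> \<delta>" "B ! 1 \<notin> \<delta>" using AA BB d(3) by auto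
          thus ?thesis unfolding hds add_heads_def by auto
        qed
        have cardg: "card (set A \<union> set B) = card (set (tl A) \<union> set (tl B)) + 2"
        proof -
          have "card (set A \<union> set B) = 2 * length A" using distinct_card[OF d(2)] B by simp
          moreover have "distinct (tl A @ tl B)" using dv unfolding con by auto
          hence "card (set (tl A) \<union> set (tl B)) = 2 * (length A - 1)" using distinct_card[of "tl A @ tl B"] B by simp
          ultimately show ?thesis using k by simp
        qed
        have "add_heads (heads \<eta> False w) ` ts_solitons \<eta> ?v =
            insert (set A \<union> set B) (add_heads (heads \<eta> False ?w') ` ts_solitons \<eta> ?v')"
          unfolding tsv using lg ldel by (auto simp: image_iff)
        thus ?thesis using IH ts prs tsv lg ldel cardg by auto
      qed
    qed simp
  qed
  thus "ts_solitons \<eta> w =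
      pairs \<eta> False w \<union> add_heads (heads \<eta> False w) ` ts_solitons \<eta> (contract \<eta> False w)"
    and "\<And>\<delta>. \<delta> \<in> ts_solitons \<eta> (contract \<eta> False w) \<Longrightarrow>
      card (add_heads (heads \<eta> False w) \<delta>) = card \<delta> + 2" by auto
qed

section \<open>Solitons under removal of the first seat\<close>

text \<open>Between two consecutive records the walk stays above the first record and returns to its
  level before the second one.\<close>

lemma balanced_excursion:
  assumes "recurrent \<eta>" "consecutive \<eta> r r'" "r \<le> x" "x < r'"
  shows "balanced \<eta> (walk \<eta> x - walk \<eta> r) [x + 1..r' - 1]"
  using assms(4,3)
proof (induction "nat (r' - 1 - x)" arbitrary: x)
  case 0
  have rec: "is_record \<eta> r" "is_record \<eta> r'" using assms(2) by (auto simp: consecutive_def)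
  have "last_record \<eta> (r' - 1) = r"
  proof -
    have "r \<le> last_record \<eta> (r' - 1)" using last_record(3)[OF assms(1) rec(1)] 0 by simp
    moreover have "\<not> r < last_record \<eta> (r' - 1)"
      using last_record(1,2)[OF assms(1), of "r' - 1"] assms(2) by (auto simp: consecutive_def)
    ultimately show ?thesis by simp
  qed
  hence "walk \<eta> (r' - 1) = walk \<eta> r" using record_walk_step[OF assms(1) rec(2)] by simp
  moreover have "x = r' - 1" using 0 by simp
  ultimately show ?case by simp
next
  case (Suc n)
  have rec: "is_record \<eta> r" using assms(2) by (auto simp: consecutive_def)
  have "last_record \<eta> (x + 1) = r"
  proof -
    have "r \<le> last_record \<eta> (x + 1)" using last_record(3)[OF assms(1) rec] Suc.prems by simp
    moreover have "\<not> r < last_record \<eta> (x + 1)"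
    proof
      assume "r < last_record \<eta> (x + 1)"
      moreover have "last_record \<eta> (x + 1) < r'"
        using last_record(2)[OF assms(1), of "x + 1"] Suc by linarith
      ultimately show False using last_record(1)[OF assms(1), of "x + 1"] assms(2)
        by (auto simp: consecutive_def)
    qed
    ultimately show ?thesis by simp
  qed
  hence "walk \<eta> r \<le> walk \<eta> (x + 1)" using walk_last_record_le[OF assms(1), of "x + 1" "x + 1"] by simp
  moreover have "balanced \<eta> (walk \<eta> (x + 1) - walk \<eta> r) [x + 1 + 1..r' - 1]"
    using Suc by (intro Suc.hyps) auto
  moreover have "[x + 1..r' - 1] = (x + 1) # [x + 1 + 1..r' - 1]" using Suc by (intro upto_rec1) auto
  moreover have "walk \<eta> x - walk \<eta> r + (2 * of_bool (\<eta> (x + 1)) - 1) = walk \<eta> (x + 1) - walk \<eta> r"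
    using walk_step[of \<eta> "x + 1"] by simp
  ultimately show ?case by (simp only: balanced.simps) simp
qed

lemma runs_map: "runs \<eta> (map s v) = map (map s) (runs (\<eta> \<circ> s) v)"
proof (induction "\<eta> \<circ> s" v rule: runs.induct)
  case (2 x w)
  thus ?case by (simp add: takeWhile_map dropWhile_map o_def)
qed simp

lemma ts_select_map: "ts_select (map (map s) rs) = map s (ts_select rs)"
  by (induction rs rule: ts_select.induct) (auto simp: take_map)

lemma ts_map:
  assumes "inj s"
  shows "ts_solitons \<eta> (map s v) = image s ` ts_solitons (\<eta> \<circ> s) v"
proof (induction "length v" arbitrary: v rule: less_induct)
  case less
  let ?g = "ts_select (runs (\<eta> \<circ> s) v)"
  have g: "ts_select (runs \<eta> (map s v)) = map s ?g" by (simp add: runs_map ts_select_map)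
  show ?case
  proof (cases "?g = [] \<or> (\<forall>x\<in>set v. \<not> \<eta> (s x))")
    case True
    have "ts_solitons \<eta> (map s v) = {}" using True by (subst ts_solitons.simps) (auto simp: g Let_def)
    moreover have "ts_solitons (\<eta> \<circ> s) v = {}" using True by (subst ts_solitons.simps) (auto simp: Let_def)
    ultimately show ?thesis by simp
  next
    case False
    have "hd ?g \<in> set ?g" using False by auto
    moreover hence "hd ?g \<in> set v" using set_ts_select_runs by blast
    ultimately have l: "length (filter (\<lambda>x. x \<notin> set ?g) v) < length v"
      by (intro length_filter_less[of "hd ?g"]) auto
    have f: "filter (\<lambda>x. x \<notin> set (map s ?g)) (map s v) = map s (filter (\<lambda>x. x \<notin> set ?g) v)"
      using assms by (auto simp: filter_map o_def inj_image_mem_iff)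
    have "ts_solitons \<eta> (map s v) = insert (set (map s ?g)) (ts_solitons \<eta> (map s (filter (\<lambda>x. x \<notin> set ?g) v)))"
      using False by (subst ts_solitons.simps) (simp only: g Let_def f, auto)
    moreover have "ts_solitons (\<eta> \<circ> s) v = insert (set ?g) (ts_solitons (\<eta> \<circ> s) (filter (\<lambda>x. x \<notin> set ?g) v))"
      using False by (subst ts_solitons.simps) (auto simp: Let_def)
    ultimately show ?thesis using less[OF l] by simp
  qed
qed

context slot_map begin

definition gap_pair :: "int \<Rightarrow> int \<Rightarrow> int set" where
  "gap_pair i j = {s i + 1 + 2 * j, s i + 2 + 2 * j}"

text \<open>The site in front of a slot is deleted and belongs to the soliton of that slot exactly when the
  slot is where seat \<open>1\<close> of the contracted configuration changes.\<close>

definition lift :: "int set \<Rightarrow> int set" where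
  "lift \<delta> = s ` \<delta> \<union> {s y - 1 | y. y \<in> \<delta> \<and> \<omega> y \<noteq> \<omega> (y - 1)}"

lemma contract_upto: "contract \<eta> (\<eta> (a - 1)) [a..b] = filter (\<lambda>x. x \<in> slots \<eta>) [a..b]"
proof (induction "nat (b + 1 - a)" arbitrary: a)
  case (Suc n)
  have "[a..b] = a # [a + 1..b]" using Suc by (intro upto_rec1) auto
  moreover have "contract \<eta> (\<eta> (a + 1 - 1)) [a + 1..b] = filter (\<lambda>x. x \<in> slots \<eta>) [a + 1..b]"
    using Suc by (intro Suc.hyps) auto
  ultimately show ?case by (auto simp: slots_def)
qed simp

lemma map_s_upto: "map s [i + 1..j - 1] = filter (\<lambda>x. x \<in> slots \<eta>) [s i + 1..s j - 1]"
proof (rule sorted_distinct_set_unique)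
  show "sorted (map s [i + 1..j - 1])"
    by (simp add: sorted_map sorted_wrt_mono_rel[OF _ sorted_upto] s_le)
  show "distinct (map s [i + 1..j - 1])"
    using strict_mono_imp_inj_on[OF mono] by (simp add: distinct_map inj_on_def)
  show "sorted (filter (\<lambda>x. x \<in> slots \<eta>) [s i + 1..s j - 1])" by (intro sorted_filter[of id, simplified] sorted_upto)
  show "distinct (filter (\<lambda>x. x \<in> slots \<eta>) [s i + 1..s j - 1])" by simp
  show "set (map s [i + 1..j - 1]) = set (filter (\<lambda>x. x \<in> slots \<eta>) [s i + 1..s j - 1])"
  proof (intro equalityI subsetI)
    fix x assume "x \<in> set (map s [i + 1..j - 1])"
    then obtain l where "x = s l" "i < l" "l < j" by auto
    thus "x \<in> set (filter (\<lambda>x. x \<in> slots \<eta>) [s i + 1..s j - 1])"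
      using s_less[of i l] s_less[of l j] range_s by auto
  next
    fix x assume "x \<in> set (filter (\<lambda>x. x \<in> slots \<eta>) [s i + 1..s j - 1])"
    hence x: "x \<in> slots \<eta>" "s i < x" "x < s j" by auto
    then obtain l where l: "x = s l" using range_s by auto
    thus "x \<in> set (map s [i + 1..j - 1])" using x s_less by auto
  qed
qed

text \<open>Reading one gap: first its pairs, then either the next slot, or one more deleted site and the
  next slot with the opposite letter.\<close>

lemma gap_step:
  assumes "i < i'"
  shows "pairs \<eta> (\<omega> i) [s i + 1..s i' - 1] =
      {gap_pair i j | j. 0 \<le> j \<and> j < gap_pairs s i} \<union> pairs \<eta> (\<omega> (i + 1)) [s (i + 1) + 1..s i' - 1]"
    and "heads \<eta> (\<omega> i) [s i + 1..s i' - 1] =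
      (if i + 1 < i' \<and> \<omega> (i + 1) \<noteq> \<omega> i then {(s (i + 1) - 1, s (i + 1))} else {}) \<union>
      heads \<eta> (\<omega> (i + 1)) [s (i + 1) + 1..s i' - 1]"
proof -
  let ?z = "gap_pairs s i" and ?b = "s i' - 1" and ?c = "\<omega> i"
  have b: "s (i + 1) \<le> s i'" using assms s_le[of "i + 1" i'] by simp
  note g = gap[of i]
  have step: "pairs \<eta> ?c [s i + 1 + 2 * j..?b] = insert (gap_pair i j) (pairs \<eta> ?c [s i + 1 + 2 * (j + 1)..?b])
      \<and> heads \<eta> ?c [s i + 1 + 2 * j..?b] = heads \<eta> ?c [s i + 1 + 2 * (j + 1)..?b]"
    if j: "0 \<le> j" "j < ?z" for j
  proof -
    let ?x = "s i + 1 + 2 * j"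
    have "?x + 1 \<le> ?b" using g b j by (auto simp: of_bool_def split: if_splits)
    hence u: "[?x..?b] = ?x # (?x + 1) # [?x + 2..?b]" by (simp add: upto_rec1)
    have "\<eta> ?x \<noteq> ?c" "\<eta> (?x + 1) = ?c"
      using alternating[of i ?x] alternating[of i "?x + 1"] g j by (auto simp: of_bool_def split: if_splits)
    thus ?thesis unfolding u by (auto simp: gap_pair_def algebra_simps)
  qed
  have all: "j \<le> ?z \<longrightarrow> (pairs \<eta> ?c [s i + 1..?b] = {gap_pair i l | l. 0 \<le> l \<and> l < j} \<union> pairs \<eta> ?c [s i + 1 + 2 * j..?b]
      \<and> heads \<eta> ?c [s i + 1..?b] = heads \<eta> ?c [s i + 1 + 2 * j..?b])" if "0 \<le> j" for j
    using that
  proof (induction j rule: int_ge_induct)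
    case base
    have e: "{gap_pair i l | l. 0 \<le> l \<and> l < (0::int)} = {}" by auto
    show ?case unfolding e by simp
  next
    case (step j)
    have e: "{gap_pair i l | l. 0 \<le> l \<and> l < j + 1} = insert (gap_pair i j) {gap_pair i l | l. 0 \<le> l \<and> l < j}"
    proof -
      have "0 \<le> l \<and> l < j + 1 \<longleftrightarrow> l = j \<or> (0 \<le> l \<and> l < j)" for l using step(1) by auto
      thus ?thesis by (simp only: conj_disj_distribL ex_disj_distrib) blast
    qed
    show ?case
    proof
      assume "j + 1 \<le> ?z"
      thus "pairs \<eta> ?c [s i + 1..?b] = {gap_pair i l | l. 0 \<le> l \<and> l < j + 1} \<union> pairs \<eta> ?c [s i + 1 + 2 * (j + 1)..?b]
        \<and> heads \<eta> ?c [s i + 1..?b] = heads \<eta> ?c [s i + 1 + 2 * (j + 1)..?b]"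
        unfolding e using step(2) \<open>\<And>j. \<lbrakk>0 \<le> j; j < ?z\<rbrakk> \<Longrightarrow> _\<close>[of j] step(1) by auto
    qed
  qed
  let ?x = "s i + 1 + 2 * ?z"
  have P: "pairs \<eta> ?c [s i + 1..?b] = {gap_pair i l | l. 0 \<le> l \<and> l < ?z} \<union> pairs \<eta> ?c [?x..?b]"
    and H: "heads \<eta> ?c [s i + 1..?b] = heads \<eta> ?c [?x..?b]"
    using all[of ?z] gap_pairs_nonneg[of i] by blast+
  have last: "pairs \<eta> ?c [?x..?b] = pairs \<eta> (\<omega> (i + 1)) [s (i + 1) + 1..?b] \<and>
     heads \<eta> ?c [?x..?b] = (if i + 1 < i' \<and> \<omega> (i + 1) \<noteq> \<omega> i then {(s (i + 1) - 1, s (i + 1))} else {}) \<union>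
       heads \<eta> (\<omega> (i + 1)) [s (i + 1) + 1..?b]"
  proof (cases "i + 1 < i'")
    case True
    hence lt: "s (i + 1) \<le> ?b" using s_less[of "i + 1" i'] by simp
    show ?thesis
    proof (cases "\<omega> (i + 1) = \<omega> i")
      case same: True
      hence "s (i + 1) = ?x" using g by simp
      moreover from this have "[?x..?b] = ?x # [s (i + 1) + 1..?b]" using lt by (simp add: upto_rec1)
      moreover have "\<eta> (s (i + 1)) = ?c" using same by (simp add: \<omega>_def)
      ultimately show ?thesis using same by (simp add: pairs_skip heads_skip)
    next
      case False
      hence sx: "s (i + 1) = ?x + 1" using g by simp
      hence u: "[?x..?b] = ?x # s (i + 1) # [s (i + 1) + 1..?b]" using lt by (simp add: upto_rec1)
      have y: "\<eta> (s (i + 1)) = (\<not> ?c)" "\<omega> (i + 1) = (\<not> ?c)" using False by (auto simp: \<omega>_def)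
      have x: "\<eta> ?x \<noteq> ?c" using alternating[of i ?x] sx gap_pairs_nonneg[of i] by auto
      have xe: "s (i + 1) - 1 = ?x" using sx by simp
      have "pairs \<eta> ?c (?x # s (i + 1) # L) = pairs \<eta> (\<not> ?c) L"
        "heads \<eta> ?c (?x # s (i + 1) # L) = insert (?x, s (i + 1)) (heads \<eta> (\<not> ?c) L)" for L
        using x y(1) by simp_all
      thus ?thesis unfolding u xe y(2) using True by simp
    qed
  next
    case False
    hence i': "i' = i + 1" using assms by simp
    have "?b = ?x - 1 \<or> ?b = ?x" using g i' by (auto simp: of_bool_def split: if_splits)
    hence "[?x..?b] = [] \<or> [?x..?b] = [?x]" by (metis upto_single upto_empty diff_add_cancel less_add_one)
    thus ?thesis using i' by auto
  qed
  show "pairs \<eta> (\<omega> i) [s i + 1..s i' - 1] =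
      {gap_pair i j | j. 0 \<le> j \<and> j < gap_pairs s i} \<union> pairs \<eta> (\<omega> (i + 1)) [s (i + 1) + 1..s i' - 1]"
    using P last by simp
  show "heads \<eta> (\<omega> i) [s i + 1..s i' - 1] =
      (if i + 1 < i' \<and> \<omega> (i + 1) \<noteq> \<omega> i then {(s (i + 1) - 1, s (i + 1))} else {}) \<union>
      heads \<eta> (\<omega> (i + 1)) [s (i + 1) + 1..s i' - 1]"
    using H last by simp
qed

lemma gaps:
  assumes "i \<le> i'"
  shows "pairs \<eta> (\<omega> i) [s i + 1..s i' - 1] = {gap_pair l j | l j. i \<le> l \<and> l < i' \<and> 0 \<le> j \<and> j < gap_pairs s l}"
    and "heads \<eta> (\<omega> i) [s i + 1..s i' - 1] = {(s l - 1, s l) | l. i < l \<and> l < i' \<and> \<omega> l \<noteq> \<omega> (l - 1)}"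
  using assms
proof (induction "nat (i' - i)" arbitrary: i)
  case 0
  { case 1 hence "i = i'" using 0 by simp thus ?case by auto }
  { case 2 hence "i = i'" using 0 by simp thus ?case by auto }
next
  case (Suc n)
  { case 1
    hence lt: "i < i'" using Suc(3) by simp
    have IH: "pairs \<eta> (\<omega> (i + 1)) [s (i + 1) + 1..s i' - 1] =
        {gap_pair l j | l j. i + 1 \<le> l \<and> l < i' \<and> 0 \<le> j \<and> j < gap_pairs s l}"
      using Suc(3) lt by (intro Suc(1)) auto
    have e: "i \<le> l \<and> l < i' \<and> Q \<longleftrightarrow> (l = i \<and> Q) \<or> (i + 1 \<le> l \<and> l < i' \<and> Q)" for l Q using lt by auto
    show ?case unfolding gap_step(1)[OF lt] IH e by blast }
  { case 2
    hence lt: "i < i'" using Suc(3) by simp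
    have IH: "heads \<eta> (\<omega> (i + 1)) [s (i + 1) + 1..s i' - 1] =
        {(s l - 1, s l) | l. i + 1 < l \<and> l < i' \<and> \<omega> l \<noteq> \<omega> (l - 1)}"
      using Suc(3) lt by (intro Suc(2)) auto
    have "i < l \<longleftrightarrow> l = i + 1 \<or> i + 1 < l" for l by auto
    thus ?case unfolding gap_step(2)[OF lt] IH by auto }
qed

lemma ts_excursion:
  assumes "consecutive \<omega> i i'"
  shows "ts_solitons \<eta> [s i + 1..s i' - 1] =
      {gap_pair l j | l j. i \<le> l \<and> l < i' \<and> 0 \<le> j \<and> j < gap_pairs s l} \<union>
      lift ` ts_solitons \<omega> [i + 1..i' - 1]"
    and "\<And>\<delta>. \<delta> \<in> ts_solitons \<omega> [i + 1..i' - 1] \<Longrightarrow> card (lift \<delta>) = card \<delta> + 2"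
proof -
  let ?w = "[s i + 1..s i' - 1]" and ?H = "heads \<eta> False [s i + 1..s i' - 1]"
  have c: "consecutive \<eta> (s i) (s i')" by (rule consecutive_expand[OF assms])
  have bal: "balanced \<eta> 0 ?w" using balanced_excursion[OF recurrent c, of "s i"] c by (simp add: consecutive_def)
  have f: "\<eta> (s i) = False" "\<omega> i = False"
    using recordD(1) assms c by (auto simp: consecutive_def)
  have lt: "i \<le> i'" using assms by (simp add: consecutive_def)
  have con: "contract \<eta> False ?w = map s [i + 1..i' - 1]"
    using contract_upto[of "s i + 1" "s i' - 1"] f by (simp add: map_s_upto)
  have inj: "inj s" using strict_mono_imp_inj_on[OF mono] .
  have tsm: "ts_solitons \<eta> (contract \<eta> False ?w) = image s ` ts_solitons \<omega> [i + 1..i' - 1]"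
    unfolding con \<omega>_def by (rule ts_map[OF inj])
  have prs: "pairs \<eta> False ?w = {gap_pair l j | l j. i \<le> l \<and> l < i' \<and> 0 \<le> j \<and> j < gap_pairs s l}"
    using gaps(1)[OF lt] f by simp
  have hds: "?H = {(s l - 1, s l) | l. i < l \<and> l < i' \<and> \<omega> l \<noteq> \<omega> (l - 1)}"
    using gaps(2)[OF lt] f by simp
  have l: "add_heads ?H (s ` \<delta>) = lift \<delta>" if "\<delta> \<in> ts_solitons \<omega> [i + 1..i' - 1]" for \<delta>
  proof -
    have sub: "\<delta> \<subseteq> {i<..<i'}" using ts_subset[OF that] by auto
    have "{x. \<exists>y\<in>s ` \<delta>. (x, y) \<in> ?H} = {s y - 1 | y. y \<in> \<delta> \<and> \<omega> y \<noteq> \<omega> (y - 1)}"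
      using sub inj unfolding hds by (auto simp: inj_eq)
    thus ?thesis by (simp add: add_heads_def lift_def)
  qed
  note T = ts_contract[OF bal distinct_upto]
  have "add_heads ?H ` (image s ` ts_solitons \<omega> [i + 1..i' - 1]) = lift ` ts_solitons \<omega> [i + 1..i' - 1]"
    using l by (auto simp: image_iff)
  thus "ts_solitons \<eta> ?w = {gap_pair l j | l j. i \<le> l \<and> l < i' \<and> 0 \<le> j \<and> j < gap_pairs s l} \<union>
      lift ` ts_solitons \<omega> [i + 1..i' - 1]"
    using T(1) unfolding tsm prs by simp
  fix \<delta> assume d: "\<delta> \<in> ts_solitons \<omega> [i + 1..i' - 1]"
  hence "card (add_heads ?H (s ` \<delta>)) = card (s ` \<delta>) + 2" using T(2)[of "s ` \<delta>"] unfolding tsm by blast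
  thus "card (lift \<delta>) = card \<delta> + 2" using l[OF d] card_image[of s \<delta>] inj by (simp add: inj_on_def)
qed

end

lemma excursion_partition:
  assumes "recurrent \<eta>" "consecutive \<eta> r r'"
  shows "\<Union>(ts_solitons \<eta> [r + 1..r' - 1]) = {r<..<r'}" "disjoint (ts_solitons \<eta> [r + 1..r' - 1])"
    "\<And>\<gamma>. \<gamma> \<in> ts_solitons \<eta> [r + 1..r' - 1] \<Longrightarrow>
      (\<exists>x\<in>\<gamma>. \<eta> x) \<and> (\<exists>x\<in>\<gamma>. \<not> \<eta> x) \<and> even (card \<gamma>) \<and> finite \<gamma>"
proof -
  have bal: "balanced \<eta> 0 [r + 1..r' - 1]"
    using balanced_excursion[OF assms, of r] assms(2) by (simp add: consecutive_def)
  note P = ts_partition[OF bal distinct_upto]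
  show "\<Union>(ts_solitons \<eta> [r + 1..r' - 1]) = {r<..<r'}" unfolding P(1) by auto
  show "disjoint (ts_solitons \<eta> [r + 1..r' - 1])" using P(2) .
  show "\<And>\<gamma>. \<gamma> \<in> ts_solitons \<eta> [r + 1..r' - 1] \<Longrightarrow>
      (\<exists>x\<in>\<gamma>. \<eta> x) \<and> (\<exists>x\<in>\<gamma>. \<not> \<eta> x) \<and> even (card \<gamma>) \<and> finite \<gamma>" using P(3) .
qed

lemma soliton_props:
  assumes "recurrent \<eta>" "\<gamma> \<in> solitons k \<eta>"
  shows "finite \<gamma>" "\<exists>x\<in>\<gamma>. \<eta> x" "\<exists>x\<in>\<gamma>. \<not> \<eta> x" "1 \<le> k" "card \<gamma> = 2 * k"
    "\<And>x. x \<in> \<gamma> \<Longrightarrow> \<not> is_record \<eta> x"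
proof -
  from assms(2) obtain r r' where c: "consecutive \<eta> r r'" and g: "\<gamma> \<in> ts_solitons \<eta> [r + 1..r' - 1]"
    and card: "card \<gamma> = 2 * k"
    unfolding solitons_consecutive[OF assms(1)] by blast
  note P = excursion_partition[OF assms(1) c]
  show f: "finite \<gamma>" and 1: "\<exists>x\<in>\<gamma>. \<eta> x" and "\<exists>x\<in>\<gamma>. \<not> \<eta> x" "card \<gamma> = 2 * k" using P(3)[OF g] card by auto
  have "card \<gamma> \<noteq> 0" using f 1 by auto
  thus "1 \<le> k" using card by simp
  fix x assume "x \<in> \<gamma>"
  hence "x \<in> {r<..<r'}" using P(1) g by auto
  thus "\<not> is_record \<eta> x" using c by (auto simp: consecutive_def)
qed

lemma solitons_disjoint:
  assumes "recurrent \<eta>" "\<gamma> \<in> solitons k \<eta>" "\<gamma>' \<in> solitons l \<eta>" "x \<in> \<gamma>" "x \<in> \<gamma>'"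
  shows "\<gamma> = \<gamma>'"
proof -
  from assms(2) obtain r r' where c: "consecutive \<eta> r r'" and g: "\<gamma> \<in> ts_solitons \<eta> [r + 1..r' - 1]"
    unfolding solitons_consecutive[OF assms(1)] by blast
  from assms(3) obtain t t' where d: "consecutive \<eta> t t'" and h: "\<gamma>' \<in> ts_solitons \<eta> [t + 1..t' - 1]"
    unfolding solitons_consecutive[OF assms(1)] by blast
  have x: "r < x" "x < r'" "t < x" "x < t'"
    using excursion_partition(1)[OF assms(1) c] excursion_partition(1)[OF assms(1) d] g h assms(4,5) by auto
  have "\<not> r < t" "\<not> t < r" "\<not> r' < t'" "\<not> t' < r'" using c d x by (auto simp: consecutive_def)
  hence "r = t" "r' = t'" by auto
  hence "\<gamma>' \<in> ts_solitons \<eta> [r + 1..r' - 1]" using h by simp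
  thus ?thesis using excursion_partition(2)[OF assms(1) c] g assms(4,5) by (auto simp: disjoint_def)
qed

lemma solitons_cover:
  assumes "recurrent \<eta>" "\<not> is_record \<eta> x"
  shows "\<exists>k. \<exists>\<gamma>\<in>solitons k \<eta>. x \<in> \<gamma>"
proof -
  obtain r r' where c: "consecutive \<eta> r r'" "r < x" "x < r'" using consecutive_exists[OF assms] by blast
  note P = excursion_partition[OF assms(1) c(1)]
  obtain \<gamma> where g: "\<gamma> \<in> ts_solitons \<eta> [r + 1..r' - 1]" "x \<in> \<gamma>" using P(1) c by (metis UnionE greaterThanLessThan_iff)
  obtain k where "card \<gamma> = 2 * k" using P(3)[OF g(1)] by blast
  hence "\<gamma> \<in> solitons k \<eta>" using g c unfolding solitons_consecutive[OF assms(1)] by blast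
  thus ?thesis using g by blast
qed

context slot_map begin

text \<open>The solitons of a configuration are the pairs in the gaps and the lifts of the solitons of its
  contraction.\<close>

lemma solitons_contract:
  shows "solitons 1 \<eta> = {gap_pair l j | l j. 0 \<le> j \<and> j < gap_pairs s l}"
    and "1 \<le> k \<Longrightarrow> solitons (Suc k) \<eta> = lift ` solitons k \<omega>"
proof -
  have cards: "card (gap_pair l j) = 2" for l j by (simp add: gap_pair_def)
  have ex: "\<exists>i i'. consecutive \<omega> i i' \<and> i \<le> l \<and> l < i'" for l
  proof (cases "is_record \<omega> l")
    case True
    define i where "i = idx (s_inf \<omega>) l"
    have e: "enumerates (s_inf \<omega>) {x. is_record \<omega> x}" by (rule s_inf(1)[OF recurrent_\<omega>])
    hence m: "strict_mono (s_inf \<omega>)" by (simp add: enumerates_def)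
    show ?thesis using consecutive_iff[OF recurrent_\<omega>] idx_le[OF m, of l] less_idx_Suc[OF m, of l] by blast
  next
    case False
    thus ?thesis using consecutive_exists[OF recurrent_\<omega>] by (meson less_imp_le)
  qed
  have S: "\<gamma> \<in> solitons m \<eta> \<longleftrightarrow> card \<gamma> = 2 * m \<and> (\<exists>i i'. consecutive \<omega> i i' \<and> \<gamma> \<in> ts_solitons \<eta> [s i + 1..s i' - 1])" for \<gamma> m
  proof -
    have "(\<exists>r r'. consecutive \<eta> r r' \<and> \<gamma> \<in> ts_solitons \<eta> [r + 1..r' - 1]) \<longleftrightarrow>
        (\<exists>i i'. consecutive \<omega> i i' \<and> \<gamma> \<in> ts_solitons \<eta> [s i + 1..s i' - 1])"
    proof
      assume "\<exists>r r'. consecutive \<eta> r r' \<and> \<gamma> \<in> ts_solitons \<eta> [r + 1..r' - 1]"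
      then obtain r r' where r: "consecutive \<eta> r r'" "\<gamma> \<in> ts_solitons \<eta> [r + 1..r' - 1]" by blast
      have "s (idx s r) = r" "s (idx s r') = r'" using r(1) idx_slot record_slot by (auto simp: consecutive_def)
      thus "\<exists>i i'. consecutive \<omega> i i' \<and> \<gamma> \<in> ts_solitons \<eta> [s i + 1..s i' - 1]"
        using consecutive_contract[OF r(1)] r(2) by metis
    qed (use consecutive_expand in blast)
    thus ?thesis unfolding solitons_consecutive[OF recurrent] by simp
  qed
  show "solitons 1 \<eta> = {gap_pair l j | l j. 0 \<le> j \<and> j < gap_pairs s l}"
  proof (intro equalityI subsetI)
    fix \<gamma> assume "\<gamma> \<in> solitons 1 \<eta>"
    then obtain i i' where g: "consecutive \<omega> i i'" "\<gamma> \<in> ts_solitons \<eta> [s i + 1..s i' - 1]" "card \<gamma> = 2"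
      using S[of \<gamma> 1] by auto
    show "\<gamma> \<in> {gap_pair l j | l j. 0 \<le> j \<and> j < gap_pairs s l}"
    proof (rule ccontr)
      assume "\<not> ?thesis"
      then obtain \<delta> where d: "\<delta> \<in> ts_solitons \<omega> [i + 1..i' - 1]" "\<gamma> = lift \<delta>"
        using g(2) unfolding ts_excursion(1)[OF g(1)] by blast
      have "card \<delta> = 0" using ts_excursion(2)[OF g(1) d(1)] g(3) d(2) by simp
      thus False using excursion_partition(3)[OF recurrent_\<omega> g(1) d(1)] by auto
    qed
  next
    fix \<gamma> assume "\<gamma> \<in> {gap_pair l j | l j. 0 \<le> j \<and> j < gap_pairs s l}"
    then obtain l j where lj: "\<gamma> = gap_pair l j" "0 \<le> j" "j < gap_pairs s l" by blast
    obtain i i' where i: "consecutive \<omega> i i'" "i \<le> l" "l < i'" using ex by blast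
    have "\<gamma> \<in> ts_solitons \<eta> [s i + 1..s i' - 1]" unfolding ts_excursion(1)[OF i(1)] using lj i(2,3) by blast
    moreover have "card \<gamma> = 2 * 1" using lj(1) cards by simp
    ultimately show "\<gamma> \<in> solitons 1 \<eta>" using i(1) unfolding S by blast
  qed
  assume k: "1 \<le> k"
  show "solitons (Suc k) \<eta> = lift ` solitons k \<omega>"
  proof (intro equalityI subsetI)
    fix \<gamma> assume "\<gamma> \<in> solitons (Suc k) \<eta>"
    then obtain i i' where g: "consecutive \<omega> i i'" "\<gamma> \<in> ts_solitons \<eta> [s i + 1..s i' - 1]" "card \<gamma> = 2 * Suc k"
      using S[of \<gamma> "Suc k"] by auto
    have "\<gamma> \<noteq> gap_pair l j" for l j using g(3) cards[of l j] k by auto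
    then obtain \<delta> where d: "\<delta> \<in> ts_solitons \<omega> [i + 1..i' - 1]" "\<gamma> = lift \<delta>"
      using g(2) unfolding ts_excursion(1)[OF g(1)] by blast
    have "card \<delta> = 2 * k" using ts_excursion(2)[OF g(1) d(1)] g(3) d(2) by simp
    hence "\<delta> \<in> solitons k \<omega>" unfolding solitons_consecutive[OF recurrent_\<omega>] using g(1) d(1) by blast
    thus "\<gamma> \<in> lift ` solitons k \<omega>" using d(2) by blast
  next
    fix \<gamma> assume "\<gamma> \<in> lift ` solitons k \<omega>"
    then obtain \<delta> i i' where d: "\<gamma> = lift \<delta>" "card \<delta> = 2 * k" "consecutive \<omega> i i'"
        "\<delta> \<in> ts_solitons \<omega> [i + 1..i' - 1]"
      unfolding solitons_consecutive[OF recurrent_\<omega>] by blast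
    have "card \<gamma> = 2 * Suc k" using ts_excursion(2)[OF d(3,4)] d by simp
    moreover have "\<gamma> \<in> ts_solitons \<eta> [s i + 1..s i' - 1]" unfolding ts_excursion(1)[OF d(3)] using d by blast
    ultimately show "\<gamma> \<in> solitons (Suc k) \<eta>" using d(3) S by blast
  qed
qed

end

section \<open>The tower of contractions and tagged solitons\<close>

text \<open>All iterated contractions at once: \<open>c l\<close> is obtained from \<open>c 0\<close> by \<open>l\<close> deletions, with the
  enumerations \<open>s\<close> of the slots at all levels.\<close>

definition tower :: "(nat \<Rightarrow> config) \<Rightarrow> (nat \<Rightarrow> int \<Rightarrow> int) \<Rightarrow> bool" where
  "tower c s \<longleftrightarrow> (\<forall>l. slot_map (c l) (s l) \<and> c (Suc l) = c l \<circ> s l)"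

lemma tower_slot_map: "tower c s \<Longrightarrow> slot_map (c l) (s l)"
  by (simp add: tower_def)

lemma tower_Suc: "tower c s \<Longrightarrow> tower (\<lambda>l. c (Suc l)) (\<lambda>l. s (Suc l))"
  unfolding tower_def by blast

lemma tower_omega: "tower c s \<Longrightarrow> slot_map.\<omega> (c l) (s l) = c (Suc l)"
  using slot_map.\<omega>_def[OF tower_slot_map, of c s l] by (simp add: tower_def)

text \<open>The \<open>j\<close>-th soliton of size \<open>k + 1\<close> in slot \<open>J\<close>, numbered from \<open>0\<close>: a pair in a gap at level \<open>k\<close>,
  lifted to level \<open>0\<close>.  Its first site and the site of its slot follow by the same recursion.\<close>

primrec sol :: "(nat \<Rightarrow> config) \<Rightarrow> (nat \<Rightarrow> int \<Rightarrow> int) \<Rightarrow> nat \<Rightarrow> int \<Rightarrow> int \<Rightarrow> int set" where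
  "sol c s 0 J j = slot_map.gap_pair (s 0) J j"
| "sol c s (Suc k) J j = slot_map.lift (c 0) (s 0) (sol (\<lambda>l. c (Suc l)) (\<lambda>l. s (Suc l)) k J j)"

primrec sol_start :: "(nat \<Rightarrow> int \<Rightarrow> int) \<Rightarrow> nat \<Rightarrow> int \<Rightarrow> int" where
  "sol_start s 0 J = s 0 J + 1"
| "sol_start s (Suc k) J = s 0 (sol_start (\<lambda>l. s (Suc l)) k J) - 1"

primrec slot_site :: "(nat \<Rightarrow> int \<Rightarrow> int) \<Rightarrow> nat \<Rightarrow> int \<Rightarrow> int" where
  "slot_site s 0 J = s 0 J"
| "slot_site s (Suc k) J = s 0 (slot_site (\<lambda>l. s (Suc l)) k J)"

context slot_map begin

lemma head_gap: "\<omega> y \<noteq> \<omega> (y - 1) \<Longrightarrow> s (y - 1) + 2 \<le> s y"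
  using gap[of "y - 1"] gap_pairs_nonneg[of "y - 1"] by simp

lemma head_not_slot:
  assumes "\<omega> y \<noteq> \<omega> (y - 1)"
  shows "s y - 1 \<notin> slots \<eta>"
  using head_gap[OF assms] enumerates_no_between[OF enum, of "y - 1" "s y - 1"] by simp

lemma gap_pair_not_slot:
  assumes "0 \<le> j" "j < gap_pairs s i" "x \<in> gap_pair i j"
  shows "x \<notin> slots \<eta>" "s i < x" "x < s (i + 1)"
proof -
  show a: "s i < x" using assms by (auto simp: gap_pair_def)
  show b: "x < s (i + 1)" using assms gap[of i] by (auto simp: gap_pair_def of_bool_def split: if_splits)
  show "x \<notin> slots \<eta>" using enumerates_no_between[OF enum a b] .
qed

lemma non_slot_cases:
  assumes "x \<notin> slots \<eta>"
  shows "(\<exists>i j. 0 \<le> j \<and> j < gap_pairs s i \<and> x \<in> gap_pair i j) \<or> (\<exists>y. \<omega> y \<noteq> \<omega> (y - 1) \<and> x = s y - 1)"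
proof -
  define i where "i = idx s x"
  have i: "s i \<le> x" "x < s (i + 1)" using idx_le[OF mono] less_idx_Suc[OF mono] by (auto simp: i_def)
  have "x \<noteq> s i" using assms range_s by (metis rangeI)
  hence lt: "s i < x" using i by simp
  define j where "j = (x - s i - 1) div 2"
  have x: "x = s i + 1 + 2 * j \<or> x = s i + 2 + 2 * j" "0 \<le> j" unfolding j_def using lt by presburger+
  show ?thesis
  proof (cases "j < gap_pairs s i")
    case True
    thus ?thesis using x by (auto simp: gap_pair_def)
  next
    case False
    hence "x = s (i + 1) - 1" "\<omega> (i + 1) \<noteq> \<omega> i" using x i(2) gap[of i] by (auto simp: of_bool_def split: if_splits)
    thus ?thesis by (intro disjI2 exI[of _ "i + 1"]) simp
  qed
qed

lemma lift_bounds: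
  assumes "finite \<delta>" "\<delta> \<noteq> {}" "\<omega> (Inf \<delta>) \<noteq> \<omega> (Inf \<delta> - 1)"
  shows "Inf (lift \<delta>) = s (Inf \<delta>) - 1" "Sup (lift \<delta>) = s (Sup \<delta>)" "Inf (lift \<delta>) \<notin> slots \<eta>"
    "finite (lift \<delta>)" "lift \<delta> \<noteq> {}"
proof -
  have I: "Inf \<delta> \<in> \<delta>" "\<And>y. y \<in> \<delta> \<Longrightarrow> Inf \<delta> \<le> y" using assms by (auto simp: cInf_eq_Min)
  have S: "Sup \<delta> \<in> \<delta>" "\<And>y. y \<in> \<delta> \<Longrightarrow> y \<le> Sup \<delta>" using assms by (auto simp: cSup_eq_Max)
  show i: "Inf (lift \<delta>) = s (Inf \<delta>) - 1"
  proof (rule cInf_eq_minimum)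
    show "s (Inf \<delta>) - 1 \<in> lift \<delta>" using I assms by (auto simp: lift_def)
    fix x assume "x \<in> lift \<delta>"
    then obtain y where "y \<in> \<delta>" "s y - 1 \<le> x" by (auto simp: lift_def)
    moreover from this have "s (Inf \<delta>) \<le> s y" using I(2) s_le by blast
    ultimately show "s (Inf \<delta>) - 1 \<le> x" by linarith
  qed
  show "Sup (lift \<delta>) = s (Sup \<delta>)"
  proof (rule cSup_eq_maximum)
    show "s (Sup \<delta>) \<in> lift \<delta>" using S by (auto simp: lift_def)
    fix x assume "x \<in> lift \<delta>"
    hence "\<exists>y\<in>\<delta>. x = s y \<or> x = s y - 1" by (auto simp: lift_def)
    then obtain y where "y \<in> \<delta>" "x \<le> s y" by auto
    moreover from this have "s y \<le> s (Sup \<delta>)" using S(2) s_le by blast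
    ultimately show "x \<le> s (Sup \<delta>)" by linarith
  qed
  show "Inf (lift \<delta>) \<notin> slots \<eta>" using i head_not_slot[OF assms(3)] by simp
  have "lift \<delta> \<subseteq> s ` \<delta> \<union> (\<lambda>y. s y - 1) ` \<delta>" by (auto simp: lift_def)
  thus "finite (lift \<delta>)" by (rule finite_subset) (use assms in simp)
  show "lift \<delta> \<noteq> {}" using assms by (auto simp: lift_def)
qed

text \<open>Follow the letters of a pair: at a record slot the pair moves one site to the right, otherwise it
  stays and is flipped.  In both cases the empty site becomes the ball.\<close>

lemma ones_gap_pair:
  "{x \<in> slot_map.gap_pair s' i j. bbs \<eta> x} = {x \<in> gap_pair i j. \<not> \<eta> x}"
  if j: "0 \<le> j" "j < gap_pairs s i" and rb: "recurrent (bbs \<eta>)" for i j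
proof -
  interpret B: slot_map "bbs \<eta>" s' using slot_map_bbs[OF rb] .
  have Bw: "B.\<omega> = bbs \<omega>" by (simp add: B.\<omega>_def bbs_contract)
  let ?a = "s i + 1 + 2 * j"
  have a: "?a \<in> gap_pair i j" "?a + 1 \<in> gap_pair i j" by (auto simp: gap_pair_def)
  have lt: "?a < s (i + 1)" "?a + 1 < s (i + 1)" using gap_pair_not_slot(3)[OF j] a by auto
  have e: "\<eta> ?a = (\<not> \<omega> i)" "\<eta> (?a + 1) = \<omega> i"
    using alternating[of i ?a] alternating[of i "?a + 1"] lt j by auto
  let ?b = "s' i + 1 + 2 * j"
  have b: "?b \<in> B.gap_pair i j" "?b + 1 \<in> B.gap_pair i j" by (auto simp: B.gap_pair_def)
  have jb: "0 \<le> j" "j < gap_pairs s' i" using j gap_pairs_bbs by auto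
  have ltb: "?b < s' (i + 1)" "?b + 1 < s' (i + 1)" using B.gap_pair_not_slot(3)[OF jb] b by auto
  have eb: "bbs \<eta> ?b = (\<not> bbs \<omega> i)" "bbs \<eta> (?b + 1) = bbs \<omega> i"
    using B.alternating[of i ?b] B.alternating[of i "?b + 1"] ltb j by (auto simp: Bw)
  have P: "gap_pair i j = {?a, ?a + 1}" "B.gap_pair i j = {?b, ?b + 1}"
    by (auto simp: gap_pair_def B.gap_pair_def)
  obtain a b where ab: "a = ?a" "b = ?b" by blast
  note E = e[folded ab(1)] and EB = eb[folded ab(2)] and P' = P[folded ab]
  show ?thesis
  proof (cases "is_record \<omega> i")
    case True
    hence "b = a + 1" "\<not> \<omega> i" "\<not> bbs \<omega> i" using recordD(1) ab by (auto simp: s'_def bbs_def)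
    thus ?thesis unfolding P' using E EB by auto
  next
    case False
    hence "b = a" "bbs \<omega> i = (\<not> \<omega> i)" using ab by (auto simp: s'_def bbs_def)
    thus ?thesis unfolding P' using E EB by auto
  qed
qed

text \<open>If a soliton of the contraction moves as required, then so does its lift: its empty slots are not
  records, hence keep their sites, and the added sites carry the letters of their slots.\<close>

lemma ones_lift:
  assumes rb: "recurrent (bbs \<eta>)" and d: "{y \<in> \<delta>'. bbs \<omega> y} = {y \<in> \<delta>. \<not> \<omega> y}"
    and nr: "\<And>y. y \<in> \<delta> \<Longrightarrow> \<not> is_record \<omega> y"
  shows "{x \<in> slot_map.lift (bbs \<eta>) s' \<delta>'. bbs \<eta> x} = {x \<in> lift \<delta>. \<not> \<eta> x}"
proof -
  interpret B: slot_map "bbs \<eta>" s' using slot_map_bbs[OF rb] .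
  have Bw: "B.\<omega> = bbs \<omega>" by (simp add: B.\<omega>_def bbs_contract)
  have v: "bbs \<eta> (s' y) = bbs \<omega> y" "bbs \<eta> (s' y - 1) = bbs \<omega> y" for y
    using B.s_slot[of y] by (auto simp: bbs_contract)
  have v': "\<eta> (s y) = \<omega> y" "\<eta> (s y - 1) = \<omega> y" for y
    using s_slot[of y] by (auto simp: \<omega>_def)
  have L: "{x \<in> B.lift \<delta>'. bbs \<eta> x} =
     s' ` {y \<in> \<delta>'. bbs \<omega> y} \<union> (\<lambda>y. s' y - 1) ` {y \<in> {y \<in> \<delta>'. bbs \<omega> y}. \<not> bbs \<omega> (y - 1)}"
    unfolding B.lift_def Bw using v by auto
  have R: "{x \<in> lift \<delta>. \<not> \<eta> x} =
     s ` {y \<in> \<delta>. \<not> \<omega> y} \<union> (\<lambda>y. s y - 1) ` {y \<in> {y \<in> \<delta>. \<not> \<omega> y}. \<omega> (y - 1)}"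
    unfolding lift_def using v' by auto
  have "s' y = s y" "(\<not> bbs \<omega> (y - 1)) = \<omega> (y - 1)" if "y \<in> {y \<in> \<delta>. \<not> \<omega> y}" for y
  proof -
    show "s' y = s y" using nr that by (simp add: s'_def)
    have "\<not> is_record \<omega> (y - 1)" using record_Suc[of \<omega> y] nr that by auto
    thus "(\<not> bbs \<omega> (y - 1)) = \<omega> (y - 1)" by (simp add: bbs_def)
  qed
  thus ?thesis unfolding L R d by (intro arg_cong2[of _ _ _ _ "(\<union>)"] image_cong) auto
qed

end

lemma solitons_tower:
  assumes "tower c s"
  shows "solitons (Suc k) (c 0) = {sol c s k J j | J j. 0 \<le> j \<and> j < gap_pairs (s k) J}"
  using assms
proof (induction k arbitrary: c s)
  case 0
  then interpret slot_map "c 0" "s 0" by (rule tower_slot_map)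
  show ?case using solitons_contract(1) by simp
next
  case (Suc k)
  interpret slot_map "c 0" "s 0" using tower_slot_map[OF Suc.prems] .
  have "solitons (Suc (Suc k)) (c 0) = lift ` solitons (Suc k) (c (Suc 0))"
    using solitons_contract(2)[of "Suc k"] tower_omega[OF Suc.prems, of 0] by simp
  also have "solitons (Suc k) (c (Suc 0)) = {sol (\<lambda>l. c (Suc l)) (\<lambda>l. s (Suc l)) k J j | J j. 0 \<le> j \<and> j < gap_pairs (s (Suc k)) J}"
    using Suc.IH[OF tower_Suc[OF Suc.prems]] by simp
  finally show ?case by auto
qed

lemma sol_bounds:
  assumes "tower c s" "0 \<le> j" "j < gap_pairs (s k) J"
  shows "finite (sol c s k J j) \<and> sol c s k J j \<noteq> {} \<and> Inf (sol c s k J j) \<notin> slots (c 0)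
    \<and> (j = 0 \<longrightarrow> Inf (sol c s k J j) = sol_start s k J)
    \<and> slot_site s k J < Inf (sol c s k J j) \<and> Sup (sol c s k J j) < slot_site s k (J + 1)"
  using assms
proof (induction k arbitrary: c s)
  case 0
  interpret slot_map "c 0" "s 0" using tower_slot_map[OF 0(1)] .
  have "Inf (gap_pair J j) = s 0 J + 1 + 2 * j" by (rule cInf_eq_minimum) (auto simp: gap_pair_def)
  moreover have "Sup (gap_pair J j) = s 0 J + 2 + 2 * j" by (rule cSup_eq_maximum) (auto simp: gap_pair_def)
  moreover have "s 0 J + 1 + 2 * j \<in> gap_pair J j" "s 0 J + 2 + 2 * j \<in> gap_pair J j" by (auto simp: gap_pair_def)
  ultimately show ?case using gap_pair_not_slot[OF 0(2,3)] 0 by (auto simp: gap_pair_def)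
next
  case (Suc k)
  interpret slot_map "c 0" "s 0" using tower_slot_map[OF Suc.prems(1)] .
  let ?d = "sol (\<lambda>l. c (Suc l)) (\<lambda>l. s (Suc l)) k J j"
  note IH = Suc.IH[OF tower_Suc[OF Suc.prems(1)] Suc.prems(2,3)]
  have w: "\<omega> = c (Suc 0)" using tower_omega[OF Suc.prems(1), of 0] .
  have h: "\<omega> (Inf ?d) \<noteq> \<omega> (Inf ?d - 1)" using IH by (simp add: w slots_def)
  note L = lift_bounds[of ?d, OF _ _ h]
  have "s 0 (slot_site (\<lambda>l. s (Suc l)) k J) \<le> s 0 (Inf ?d - 1)" using IH s_le by simp
  hence "slot_site s (Suc k) J < Inf (lift ?d)" using L(1) IH head_gap[OF h] by simp
  moreover have "Sup (lift ?d) < slot_site s (Suc k) (J + 1)" using L(2) IH s_less by simp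
  moreover have "j = 0 \<longrightarrow> Inf (lift ?d) = s 0 (sol_start (\<lambda>l. s (Suc l)) k J) - 1"
  proof
    assume "j = 0"
    hence e: "Inf ?d = sol_start (\<lambda>l. s (Suc l)) k J" using IH by blast
    have "Inf (lift ?d) = s 0 (Inf ?d) - 1" using L(1) IH by blast
    thus "Inf (lift ?d) = s 0 (sol_start (\<lambda>l. s (Suc l)) k J) - 1" unfolding e .
  qed
  ultimately show ?case using IH L by simp
qed

lemma sol_start_mono:
  assumes "tower c s" "J < J'"
  shows "sol_start s k J < sol_start s k J'" "slot_site s k J < slot_site s k J'"
proof -
  have "sol_start s k J < sol_start s k J' \<and> slot_site s k J < slot_site s k J'"
    using assms
  proof (induction k arbitrary: c s)
    case 0
    interpret slot_map "c 0" "s 0" using tower_slot_map[OF 0(1)] .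
    show ?case using 0 s_less[of J J'] by simp
  next
    case (Suc k)
    interpret slot_map "c 0" "s 0" using tower_slot_map[OF Suc.prems(1)] .
    show ?case using Suc.IH[OF tower_Suc[OF Suc.prems(1)] Suc.prems(2)] s_less by simp
  qed
  thus "sol_start s k J < sol_start s k J'" "slot_site s k J < slot_site s k J'" by auto
qed

text \<open>Between two solitons of the same slot there are only sites of solitons that are not larger.\<close>

lemma sol_between:
  assumes "tower c s" "0 \<le> j" "j < j'" "j' < gap_pairs (s k) J"
    and "Sup (sol c s k J j) \<le> x" "x < Inf (sol c s k J j')"
  shows "\<exists>l\<le>Suc k. \<exists>\<gamma>\<in>solitons l (c 0). x \<in> \<gamma>"
  using assms
proof (induction k arbitrary: c s x)
  case 0
  interpret slot_map "c 0" "s 0" using tower_slot_map[OF 0(1)] .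
  have "Inf (gap_pair J j') = s 0 J + 1 + 2 * j'" by (rule cInf_eq_minimum) (auto simp: gap_pair_def)
  moreover have "Sup (gap_pair J j) = s 0 J + 2 + 2 * j" by (rule cSup_eq_maximum) (auto simp: gap_pair_def)
  ultimately have x: "s 0 J + 2 + 2 * j \<le> x" "x < s 0 J + 1 + 2 * j'" using 0 by auto
  define i where "i = (x - s 0 J - 1) div 2"
  have "x = s 0 J + 1 + 2 * i \<or> x = s 0 J + 2 + 2 * i" "0 \<le> i" "i < j'"
    unfolding i_def using x 0(2) by presburger+
  hence i: "x \<in> gap_pair J i" "0 \<le> i" "i < gap_pairs (s 0) J" using 0(4) by (auto simp: gap_pair_def)
  have "gap_pair J i \<in> solitons 1 (c 0)" unfolding solitons_contract(1) using i(2,3) by blast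
  moreover have "1 \<le> Suc 0" by simp
  ultimately show ?case using i(1) by blast
next
  case (Suc k)
  interpret slot_map "c 0" "s 0" using tower_slot_map[OF Suc.prems(1)] .
  let ?d = "sol (\<lambda>l. c (Suc l)) (\<lambda>l. s (Suc l)) k J j"
  let ?e = "sol (\<lambda>l. c (Suc l)) (\<lambda>l. s (Suc l)) k J j'"
  have w: "\<omega> = c (Suc 0)" using tower_omega[OF Suc.prems(1), of 0] .
  have j: "0 \<le> j" "j < gap_pairs (s (Suc k)) J" "0 \<le> j'" using Suc.prems by auto
  note bd = sol_bounds[OF tower_Suc[OF Suc.prems(1)] j(1,2)] and be = sol_bounds[OF tower_Suc[OF Suc.prems(1)] j(3) Suc.prems(4)]
  have hd: "\<omega> (Inf ?d) \<noteq> \<omega> (Inf ?d - 1)" and he: "\<omega> (Inf ?e) \<noteq> \<omega> (Inf ?e - 1)"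
    using bd be by (auto simp: w slots_def)
  have lo: "s 0 (Sup ?d) \<le> x" using Suc.prems(5) lift_bounds(2)[OF _ _ hd] bd by simp
  have hi: "x < s 0 (Inf ?e) - 1" using Suc.prems(6) lift_bounds(1)[OF _ _ he] be by simp
  have IH: "\<exists>l\<le>Suc k. \<exists>\<gamma>\<in>solitons l \<omega>. y \<in> \<gamma>" if "Sup ?d \<le> y" "y < Inf ?e" for y
    using Suc.IH[OF tower_Suc[OF Suc.prems(1)] Suc.prems(2-4) that] by (simp add: w)
  have up: "lift \<gamma> \<in> solitons (Suc l) (c 0)" if "\<gamma> \<in> solitons l \<omega>" for \<gamma> l
    using solitons_contract(2) soliton_props(4)[OF recurrent_\<omega> that] that by blast
  show ?case
  proof (cases "x \<in> slots (c 0)")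
    case True
    then obtain y where y: "x = s 0 y" using range_s by auto
    have "Sup ?d \<le> y" "y < Inf ?e" using lo hi s_le[of "Sup ?d" y] s_less[of y "Inf ?e"] y by auto
    then obtain l \<gamma> where g: "l \<le> Suc k" "\<gamma> \<in> solitons l \<omega>" "y \<in> \<gamma>" using IH by blast
    have "x \<in> lift \<gamma>" using g y by (auto simp: lift_def)
    moreover have "Suc l \<le> Suc (Suc k)" using g(1) by simp
    ultimately show ?thesis using up[OF g(2)] by blast
  next
    case False
    from non_slot_cases[OF False] show ?thesis
    proof
      assume "\<exists>i j. 0 \<le> j \<and> j < gap_pairs (s 0) i \<and> x \<in> gap_pair i j"
      then obtain i m where m: "0 \<le> m" "m < gap_pairs (s 0) i" "x \<in> gap_pair i m" by blast
      hence "gap_pair i m \<in> solitons 1 (c 0)" using solitons_contract(1) by blast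
      moreover have "1 \<le> Suc (Suc k)" by simp
      ultimately show ?thesis using m(3) by blast
    next
      assume "\<exists>y. \<omega> y \<noteq> \<omega> (y - 1) \<and> x = s 0 y - 1"
      then obtain y where y: "\<omega> y \<noteq> \<omega> (y - 1)" "x = s 0 y - 1" by blast
      have "Sup ?d \<le> y" "y < Inf ?e" using lo hi s_le[of "Sup ?d" y] s_less[of y "Inf ?e"] y by auto
      then obtain l \<gamma> where g: "l \<le> Suc k" "\<gamma> \<in> solitons l \<omega>" "y \<in> \<gamma>" using IH by blast
      have "x \<in> lift \<gamma>" using g y by (auto simp: lift_def)
      moreover have "Suc l \<le> Suc (Suc k)" using g(1) by simp
      ultimately show ?thesis using up[OF g(2)] by blast
    qed
  qed
qed

text \<open>The site of a slot of size \<open>k + 1\<close> separates the solitons in different slots: it is a record or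
  lies in a larger soliton.\<close>

lemma slot_site_large:
  assumes "tower c s"
  shows "is_record (c 0) (slot_site s k J) \<or> (\<exists>l\<ge>Suc (Suc k). \<exists>\<gamma>\<in>solitons l (c 0). slot_site s k J \<in> \<gamma>)"
  using assms
proof (induction k arbitrary: c s)
  case 0
  interpret slot_map "c 0" "s 0" using tower_slot_map[OF 0(1)] .
  show ?case
  proof (cases "is_record (c 0) (s 0 J)")
    case False
    then obtain l \<gamma> where g: "\<gamma> \<in> solitons l (c 0)" "s 0 J \<in> \<gamma>" using solitons_cover[OF recurrent] by blast
    have "l \<noteq> 1"
    proof
      assume "l = 1"
      then obtain i m where "\<gamma> = gap_pair i m" "0 \<le> m" "m < gap_pairs (s 0) i" using g(1) solitons_contract(1) by auto
      thus False using gap_pair_not_slot(1) g(2) range_s by blast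
    qed
    moreover have "1 \<le> l" using soliton_props(4)[OF recurrent g(1)] .
    ultimately have "Suc (Suc 0) \<le> l" by simp
    thus ?thesis using g by auto
  qed simp
next
  case (Suc k)
  interpret slot_map "c 0" "s 0" using tower_slot_map[OF Suc.prems(1)] .
  have w: "\<omega> = c (Suc 0)" using tower_omega[OF Suc.prems(1), of 0] .
  let ?y = "slot_site (\<lambda>l. s (Suc l)) k J"
  have "is_record \<omega> ?y \<or> (\<exists>l\<ge>Suc (Suc k). \<exists>\<gamma>\<in>solitons l \<omega>. ?y \<in> \<gamma>)"
    using Suc.IH[OF tower_Suc[OF Suc.prems]] by (simp add: w)
  thus ?case
  proof
    assume "is_record \<omega> ?y"
    thus ?thesis using record_iff by simp
  next
    assume "\<exists>l\<ge>Suc (Suc k). \<exists>\<gamma>\<in>solitons l \<omega>. ?y \<in> \<gamma>"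
    then obtain l \<gamma> where g: "Suc (Suc k) \<le> l" "\<gamma> \<in> solitons l \<omega>" "?y \<in> \<gamma>" by blast
    have "lift \<gamma> \<in> solitons (Suc l) (c 0)" using solitons_contract(2)[of l] g by auto
    moreover have "s 0 ?y \<in> lift \<gamma>" using g by (auto simp: lift_def)
    moreover have "Suc (Suc (Suc k)) \<le> Suc l" using g by simp
    ultimately show ?thesis unfolding slot_site.simps by blast
  qed
qed

lemma sol_order:
  assumes "tower c s" "0 \<le> j" "j < j'" "j' < gap_pairs (s k) J"
  shows "Sup (sol c s k J j) < Inf (sol c s k J j')"
  using assms
proof (induction k arbitrary: c s)
  case 0
  interpret slot_map "c 0" "s 0" using tower_slot_map[OF 0(1)] .
  have "Inf (gap_pair J j') = s 0 J + 1 + 2 * j'" by (rule cInf_eq_minimum) (auto simp: gap_pair_def)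
  moreover have "Sup (gap_pair J j) = s 0 J + 2 + 2 * j" by (rule cSup_eq_maximum) (auto simp: gap_pair_def)
  ultimately show ?case using 0 by simp
next
  case (Suc k)
  interpret slot_map "c 0" "s 0" using tower_slot_map[OF Suc.prems(1)] .
  let ?d = "sol (\<lambda>l. c (Suc l)) (\<lambda>l. s (Suc l)) k J j"
  let ?e = "sol (\<lambda>l. c (Suc l)) (\<lambda>l. s (Suc l)) k J j'"
  have w: "\<omega> = c (Suc 0)" using tower_omega[OF Suc.prems(1), of 0] .
  have j: "0 \<le> j" "j < gap_pairs (s (Suc k)) J" "0 \<le> j'" using Suc.prems by auto
  note bd = sol_bounds[OF tower_Suc[OF Suc.prems(1)] j(1,2)] and be = sol_bounds[OF tower_Suc[OF Suc.prems(1)] j(3) Suc.prems(4)]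
  have hd: "\<omega> (Inf ?d) \<noteq> \<omega> (Inf ?d - 1)" and he: "\<omega> (Inf ?e) \<noteq> \<omega> (Inf ?e - 1)"
    using bd be by (auto simp: w slots_def)
  have "Sup ?d < Inf ?e" using Suc.IH[OF tower_Suc[OF Suc.prems(1)] Suc.prems(2-4)] .
  hence "s 0 (Sup ?d) \<le> s 0 (Inf ?e - 1)" using s_le by simp
  thus ?case using lift_bounds(2)[OF _ _ hd] lift_bounds(1)[OF _ _ he] bd be head_gap[OF he] by simp
qed

text \<open>So two solitons of the same size are connected exactly when they are in the same slot, and the
  leading solitons are those with \<open>j = 0\<close>.\<close>

lemma lead_solitons_tower:
  assumes t: "tower c s"
  shows "lead_solitons (Suc k) (c 0) = {sol c s k J 0 | J. 0 < gap_pairs (s k) J}"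
proof -
  interpret slot_map "c 0" "s 0" using tower_slot_map[OF t] .
  note S = solitons_tower[OF t, of k]
  note B = sol_bounds[OF t]
  have site_le: "slot_site s k J \<le> slot_site s k J'" if "J \<le> J'" for J J'
    using sol_start_mono(2)[OF t, of J J' k] that by (cases "J = J'") auto
  have sep: "Sup (sol c s k J' j') < slot_site s k J \<and> slot_site s k J < Inf (sol c s k J j)"
    if "0 \<le> j" "j < gap_pairs (s k) J" "0 \<le> j'" "j' < gap_pairs (s k) J'" "J' < J" for J J' j j'
    using B[OF that(1,2)] B[OF that(3,4)] site_le[of "J' + 1" J] that(5) by auto
  have le: "Inf (sol c s k J j) \<le> Sup (sol c s k J j)" if "0 \<le> j" "j < gap_pairs (s k) J" for J j
    using B[OF that] by (auto simp: cInf_eq_Min cSup_eq_Max)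
  show ?thesis
  proof (intro equalityI subsetI)
    fix \<gamma> assume g: "\<gamma> \<in> lead_solitons (Suc k) (c 0)"
    hence gs: "\<gamma> \<in> solitons (Suc k) (c 0)" by (simp add: lead_solitons_def)
    then obtain J j where Jj: "\<gamma> = sol c s k J j" "0 \<le> j" "j < gap_pairs (s k) J" using S by blast
    have "j = 0"
    proof (rule ccontr)
      assume "j \<noteq> 0"
      hence j: "0 < j" using Jj by simp
      let ?\<gamma> = "sol c s k J 0"
      have z: "0 < gap_pairs (s k) J" using j Jj by simp
      have g0: "?\<gamma> \<in> solitons (Suc k) (c 0)" using S z by blast
      have "Inf ?\<gamma> \<le> Sup ?\<gamma>" using le[of 0 J] z by simp
      also have "\<dots> < Inf \<gamma>" using sol_order[OF t _ j Jj(3)] Jj(1) by simp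
      finally have lt: "lpos ?\<gamma> < lpos \<gamma>" by (simp add: lpos_def)
      have "soliton_conn (Suc k) (c 0) ?\<gamma> \<gamma>" unfolding soliton_conn_def
      proof (intro conjI ballI lt)
        fix x assume "x \<in> {rpos ?\<gamma>..lpos \<gamma>}"
        hence "Sup ?\<gamma> \<le> x" "x < Inf \<gamma>" by (auto simp: rpos_def lpos_def)
        hence "\<exists>l\<le>Suc k. \<exists>\<delta>\<in>solitons l (c 0). x \<in> \<delta>"
          using sol_between[OF t order_refl j Jj(3), of x] Jj(1) by simp
        then obtain l \<delta> where d: "l \<le> Suc k" "\<delta> \<in> solitons l (c 0)" "x \<in> \<delta>" by blast
        show "\<not> is_record (c 0) x" using soliton_props(6)[OF recurrent d(2,3)] .
        show "\<forall>l\<ge>Suc k + 1. \<forall>\<delta>\<in>solitons l (c 0). x \<notin> \<delta>"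
        proof (intro allI impI ballI notI)
          fix l' \<delta>' assume l': "Suc k + 1 \<le> l'" "\<delta>' \<in> solitons l' (c 0)" "x \<in> \<delta>'"
          have "\<delta>' = \<delta>" using solitons_disjoint[OF recurrent l'(2) d(2) l'(3) d(3)] .
          thus False using soliton_props(5)[OF recurrent d(2)] soliton_props(5)[OF recurrent l'(2)] d(1) l'(1) by simp
        qed
      qed
      hence "?\<gamma> \<in> Con (Suc k) (c 0) \<gamma>" using g0 by (simp add: Con_def)
      hence "lpos \<gamma> \<le> lpos ?\<gamma>" using g by (auto simp: lead_solitons_def)
      thus False using lt by simp
    qed
    thus "\<gamma> \<in> {sol c s k J 0 | J. 0 < gap_pairs (s k) J}" using Jj by blast
  next
    fix \<gamma> assume "\<gamma> \<in> {sol c s k J 0 | J. 0 < gap_pairs (s k) J}"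
    then obtain J where J: "\<gamma> = sol c s k J 0" "0 < gap_pairs (s k) J" by blast
    have gs: "\<gamma> \<in> solitons (Suc k) (c 0)" using S J by blast
    have "lpos \<gamma> \<le> lpos \<gamma>'" if c: "\<gamma>' \<in> Con (Suc k) (c 0) \<gamma>" for \<gamma>'
    proof (rule ccontr)
      assume "\<not> ?thesis"
      hence lt: "Inf \<gamma>' < Inf \<gamma>" by (simp add: lpos_def)
      have con: "soliton_conn (Suc k) (c 0) \<gamma>' \<gamma>" using c lt by (auto simp: Con_def soliton_conn_def lpos_def)
      obtain J' j' where J': "\<gamma>' = sol c s k J' j'" "0 \<le> j'" "j' < gap_pairs (s k) J'"
        using c S unfolding Con_def by blast
      consider "J' < J" | "J' = J" | "J < J'" by linarith
      thus False
      proof cases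
        case 1
        let ?x = "slot_site s k J"
        have "?x \<in> {rpos \<gamma>'..lpos \<gamma>}" using sep[OF _ J(2) J'(2,3) 1] J(1) J'(1) by (simp add: rpos_def lpos_def)
        hence "\<not> is_record (c 0) ?x" "\<forall>l\<ge>Suc k + 1. \<forall>\<delta>\<in>solitons l (c 0). ?x \<notin> \<delta>"
          using con unfolding soliton_conn_def by blast+
        thus False using slot_site_large[OF t, of k J] by auto
      next
        case 2
        have "j' \<noteq> 0" using 2 J J' lt by auto
        hence "Sup \<gamma> < Inf \<gamma>'" using sol_order[OF t _ _ J'(3), of 0] J J' 2 by simp
        thus False using le[of 0 J] J lt by simp
      next
        case 3
        hence "Sup \<gamma> < Inf \<gamma>'" using sep[OF J'(2,3) _ J(2) 3] J(1) J'(1) by simp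
        thus False using le[of 0 J] J lt by simp
      qed
    qed
    thus "\<gamma> \<in> lead_solitons (Suc k) (c 0)" using gs by (simp add: lead_solitons_def)
  qed
qed

section \<open>Tagged solitons in time\<close>

lemma sol_ones:
  assumes "tower c s" "tower c' s'" "\<And>l. c' l = bbs (c l)"
    "\<And>l. s' l = slot_map.s' (c l) (s l)" "0 \<le> j" "j < gap_pairs (s k) J"
  shows "{x \<in> sol c' s' k J j. c' 0 x} = {x \<in> sol c s k J j. \<not> c 0 x}"
  using assms
proof (induction k arbitrary: c s c' s')
  case 0
  interpret slot_map "c 0" "s 0" using tower_slot_map[OF 0(1)] .
  have "recurrent (bbs (c 0))" using slot_map.recurrent[OF tower_slot_map[OF 0(2), of 0]] 0(3) by simp
  from ones_gap_pair[OF 0(5,6) this] show ?case by (simp add: 0(3,4))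
next
  case (Suc k)
  interpret slot_map "c 0" "s 0" using tower_slot_map[OF Suc.prems(1)] .
  have rb: "recurrent (bbs (c 0))" using slot_map.recurrent[OF tower_slot_map[OF Suc.prems(2), of 0]] Suc.prems(3) by simp
  have w: "\<omega> = c (Suc 0)" using tower_omega[OF Suc.prems(1), of 0] .
  let ?d = "sol (\<lambda>l. c (Suc l)) (\<lambda>l. s (Suc l)) k J j"
  let ?d' = "sol (\<lambda>l. c' (Suc l)) (\<lambda>l. s' (Suc l)) k J j"
  have "{x \<in> ?d'. bbs \<omega> x} = {x \<in> ?d. \<not> \<omega> x}"
    using Suc.IH[OF tower_Suc[OF Suc.prems(1)] tower_Suc[OF Suc.prems(2)], OF Suc.prems(3,4,5,6)]
    by (simp add: w Suc.prems(3))
  moreover have "?d \<in> solitons (Suc k) \<omega>"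
    using solitons_tower[OF tower_Suc[OF Suc.prems(1)], of k] Suc.prems(5,6) by (auto simp: w)
  hence "\<And>y. y \<in> ?d \<Longrightarrow> \<not> is_record \<omega> y" using soliton_props(6)[OF recurrent_\<omega>] by blast
  ultimately show ?case using ones_lift[OF rb] by (simp add: Suc.prems(3,4))
qed

lemma soliton_next_tower:
  assumes t: "tower c s" and t': "tower c' s'" and c': "\<And>l. c' l = bbs (c l)"
    and s': "\<And>l. s' l = slot_map.s' (c l) (s l)" and j: "0 \<le> j" "j < gap_pairs (s k) J"
  shows "soliton_next (Suc k) (c 0) (sol c s k J j) = sol c' s' k J j"
  unfolding soliton_next_def
proof (rule the_equality)
  let ?g = "sol c' s' k J j"
  have g': "gap_pairs (s' k) J = gap_pairs (s k) J"
    using slot_map.gap_pairs_bbs[OF tower_slot_map[OF t, of k]] by (simp add: s')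
  have rec: "recurrent (bbs (c 0))" using slot_map.recurrent[OF tower_slot_map[OF t', of 0]] c' by simp
  have ones: "{x \<in> ?g. bbs (c 0) x} = {x \<in> sol c s k J j. \<not> c 0 x}"
    using sol_ones[OF assms] unfolding c'[of 0] .
  have S: "?g \<in> solitons (Suc k) (bbs (c 0))" 
    using solitons_tower[OF t', of k] j unfolding c'[of 0] g'[symmetric] by blast
  show "?g \<in> solitons (Suc k) (bbs (c 0)) \<and> {x \<in> ?g. bbs (c 0) x} = {x \<in> sol c s k J j. \<not> c 0 x}"
    using ones S by simp
  fix h assume h: "h \<in> solitons (Suc k) (bbs (c 0)) \<and> {x \<in> h. bbs (c 0) x} = {x \<in> sol c s k J j. \<not> c 0 x}"
  obtain x where "x \<in> h" "bbs (c 0) x" using soliton_props(2)[OF rec] h by blast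
  hence "x \<in> ?g" using h ones by blast
  thus "h = ?g" using solitons_disjoint[OF rec _ S \<open>x \<in> h\<close>] h by blast
qed

text \<open>The labels after \<open>n\<close> steps: slots that are records move one site to the right.\<close>

primrec move :: "(nat \<Rightarrow> config) \<Rightarrow> (nat \<Rightarrow> int \<Rightarrow> int) \<Rightarrow> nat \<Rightarrow> nat \<Rightarrow> int \<Rightarrow> int" where
  "move c s 0 = s"
| "move c s (Suc n) = (\<lambda>l i. move c s n l i + of_bool (is_record ((bbs ^^ n) (c (Suc l))) i))"

text \<open>The contractions of the evolved configuration are the evolved contractions, and the counts in
  the slots are constant in time.  Recurrence passes from level to level and comes from
  \<^const>\<open>sloped\<close> at level \<open>0\<close>.\<close>

lemma tower_move:
  assumes t: "tower c s" and sl: "sloped (c 0)"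
  shows "tower (\<lambda>l. (bbs ^^ n) (c l)) (move c s n)"
    and "move c s (Suc n) l = slot_map.s' ((bbs ^^ n) (c l)) (move c s n l)"
    and "gap_pairs (move c s n l) = gap_pairs (s l)"
proof -
  have s'_eq: "move c s (Suc n) l = slot_map.s' ((bbs ^^ n) (c l)) (move c s n l)"
    if "slot_map ((bbs ^^ n) (c l)) (move c s n l)" "(bbs ^^ n) (c (Suc l)) = (bbs ^^ n) (c l) \<circ> move c s n l" for n l
    using slot_map.s'_def[OF that(1)] slot_map.\<omega>_def[OF that(1)] that(2) by auto
  have step: "slot_map ((bbs ^^ n) (c l)) (move c s n l) \<and> (bbs ^^ n) (c (Suc l)) = (bbs ^^ n) (c l) \<circ> move c s n l"
    if rec: "\<And>n. recurrent ((bbs ^^ n) (c l))" for n l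
  proof (induction n)
    case 0
    show ?case using t by (simp add: tower_def)
  next
    case (Suc n)
    interpret S: slot_map "(bbs ^^ n) (c l)" "move c s n l" using Suc by simp
    have s': "move c s (Suc n) l = S.s'" using s'_eq Suc by blast
    have "slot_map (bbs ((bbs ^^ n) (c l))) S.s'" using S.slot_map_bbs rec[of "Suc n"] by simp
    moreover have "S.\<omega> = (bbs ^^ n) (c (Suc l))" using conjunct2[OF Suc] unfolding S.\<omega>_def by (rule sym)
    hence "bbs ((bbs ^^ n) (c (Suc l))) = bbs ((bbs ^^ n) (c l)) \<circ> S.s'" using S.bbs_contract by simp
    ultimately show ?case unfolding s' by simp
  qed
  have rec: "recurrent ((bbs ^^ n) (c l))" for n l
  proof (induction l arbitrary: n)
    case 0
    show ?case using sloped_recurrent[OF sloped_iterate[OF sl]] .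
  next
    case (Suc l)
    note S = step[OF Suc, of n]
    show ?case
      using slot_map.recurrent_\<omega>[OF conjunct1[OF S]]
      unfolding slot_map.\<omega>_def[OF conjunct1[OF S]] conjunct2[OF S, symmetric] .
  qed
  show T: "tower (\<lambda>l. (bbs ^^ n) (c l)) (move c s n)" for n unfolding tower_def using step[OF rec] by blast
  show "move c s (Suc n) l = slot_map.s' ((bbs ^^ n) (c l)) (move c s n l)" for n l
    using s'_eq step[OF rec] by blast
  thus "gap_pairs (move c s n l) = gap_pairs (s l)"
  proof (induction n)
    case (Suc n)
    have "gap_pairs (move c s (Suc n) l) i = gap_pairs (move c s n l) i" for i
      using slot_map.gap_pairs_bbs[OF conjunct1[OF step[OF rec, of n l]]] unfolding Suc.prems[of n l] .
    thus ?case using Suc.IH[OF Suc.prems] by auto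
  qed simp
qed

lemma soliton_at_tower:
  assumes t: "tower c s" and sl: "sloped (c 0)" and j: "0 \<le> j" "j < gap_pairs (s k) J"
  shows "soliton_at (Suc k) (c 0) (sol c s k J j) n = sol (\<lambda>l. (bbs ^^ n) (c l)) (move c s n) k J j"
proof (induction n)
  case (Suc n)
  have "soliton_next (Suc k) ((bbs ^^ n) (c 0)) (sol (\<lambda>l. (bbs ^^ n) (c l)) (move c s n) k J j) =
      sol (\<lambda>l. (bbs ^^ Suc n) (c l)) (move c s (Suc n)) k J j"
    using soliton_next_tower[OF tower_move(1)[OF t sl, of n] tower_move(1)[OF t sl, of "Suc n"]
        _ tower_move(2)[OF t sl, of n] j(1)] tower_move(3)[OF t sl] j by simp
  thus ?case using Suc by simp
qed simp

lemma move_bounds: "s l i \<le> move c s n l i \<and> move c s n l i \<le> s l i + int n"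
  by (induction n) auto

text \<open>The contractions of a configuration, anchored at a record at the origin.\<close>

definition slot_enum :: "config \<Rightarrow> int \<Rightarrow> int" where
  "slot_enum \<eta> = (SOME s. enumerates s (slots \<eta>) \<and> (is_record \<eta> 0 \<longrightarrow> s 0 = 0))"

lemma slot_enum:
  assumes "recurrent \<eta>"
  shows "enumerates (slot_enum \<eta>) (slots \<eta>)" "is_record \<eta> 0 \<Longrightarrow> slot_enum \<eta> 0 = 0"
  using someI_ex[OF slot_map_exists[OF assms]] by (auto simp: slot_enum_def)

primrec contraction :: "config \<Rightarrow> nat \<Rightarrow> config" where
  "contraction \<eta> 0 = \<eta>"
| "contraction \<eta> (Suc l) = contraction \<eta> l \<circ> slot_enum (contraction \<eta> l)"

definition levels :: "config \<Rightarrow> nat \<Rightarrow> int \<Rightarrow> int" where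
  "levels \<eta> l = slot_enum (contraction \<eta> l)"

lemma contraction_recurrent: "recurrent \<eta> \<Longrightarrow> recurrent (contraction \<eta> l)"
proof (induction l)
  case (Suc l)
  interpret slot_map "contraction \<eta> l" "slot_enum (contraction \<eta> l)"
    using Suc slot_enum(1) by unfold_locales auto
  have "contraction \<eta> (Suc l) = \<omega>" by (simp add: \<omega>_def)
  thus ?case using recurrent_\<omega> by simp
qed simp

lemma tower_contraction: "recurrent \<eta> \<Longrightarrow> tower (contraction \<eta>) (levels \<eta>)"
  unfolding tower_def levels_def
  using contraction_recurrent slot_enum(1) by (auto intro!: slot_map.intro)

lemma contraction_anchor:
  assumes "recurrent \<eta>" "is_record \<eta> 0"
  shows "is_record (contraction \<eta> l) 0" "levels \<eta> l 0 = 0"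
proof -
  have *: "is_record (contraction \<eta> l) 0 \<and> levels \<eta> l 0 = 0"
  proof (induction l)
    case 0
    show ?case using assms slot_enum(2)[OF assms] by (simp add: levels_def)
  next
    case (Suc l)
    interpret slot_map "contraction \<eta> l" "levels \<eta> l"
      using tower_slot_map[OF tower_contraction[OF assms(1)]] .
    have "contraction \<eta> (Suc l) = \<omega>" unfolding \<omega>_def by (simp add: levels_def)
    hence "is_record (contraction \<eta> (Suc l)) 0" using record_iff[of 0] Suc by simp
    moreover from this have "levels \<eta> (Suc l) 0 = 0"
      using slot_enum(2)[OF contraction_recurrent[OF assms(1)], of "Suc l"] unfolding levels_def by blast
    ultimately show ?case by blast
  qed
  thus "is_record (contraction \<eta> l) 0" "levels \<eta> l 0 = 0" by auto
qed

text \<open>With a record at the origin at all levels, the solitons left of the origin are those in slots with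
  negative label.  This fixes the soliton with number \<open>0\<close>.\<close>

lemma sol_start_sign:
  assumes "tower c s" "\<And>l. s l 0 = 0" "0 < gap_pairs (s k) J"
  shows "0 \<le> J \<Longrightarrow> 0 < sol_start s k J" "J < 0 \<Longrightarrow> sol_start s k J \<le> 0"
proof -
  have "(0 \<le> J \<longrightarrow> 0 < sol_start s k J) \<and> (J < 0 \<longrightarrow> sol_start s k J \<le> 0)"
    using assms
  proof (induction k arbitrary: c s)
    case 0
    interpret slot_map "c 0" "s 0" using tower_slot_map[OF 0(1)] .
    show ?case using s_le[of 0 J] s_less[of J 0] 0(2)[of 0] by auto
  next
    case (Suc k)
    interpret slot_map "c 0" "s 0" using tower_slot_map[OF Suc.prems(1)] .
    let ?p = "sol_start (\<lambda>l. s (Suc l)) k J"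
    have IH: "(0 \<le> J \<longrightarrow> 0 < ?p) \<and> (J < 0 \<longrightarrow> ?p \<le> 0)"
      using Suc.IH[OF tower_Suc[OF Suc.prems(1)]] Suc.prems(2,3) by simp
    show ?case
    proof (intro conjI impI)
      assume "J < 0"
      thus "sol_start s (Suc k) J \<le> 0" using IH s_le[of ?p 0] Suc.prems(2)[of 0] by simp
    next
      assume "0 \<le> J"
      hence "0 \<le> ?p - 1" using IH by simp
      hence "0 \<le> s 0 (?p - 1)" using s_le[of 0 "?p - 1"] Suc.prems(2)[of 0] by simp
      moreover have "?p \<notin> slots (c (Suc 0))"
        using sol_bounds[OF tower_Suc[OF Suc.prems(1)] order_refl] Suc.prems(3) by fastforce
      hence "\<omega> ?p \<noteq> \<omega> (?p - 1)" using tower_omega[OF Suc.prems(1), of 0] by (simp add: slots_def)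
      ultimately show "0 < sol_start s (Suc k) J" using head_gap[of ?p] by simp
    qed
  qed
  thus "0 \<le> J \<Longrightarrow> 0 < sol_start s k J" "J < 0 \<Longrightarrow> sol_start s k J \<le> 0" by auto
qed

text \<open>The tagged soliton number \<open>i\<close> is the first one in the \<open>i\<close>-th occupied slot \<open>Jn i\<close>, and stays there
  for ever.\<close>

theorem X_pos_tower:
  assumes t: "tower c s" and sl: "sloped (c 0)" and r0: "is_record (c 0) 0" and s0: "\<And>l. s l 0 = 0"
    and Jn: "enumerates Jn {J. 0 < gap_pairs (s k) J}" "Jn 0 < 0" "0 \<le> Jn 1"
  shows "X_pos (Suc k) i (c 0) n = sol_start (move c s n) k (Jn i) - 1"
proof -
  note rec = sloped_recurrent[OF sl]
  have Jmono: "strict_mono Jn" and Jran: "range Jn = {J. 0 < gap_pairs (s k) J}"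
    using Jn by (auto simp: enumerates_def)
  have Jpos: "0 < gap_pairs (s k) (Jn i)" for i using Jran by auto
  define g where "g i = sol c s k (Jn i) 0" for i
  note L = lead_solitons_tower[OF t, of k]
  have lp: "lpos (g i) = sol_start s k (Jn i) - 1" for i
    using sol_bounds[OF t order_refl Jpos] by (simp add: g_def lpos_def)
  have ran: "range g = lead_solitons (Suc k) (c 0)"
  proof -
    have "range g = (\<lambda>J. sol c s k J 0) ` range Jn" by (auto simp: g_def)
    thus ?thesis unfolding L Jran by auto
  qed
  have lm: "strict_mono (\<lambda>i. lpos (g i))"
    unfolding lp by (rule strict_monoI) (use sol_start_mono(1)[OF t] Jmono in \<open>auto simp: strict_mono_def\<close>)
  have si0: "s_inf (c 0) 0 = 0" using s_inf(2)[OF rec] last_record_record[OF rec r0] by simp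
  have neg: "lpos (g 0) < 0" using sol_start_sign(2)[OF t s0 Jpos Jn(2)] lp[of 0] by simp
  have top: "lpos \<gamma> \<le> lpos (g 0)" if "\<gamma> \<in> lead_solitons (Suc k) (c 0)" "lpos \<gamma> < 0" for \<gamma>
  proof -
    have "\<gamma> \<in> range g" using that(1) unfolding ran .
    then obtain i where i: "\<gamma> = g i" by (rule rangeE)
    have "\<not> 0 \<le> Jn i" using sol_start_sign(1)[OF t s0 Jpos, of i] lp[of i] that(2) i by auto
    hence "Jn i < 0" by simp
    hence "Jn i < Jn 1" using Jn(3) by simp
    hence "i \<le> 0" using Jmono by (simp add: strict_mono_less)
    hence "lpos (g i) \<le> lpos (g 0)" using strict_mono_less_eq[OF lm, of i 0] by blast
    thus ?thesis unfolding i .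
  qed
  have "lead (Suc k) (c 0) = g" unfolding lead_def si0
  proof (rule the_equality)
    show "range g = lead_solitons (Suc k) (c 0) \<and> strict_mono (\<lambda>i. lpos (g i)) \<and> lpos (g 0) < 0 \<and>
        (\<forall>\<gamma>\<in>lead_solitons (Suc k) (c 0). lpos \<gamma> < 0 \<longrightarrow> lpos \<gamma> \<le> lpos (g 0))"
      using ran lm neg top by simp
  next
    fix h :: "int \<Rightarrow> int set"
    assume h: "range h = lead_solitons (Suc k) (c 0) \<and> strict_mono (\<lambda>i. lpos (h i)) \<and> lpos (h 0) < 0 \<and>
        (\<forall>\<gamma>\<in>lead_solitons (Suc k) (c 0). lpos \<gamma> < 0 \<longrightarrow> lpos \<gamma> \<le> lpos (h 0))"
    have h0: "lpos (h 0) = lpos (g 0)"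
    proof (rule antisym)
      have "h 0 \<in> lead_solitons (Suc k) (c 0)" "g 0 \<in> lead_solitons (Suc k) (c 0)"
        using h ran rangeI[of h 0] rangeI[of g 0] by simp_all
      thus "lpos (h 0) \<le> lpos (g 0)" "lpos (g 0) \<le> lpos (h 0)" using top[of "h 0"] neg h by simp_all
    qed
    have "range (\<lambda>i. lpos (h i)) = lpos ` range h" "range (\<lambda>i. lpos (g i)) = lpos ` range g" by auto
    hence "(\<lambda>i. lpos (h i)) = (\<lambda>i. lpos (g i))"
      using h lm ran h0 by (intro enumerates_unique[of _ "lpos ` lead_solitons (Suc k) (c 0)"])
        (auto simp: enumerates_def)
    hence eq: "lpos (h i) = lpos (g i)" for i by meson
    show "h = g"
    proof
      fix i
      have "h i \<in> range g" using h rangeI[of h i] unfolding ran by simp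
      then obtain j where j: "h i = g j" by (rule rangeE)
      hence "lpos (g j) = lpos (g i)" using eq[of i] by simp
      hence "j = i" using strict_mono_eq[OF lm, of j i] by blast
      thus "h i = g i" using j by simp
    qed
  qed
  hence "X_pos (Suc k) i (c 0) n = lpos (sol (\<lambda>l. (bbs ^^ n) (c l)) (move c s n) k (Jn i) 0)"
    using soliton_at_tower[OF t sl order_refl Jpos] by (simp add: X_pos_def g_def)
  also have "\<dots> = sol_start (move c s n) k (Jn i) - 1"
    using sol_bounds[OF tower_move(1)[OF t sl, of n] order_refl, of k "Jn i"] Jpos[of i] tower_move(3)[OF t sl]
    by (simp add: lpos_def)
  finally show ?thesis .
qed

section \<open>Seat numbers\<close>

lemma record_induct [consumes 1, case_names at_record step]:
  assumes "recurrent \<eta>" "\<And>x. is_record \<eta> x \<Longrightarrow> Q x" "\<And>x. \<not> is_record \<eta> x \<Longrightarrow> Q (x - 1) \<Longrightarrow> Q x"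
  shows "Q x"
proof -
  have "last_record \<eta> x \<le> x" using last_record(2)[OF assms(1)] .
  thus ?thesis
  proof (induction x rule: int_ge_induct)
    case base
    show ?case using assms(2) last_record(1)[OF assms(1)] by blast
  next
    case (step x)
    thus ?case using assms(2,3)[of "x + 1"] by (cases "is_record \<eta> (x + 1)") auto
  qed
qed

lemma carrier_at_record: "recurrent \<eta> \<Longrightarrow> is_record \<eta> x \<Longrightarrow> carrier_at \<eta> x = {}"
  using last_record_record[of \<eta> x] by (simp add: carrier_at_def last_record_def)

lemma carrier_at_step:
  assumes "recurrent \<eta>" "\<not> is_record \<eta> x"
  shows "carrier_at \<eta> x = seat_step (\<eta> x) (carrier_at \<eta> (x - 1))"
proof -
  let ?r = "last_record \<eta> x"
  have "?r \<noteq> x" using last_record(1)[OF assms(1), of x] assms(2) by metis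
  hence "?r + 1 \<le> x" using last_record(2)[OF assms(1), of x] by simp
  hence "[?r + 1..x] = [?r + 1..x - 1] @ [x]" by (rule upto_rec2)
  moreover have "carrier_at \<eta> x = fold (\<lambda>y. seat_step (\<eta> y)) [?r + 1..x] {}"
    by (simp add: carrier_at_def last_record_def)
  moreover have "carrier_at \<eta> (x - 1) = fold (\<lambda>y. seat_step (\<eta> y)) [?r + 1..x - 1] {}"
    unfolding last_record_step[OF assms] by (simp add: carrier_at_def last_record_def)
  ultimately show ?thesis by simp
qed

lemma free_seat:
  assumes "finite C"
  shows "1 \<le> (LEAST l::nat. 1 \<le> l \<and> l \<notin> C)" "(LEAST l. 1 \<le> l \<and> l \<notin> C) \<notin> C"
proof -
  obtain m where "m \<notin> C \<union> {0}" using ex_new_if_finite[of "C \<union> {0}"] assms by auto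
  hence "1 \<le> m \<and> m \<notin> C" by auto
  from LeastI[of "\<lambda>l. 1 \<le> l \<and> l \<notin> C", OF this]
  show "1 \<le> (LEAST l::nat. 1 \<le> l \<and> l \<notin> C)" "(LEAST l. 1 \<le> l \<and> l \<notin> C) \<notin> C" by auto
qed

text \<open>The number of occupied seats is the height of the walk above its running minimum.\<close>

lemma carrier_basic:
  assumes "recurrent \<eta>"
  shows "finite (carrier_at \<eta> x) \<and> 0 \<notin> carrier_at \<eta> x \<and>
    int (card (carrier_at \<eta> x)) = walk \<eta> x - walk \<eta> (last_record \<eta> x)"
  using assms
proof (induction x rule: record_induct)
  case (at_record x)
  thus ?case using carrier_at_record[OF assms] last_record_record[OF assms] by simp
next
  case (step x)
  let ?C = "carrier_at \<eta> (x - 1)"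
  have l: "last_record \<eta> x = last_record \<eta> (x - 1)" using last_record_step[OF assms step(1)] .
  show ?case
  proof (cases "\<eta> x")
    case True
    let ?m = "LEAST l. 1 \<le> l \<and> l \<notin> ?C"
    have "?m \<notin> ?C" "1 \<le> ?m" using free_seat step by auto
    moreover have "carrier_at \<eta> x = insert ?m ?C" using carrier_at_step[OF assms step(1)] True by (simp add: seat_step_def)
    ultimately show ?thesis using step(2) walk_step[of \<eta> x] True l by auto
  next
    case False
    have ne: "?C \<noteq> {}"
    proof
      assume "?C = {}"
      hence "walk \<eta> x < walk \<eta> (last_record \<eta> x)" using step(2) walk_step[of \<eta> x] False l by simp
      thus False using walk_last_record_le[OF assms order_refl, of x] by simp
    qed
    let ?m = "LEAST l. l \<in> ?C"
    have m: "?m \<in> ?C" using ne LeastI_ex[of "\<lambda>l. l \<in> ?C"] by blast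
    have "carrier_at \<eta> x = ?C - {?m}" using carrier_at_step[OF assms step(1)] False ne by (simp add: seat_step_def)
    moreover have "int (card (?C - {?m})) = int (card ?C) - 1"
      using m step(2) card_gt_0_iff[of ?C] ne by (subst card_Diff_singleton) (auto simp: of_nat_diff)
    ultimately show ?thesis using step(2) walk_step[of \<eta> x] False l by auto
  qed
qed

lemma carrier_empty_before_record:
  assumes "recurrent \<eta>" "is_record \<eta> x"
  shows "carrier_at \<eta> (x - 1) = {}"
  using carrier_basic[OF assms(1), of "x - 1"] record_walk_step[OF assms] by auto

lemma carrier_nonempty:
  assumes "recurrent \<eta>" "\<not> is_record \<eta> x" "\<not> \<eta> x"
  shows "carrier_at \<eta> (x - 1) \<noteq> {}"
proof
  assume "carrier_at \<eta> (x - 1) = {}"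
  hence "walk \<eta> x < walk \<eta> (last_record \<eta> x)"
    using carrier_basic[OF assms(1), of "x - 1"] walk_step[of \<eta> x] assms(3) last_record_step[OF assms(1,2)] by simp
  thus False using walk_last_record_le[OF assms(1) order_refl, of x] by simp
qed

definition slot_increment :: "nat \<Rightarrow> config \<Rightarrow> int \<Rightarrow> int" where
  "slot_increment k \<eta> x =
     of_bool (is_record \<eta> x) + (\<Sum>l. seat_up (k + Suc l) \<eta> x + seat_down (k + Suc l) \<eta> x)"

lemma suminf_indicator: "(\<Sum>l. of_bool (l = m) :: int) = 1"
  using suminf_finite[of "{m}" "\<lambda>l. of_bool (l = m) :: int"] by simp

text \<open>Every site is a record or changes exactly one seat.\<close>

lemma slot_increment_0:
  assumes "recurrent \<eta>"
  shows "slot_increment 0 \<eta> x = 1"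
proof (cases "is_record \<eta> x")
  case True
  thus ?thesis
    using carrier_at_record[OF assms True] carrier_empty_before_record[OF assms True]
    by (simp add: slot_increment_def seat_up_def seat_down_def)
next
  case False
  let ?C = "carrier_at \<eta> (x - 1)"
  have fC: "finite ?C" "0 \<notin> ?C" using carrier_basic[OF assms] by auto
  note st = carrier_at_step[OF assms False]
  have "\<exists>m. (\<lambda>l. seat_up (0 + Suc l) \<eta> x + seat_down (0 + Suc l) \<eta> x) = (\<lambda>l. of_bool (l = m))"
  proof (cases "\<eta> x")
    case True
    define m where "m = (LEAST l. 1 \<le> l \<and> l \<notin> ?C)"
    have m: "m \<notin> ?C" "1 \<le> m" using free_seat[OF fC(1)] by (auto simp: m_def)
    have "carrier_at \<eta> x = insert m ?C" using st True by (simp add: seat_step_def m_def)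
    thus ?thesis using m by (intro exI[of _ "m - 1"]) (auto simp: seat_up_def seat_down_def fun_eq_iff)
  next
    case F: False
    have ne: "?C \<noteq> {}" using carrier_nonempty[OF assms False F] .
    define m where "m = (LEAST l. l \<in> ?C)"
    have m: "m \<in> ?C" using ne LeastI_ex[of "\<lambda>l. l \<in> ?C"] by (auto simp: m_def)
    hence "m \<noteq> 0" using fC by metis
    moreover have "carrier_at \<eta> x = ?C - {m}" using st F ne by (simp add: seat_step_def m_def)
    ultimately show ?thesis using m by (intro exI[of _ "m - 1"]) (auto simp: seat_up_def seat_down_def fun_eq_iff)
  qed
  thus ?thesis using False suminf_indicator by (auto simp: slot_increment_def)
qed

lemma Least_Suc_image:
  fixes D :: "nat set"
  assumes "D \<noteq> {}"
  shows "(LEAST l. l \<in> Suc ` D) = Suc (LEAST l. l \<in> D)"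
proof (rule Least_equality)
  show "Suc (LEAST l. l \<in> D) \<in> Suc ` D" using assms LeastI_ex[of "\<lambda>l. l \<in> D"] by blast
  fix y assume "y \<in> Suc ` D"
  thus "Suc (LEAST l. l \<in> D) \<le> y" using Least_le[of "\<lambda>l. l \<in> D"] by auto
qed

lemma Least_free_Suc:
  fixes D :: "nat set"
  assumes "finite D"
  shows "(LEAST l. 1 \<le> l \<and> l \<notin> insert 1 (Suc ` D)) = Suc (LEAST l. 1 \<le> l \<and> l \<notin> D)"
proof (rule Least_equality)
  show "1 \<le> Suc (LEAST l. 1 \<le> l \<and> l \<notin> D) \<and> Suc (LEAST l. 1 \<le> l \<and> l \<notin> D) \<notin> insert 1 (Suc ` D)"
    using free_seat[OF assms] by auto
  fix y assume y: "1 \<le> y \<and> y \<notin> insert 1 (Suc ` D)"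
  then obtain z where z: "y = Suc z" "1 \<le> z" by (cases y) auto
  hence "1 \<le> z \<and> z \<notin> D" using y by auto
  thus "Suc (LEAST l. 1 \<le> l \<and> l \<notin> D) \<le> y" using z Least_le[of "\<lambda>l. 1 \<le> l \<and> l \<notin> D"] by auto
qed

context slot_map begin

text \<open>Seat \<open>1\<close> is occupied after \<open>x\<close> exactly when \<open>x\<close> carries a ball, and the other seats are those of
  the contraction: the seat chosen at a slot is the one after the seat chosen in the contraction.\<close>

lemma carrier_contract:
  "carrier_at \<eta> x = (if \<eta> x then {1} else {}) \<union> Suc ` carrier_at \<omega> (idx s x)"
  using recurrent
proof (induction x rule: record_induct)
  case (at_record x)
  thus ?case
    using carrier_at_record[OF recurrent at_record] carrier_at_record[OF recurrent_\<omega> record_idx[OF at_record]]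
      recordD(1)[OF at_record] by simp
next
  case (step x)
  let ?D = "carrier_at \<omega> (idx s (x - 1))"
  have D: "finite ?D" "0 \<notin> ?D" using carrier_basic[OF recurrent_\<omega>] by auto
  note st = carrier_at_step[OF recurrent step(1)]
  show ?case
  proof (cases "\<eta> x = \<eta> (x - 1)")
    case False
    have i: "idx s x = idx s (x - 1)" using idx_step[of x] False by simp
    show ?thesis
    proof (cases "\<eta> x")
      case True
      hence C: "carrier_at \<eta> (x - 1) = Suc ` ?D" using step(2) False by simp
      have "(LEAST l::nat. 1 \<le> l \<and> l \<notin> Suc ` ?D) = 1" using D by (intro Least_equality) auto
      thus ?thesis using st True C i by (simp add: seat_step_def)
    next
      case F: False
      hence C: "carrier_at \<eta> (x - 1) = insert 1 (Suc ` ?D)" using step(2) False by simp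
      have "(LEAST l::nat. l \<in> insert 1 (Suc ` ?D)) = 1" using D by (intro Least_equality) auto
      moreover have "1 \<notin> Suc ` ?D" using D by auto
      ultimately show ?thesis using st F C i by (simp add: seat_step_def)
    qed
  next
    case True
    have i: "idx s x = idx s (x - 1) + 1" using idx_step[of x] True by simp
    have sx: "s (idx s x) = x" using idx_slot[of x] True by (simp add: slots_def)
    hence w: "\<omega> (idx s x) = \<eta> x" by (simp add: \<omega>_def)
    have "\<not> is_record \<omega> (idx s x)" using step(1) record_iff[of "idx s x"] sx by simp
    from carrier_at_step[OF recurrent_\<omega> this] have D': "carrier_at \<omega> (idx s x) = seat_step (\<eta> x) ?D" using i w by simp
    show ?thesis
    proof (cases "\<eta> x")
      case T: True
      hence C: "carrier_at \<eta> (x - 1) = insert 1 (Suc ` ?D)" using step(2) True by simp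
      define m where "m = (LEAST l. 1 \<le> l \<and> l \<notin> ?D)"
      have "carrier_at \<eta> x = insert (Suc m) (insert 1 (Suc ` ?D))"
        using st T unfolding C by (simp only: seat_step_def if_True Least_free_Suc[OF D(1)] m_def)
      moreover have "carrier_at \<omega> (idx s x) = insert m ?D"
        using D' T by (simp only: seat_step_def if_True m_def)
      ultimately show ?thesis using T by auto
    next
      case F: False
      hence C: "carrier_at \<eta> (x - 1) = Suc ` ?D" using step(2) True by simp
      show ?thesis
      proof (cases "?D = {}")
        case True
        thus ?thesis using st F D' unfolding C by (simp add: seat_step_def)
      next
        case ne: False
        have "Suc ` (?D - {LEAST l. l \<in> ?D}) = Suc ` ?D - {Suc (LEAST l. l \<in> ?D)}" by auto
        thus ?thesis using st F D' ne unfolding C by (simp add: seat_step_def Least_Suc_image[OF ne])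
      qed
    qed
  qed
qed

lemma seat_one: "seat_up (Suc 0) \<eta> x = of_bool (\<eta> x \<and> \<not> \<eta> (x - 1))"
proof -
  have "Suc 0 \<in> carrier_at \<eta> y \<longleftrightarrow> \<eta> y" for y
    using carrier_contract[of y] carrier_basic[OF recurrent_\<omega>, of "idx s y"] by auto
  thus ?thesis by (auto simp: seat_up_def)
qed

lemma seat_Suc:
  assumes "1 \<le> m"
  shows "seat_up (Suc m) \<eta> x = (if x \<in> slots \<eta> then seat_up m \<omega> (idx s x) else 0)"
    "seat_down (Suc m) \<eta> x = (if x \<in> slots \<eta> then seat_down m \<omega> (idx s x) else 0)"
proof -
  have m: "Suc m \<in> carrier_at \<eta> y \<longleftrightarrow> m \<in> carrier_at \<omega> (idx s y)" for y
    using carrier_contract[of y] assms by auto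
  have i: "idx s (x - 1) = (if x \<in> slots \<eta> then idx s x - 1 else idx s x)"
    using idx_step[of x] by (simp add: slots_def)
  show "seat_up (Suc m) \<eta> x = (if x \<in> slots \<eta> then seat_up m \<omega> (idx s x) else 0)"
    "seat_down (Suc m) \<eta> x = (if x \<in> slots \<eta> then seat_down m \<omega> (idx s x) else 0)"
    unfolding seat_up_def seat_down_def m i by auto
qed

lemma slot_increment_Suc:
  "slot_increment (Suc k) \<eta> x = (if x \<in> slots \<eta> then slot_increment k \<omega> (idx s x) else 0)"
proof (cases "x \<in> slots \<eta>")
  case True
  have "is_record \<eta> x = is_record \<omega> (idx s x)" using record_iff[of "idx s x"] idx_slot[OF True] by simp
  thus ?thesis using True seat_Suc by (simp add: slot_increment_def)
next
  case False
  have "\<not> is_record \<eta> x" using False record_slot by blast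
  thus ?thesis using False seat_Suc by (simp add: slot_increment_def)
qed

lemma sum_slots:
  fixes f :: "int \<Rightarrow> int"
  assumes "\<And>y. y \<notin> slots \<eta> \<Longrightarrow> f y = 0"
  shows "(\<Sum>y=s a + 1..s b. f y) = (\<Sum>i=a + 1..b. f (s i))"
proof -
  have "(\<Sum>y=s a + 1..s b. f y) = sum f (s ` {a + 1..b})"
  proof (rule sum.mono_neutral_right)
    show "s ` {a + 1..b} \<subseteq> {s a + 1..s b}"
    proof
      fix y assume "y \<in> s ` {a + 1..b}"
      then obtain i where "y = s i" "a < i" "i \<le> b" by auto
      thus "y \<in> {s a + 1..s b}" using s_less[of a i] s_le[of i b] by auto
    qed
    show "\<forall>y\<in>{s a + 1..s b} - s ` {a + 1..b}. f y = 0"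
    proof
      fix y assume y: "y \<in> {s a + 1..s b} - s ` {a + 1..b}"
      have "y \<notin> slots \<eta>"
      proof
        assume "y \<in> slots \<eta>"
        then obtain i where "y = s i" using range_s by auto
        thus False using y s_less[of a i] s_le[of i b] by auto
      qed
      thus "f y = 0" using assms by blast
    qed
  qed simp
  also have "\<dots> = (\<Sum>i=a + 1..b. f (s i))"
    using strict_mono_imp_inj_on[OF mono] by (subst sum.reindex) (auto simp: inj_on_def)
  finally show ?thesis .
qed

lemma ups_in_gap:
  "int n \<le> s (i + 1) - s i - 1 \<Longrightarrow>
     (\<Sum>y=s i + 1..s i + int n. seat_up (Suc 0) \<eta> y) = (int n + of_bool (\<not> \<omega> i)) div 2"
proof (induction n)
  case (Suc n)
  let ?y = "s i + int (Suc n)"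
  have "{s i + 1..?y} = insert ?y {s i + 1..s i + int n}" by auto
  hence "(\<Sum>y=s i + 1..?y. seat_up (Suc 0) \<eta> y) = seat_up (Suc 0) \<eta> ?y + (int n + of_bool (\<not> \<omega> i)) div 2"
    using Suc by simp
  moreover have "\<eta> ?y \<longleftrightarrow> (\<omega> i \<longleftrightarrow> even (int (Suc n)))"
    using alternating[of i ?y] Suc.prems by simp
  moreover have "\<eta> (?y - 1) \<longleftrightarrow> (\<omega> i \<longleftrightarrow> even (int n))"
    using alternating[of i "?y - 1"] Suc.prems by simp
  moreover have "?y - 1 = s i + int n" by simp
  ultimately show ?case unfolding seat_one by (cases "\<omega> i"; cases "even n") (auto elim!: evenE oddE)
qed (simp add: of_bool_def)

text \<open>The base case of \<open>zeta_tower\<close>.  The balls on seat \<open>1\<close> inside a gap are half of its sites, rounded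
  up if the gap begins empty; the surplus is the ball on seat \<open>2\<close> at the end of the gap.\<close>

lemma ups_difference: "(\<Sum>y=s i + 1..s (i + 1). seat_up (Suc 0) \<eta> y - seat_up (Suc (Suc 0)) \<eta> y) = gap_pairs s i"
proof -
  have lt: "s i < s (i + 1)" by (simp add: s_less)
  define n where "n = nat (s (i + 1) - s i - 1)"
  have n: "int n = s (i + 1) - s i - 1" using lt by (simp add: n_def)
  have "{s i + 1..s (i + 1)} = insert (s (i + 1)) {s i + 1..s i + int n}" using n lt by auto
  hence "(\<Sum>y=s i + 1..s (i + 1). seat_up (Suc 0) \<eta> y) = seat_up (Suc 0) \<eta> (s (i + 1)) + (int n + of_bool (\<not> \<omega> i)) div 2"
    using ups_in_gap[of n i] n by simp
  moreover have "seat_up (Suc 0) \<eta> (s (i + 1)) = 0" using s_slot[of "i + 1"] by (simp add: seat_one)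
  moreover have "(\<Sum>y=s i + 1..s (i + 1). seat_up (Suc (Suc 0)) \<eta> y) = of_bool (\<omega> (i + 1) \<and> \<not> \<omega> i)"
  proof -
    obtain t where t: "slot_map \<omega> t" using slot_map_exists[OF recurrent_\<omega>] recurrent_\<omega> slot_map.intro by blast
    have "(\<Sum>y=s i + 1..s (i + 1). seat_up (Suc (Suc 0)) \<eta> y) = (\<Sum>j=i + 1..i + 1. seat_up (Suc (Suc 0)) \<eta> (s j))"
      by (rule sum_slots) (simp add: seat_Suc)
    also have "\<dots> = seat_up (Suc 0) \<omega> (i + 1)" using range_s mono by (auto simp: seat_Suc)
    finally show ?thesis using slot_map.seat_one[OF t, of "i + 1"] by simp
  qed
  moreover have "int n = 2 * gap_pairs s i + of_bool (\<omega> (i + 1) \<noteq> \<omega> i)" using n gap[of i] by simp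
  ultimately show ?thesis by (cases "\<omega> i"; cases "\<omega> (i + 1)") (auto simp: sum_subtractf)
qed

end

text \<open>The value of \<^const>\<open>xi\<close>: iterated indices of slots (\<open>xi_tower\<close>).\<close>

primrec slot_index :: "(nat \<Rightarrow> int \<Rightarrow> int) \<Rightarrow> nat \<Rightarrow> int \<Rightarrow> int" where
  "slot_index s 0 x = x"
| "slot_index s (Suc k) x = slot_index (\<lambda>l. s (Suc l)) k (idx (s 0) x)"

lemma slot_index_step:
  assumes "tower c s"
  shows "slot_index s k x - slot_index s k (x - 1) = slot_increment k (c 0) x"
  using assms
proof (induction k arbitrary: c s x)
  case 0
  show ?case using slot_increment_0[OF slot_map.recurrent[OF tower_slot_map[OF 0]]] by simp
next
  case (Suc k)
  interpret slot_map "c 0" "s 0" using tower_slot_map[OF Suc.prems] .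
  have w: "\<omega> = c (Suc 0)" using tower_omega[OF Suc.prems, of 0] .
  have i: "idx (s 0) (x - 1) = (if x \<in> slots (c 0) then idx (s 0) x - 1 else idx (s 0) x)"
    using idx_step[of x] by (simp add: slots_def)
  show ?case using Suc.IH[OF tower_Suc[OF Suc.prems], of "idx (s 0) x"] i slot_increment_Suc[of k x] by (simp add: w)
qed

lemma xi_tower:
  assumes t: "tower c s" and r0: "is_record (c 0) 0" and s0: "\<And>l. s l 0 = 0"
  shows "xi k (c 0) = slot_index s k"
proof -
  have rec: "recurrent (c 0)" using slot_map.recurrent[OF tower_slot_map[OF t]] .
  have si0: "s_inf (c 0) 0 = 0" using s_inf(2)[OF rec] last_record_record[OF rec r0] by simp
  have z: "slot_index s k 0 = 0"
    using t s0
  proof (induction k arbitrary: c s)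
    case (Suc k)
    interpret slot_map "c 0" "s 0" using tower_slot_map[OF Suc.prems(1)] .
    have "idx (s 0) 0 = 0" using idx_apply[OF mono, of 0] Suc.prems(2)[of 0] by simp
    thus ?case using Suc.IH[OF tower_Suc[OF Suc.prems(1)]] Suc.prems(2) by simp
  qed simp
  show ?thesis unfolding xi_def si0 slot_increment_def[symmetric]
  proof (rule the_equality)
    show "slot_index s k 0 = 0 \<and> (\<forall>x. slot_index s k x - slot_index s k (x - 1) = slot_increment k (c 0) x)"
      using z slot_index_step[OF t] by blast
  next
    fix f assume f: "f 0 = 0 \<and> (\<forall>x. f x - f (x - 1) = slot_increment k (c 0) x)"
    have "f x = slot_index s k x" for x
    proof (induction x rule: int_induct[of _ 0])
      case base thus ?case using f z by simp
    next
      case (step1 i)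
      have "f (i + 1) - f (i + 1 - 1) = slot_increment k (c 0) (i + 1)" using f by blast
      thus ?case using slot_index_step[OF t, of k "i + 1"] step1 by simp
    next
      case (step2 i)
      have "f i - f (i - 1) = slot_increment k (c 0) i" using f by blast
      thus ?case using slot_index_step[OF t, of k i] step2 by simp
    qed
    thus "f = slot_index s k" by auto
  qed
qed

lemma slot_index_galois:
  assumes "tower c s"
  shows "i \<le> slot_index s (Suc k) x \<longleftrightarrow> slot_site s k i \<le> x" "slot_index s (Suc k) (slot_site s k i) = i"
proof -
  have "(i \<le> slot_index s (Suc k) x \<longleftrightarrow> slot_site s k i \<le> x) \<and> slot_index s (Suc k) (slot_site s k i) = i"
    using assms
  proof (induction k arbitrary: c s x)
    case 0
    interpret slot_map "c 0" "s 0" using tower_slot_map[OF 0] .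
    show ?case using le_idx_iff[OF mono] mono by simp
  next
    case (Suc k)
    interpret slot_map "c 0" "s 0" using tower_slot_map[OF Suc.prems] .
    show ?case using Suc.IH[OF tower_Suc[OF Suc.prems]] le_idx_iff[OF mono] mono by simp
  qed
  thus "i \<le> slot_index s (Suc k) x \<longleftrightarrow> slot_site s k i \<le> x" "slot_index s (Suc k) (slot_site s k i) = i" by auto
qed

text \<open>The counts defined by seat numbers are the numbers of pairs in the gaps at all levels: one
  deletion lowers all seats by one.\<close>

theorem zeta_tower:
  assumes t: "tower c s" and r0: "is_record (c 0) 0" and s0: "\<And>l. s l 0 = 0"
  shows "zeta (Suc k) (c 0) i = gap_pairs (s k) i"
proof -
  have seat: "s_seat (Suc k) (c 0) i = slot_site s k i" for i
    unfolding s_seat_def xi_tower[OF assms]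
    using slot_index_galois[OF t] by (intro Least_equality) (simp_all del: slot_index.simps slot_site.simps, metis order_refl)
  have "(\<Sum>y = slot_site s k i + 1..slot_site s k (i + 1). seat_up (Suc k) (c 0) y - seat_up (Suc (Suc k)) (c 0) y)
      = gap_pairs (s k) i"
    using t
  proof (induction k arbitrary: c s)
    case 0
    interpret slot_map "c 0" "s 0" using tower_slot_map[OF 0] .
    show ?case using ups_difference by simp
  next
    case (Suc k)
    interpret slot_map "c 0" "s 0" using tower_slot_map[OF Suc.prems] .
    have w: "\<omega> = c (Suc 0)" using tower_omega[OF Suc.prems, of 0] .
    let ?a = "slot_site (\<lambda>l. s (Suc l)) k"
    have "(\<Sum>y = s 0 (?a i) + 1..s 0 (?a (i + 1)). seat_up (Suc (Suc k)) (c 0) y - seat_up (Suc (Suc (Suc k))) (c 0) y)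
       = (\<Sum>j = ?a i + 1..?a (i + 1). seat_up (Suc (Suc k)) (c 0) (s 0 j) - seat_up (Suc (Suc (Suc k))) (c 0) (s 0 j))"
      by (rule sum_slots) (simp add: seat_Suc)
    also have "\<dots> = (\<Sum>j = ?a i + 1..?a (i + 1). seat_up (Suc k) \<omega> j - seat_up (Suc (Suc k)) \<omega> j)"
      using range_s mono by (intro sum.cong) (auto simp: seat_Suc)
    also have "\<dots> = gap_pairs (s (Suc k)) i" using Suc.IH[OF tower_Suc[OF Suc.prems]] by (simp add: w)
    finally show ?case by simp
  qed
  thus ?thesis by (simp add: zeta_def seat)
qed

section \<open>Two solutions of the window recursion\<close>

lemma backward_recursion:
  fixes a :: "nat \<Rightarrow> real"
  assumes "\<And>l. 0 \<le> a l" "d \<le> Suc k"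
  shows "\<exists>K\<ge>0. \<forall>\<Delta> \<sigma> e. 0 \<le> \<sigma> \<longrightarrow> 0 \<le> e \<longrightarrow> \<Delta> (Suc k) = (0::real) \<longrightarrow> \<Delta> (Suc (Suc k)) \<le> \<sigma> \<longrightarrow>
    (\<forall>l\<le>k. \<Delta> l \<le> (2 + 2 * a l) * \<Delta> (Suc l) + \<Delta> (Suc (Suc l)) + 2 * e) \<longrightarrow>
    \<Delta> (Suc k - d) \<le> K * (\<sigma> + e) \<and> \<Delta> (Suc (Suc k - d)) \<le> K * (\<sigma> + e)"
  using assms(2)
proof (induction d)
  case 0
  show ?case by (intro exI[of _ 1]) auto
next
  case (Suc d)
  then obtain K where K: "K \<ge> 0" "\<And>\<Delta> \<sigma> e. 0 \<le> \<sigma> \<Longrightarrow> 0 \<le> e \<Longrightarrow> \<Delta> (Suc k) = (0::real) \<Longrightarrow> \<Delta> (Suc (Suc k)) \<le> \<sigma> \<Longrightarrow>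
    (\<forall>l\<le>k. \<Delta> l \<le> (2 + 2 * a l) * \<Delta> (Suc l) + \<Delta> (Suc (Suc l)) + 2 * e) \<Longrightarrow>
    \<Delta> (Suc k - d) \<le> K * (\<sigma> + e) \<and> \<Delta> (Suc (Suc k - d)) \<le> K * (\<sigma> + e)"
    by (metis Suc_leD)
  let ?l = "k - d"
  have l: "Suc k - d = Suc ?l" "Suc k - Suc d = ?l" using Suc.prems by auto
  define K' where "K' = (2 + 2 * a ?l) * K + K + 2"
  have a: "0 \<le> a ?l * K" using assms(1) K(1) by simp
  have K': "K \<le> K'" "0 \<le> K'" using a K(1) by (auto simp: K'_def algebra_simps)
  show ?case unfolding l
  proof (intro exI[of _ K'] conjI allI impI K'(2))
    fix \<Delta> :: "nat \<Rightarrow> real" and \<sigma> e :: real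
    assume H: "0 \<le> \<sigma>" "0 \<le> e" "\<Delta> (Suc k) = 0" "\<Delta> (Suc (Suc k)) \<le> \<sigma>"
      "\<forall>l\<le>k. \<Delta> l \<le> (2 + 2 * a l) * \<Delta> (Suc l) + \<Delta> (Suc (Suc l)) + 2 * e"
    note B = K(2)[of \<sigma> e \<Delta>, OF H, unfolded l]
    have se: "0 \<le> \<sigma> + e" using H by simp
    have "\<Delta> ?l \<le> (2 + 2 * a ?l) * \<Delta> (Suc ?l) + \<Delta> (Suc (Suc ?l)) + 2 * e" using H(5) by simp
    also have "\<dots> \<le> (2 + 2 * a ?l) * (K * (\<sigma> + e)) + K * (\<sigma> + e) + 2 * (\<sigma> + e)"
      using B H assms(1)[of ?l] by (intro add_mono mult_left_mono) auto
    finally show "\<Delta> ?l \<le> K' * (\<sigma> + e)" by (simp add: K'_def algebra_simps)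
    show "\<Delta> (Suc ?l) \<le> K' * (\<sigma> + e)" using B mult_right_mono[OF K'(1) se] by simp
  qed
qed

text \<open>Let \<open>om l = V l W (l + 1) - W l V (l + 1)\<close>.  The recursion makes \<open>om\<close> constant up to \<open>2 B e\<close> per
  level.  At the top \<open>om L\<close> is at most \<open>B\<close> times the increment of a solution at \<open>L\<close>, and the
  increments are almost monotone with sum at most \<open>B\<close>, so this increment is about \<open>B / L\<close>.  At level
  \<open>k + 1\<close>, where both solutions equal \<open>D\<close>, one has \<open>om (k + 1) = D (W (k + 2) - V (k + 2))\<close>; and since
  both values lie in \<open>[0, D]\<close>, the square of their difference is at most \<open>\<bar>om (k + 1)\<bar>\<close>.  The bound is
  thus uniform in \<open>D\<close>.\<close>

lemma wronskian_bound:
  fixes W V a :: "nat \<Rightarrow> real"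
  assumes L: "Suc k \<le> L" and e: "0 \<le> e" and a: "\<And>l. 0 \<le> a l"
    and W: "\<And>l. 0 \<le> W l" "\<And>l. W (Suc l) \<le> W l" "W 0 \<le> B"
    and V: "\<And>l. 0 \<le> V l" "\<And>l. V (Suc l) \<le> V l" "V 0 \<le> B"
    and recW: "\<And>l. l < L \<Longrightarrow> \<bar>W l - (2 + 2 * a l) * W (Suc l) + W (Suc (Suc l))\<bar> \<le> e"
    and recV: "\<And>l. l < L \<Longrightarrow> \<bar>V l - (2 + 2 * a l) * V (Suc l) + V (Suc (Suc l))\<bar> \<le> e"
    and eq: "W (Suc k) = V (Suc k)"
  shows "\<bar>W (Suc (Suc k)) - V (Suc (Suc k))\<bar> \<le> sqrt (B\<^sup>2 / L + 3 * B * L * e)"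
proof -
  have L0: "0 < real L" using L by simp
  have le: "U l \<le> B" if "\<And>l. U (Suc l) \<le> U l" "U 0 \<le> B" for U :: "nat \<Rightarrow> real" and l
    using lift_Suc_antimono_le[of U, OF that(1), of 0 l] that(2) by simp
  note WB = le[of W, OF W(2,3)] and VB = le[of V, OF V(2,3)]
  have B: "0 \<le> B" using W(1)[of 0] W(3) by simp
  have tail: "U L - U (Suc L) \<le> B / L + L * e"
    if U: "\<And>l. 0 \<le> U l" "\<And>l. U (Suc l) \<le> U l" "U 0 \<le> B"
      and rec: "\<And>l. l < L \<Longrightarrow> \<bar>U l - (2 + 2 * a l) * U (Suc l) + U (Suc (Suc l))\<bar> \<le> e" for U :: "nat \<Rightarrow> real"
  proof -
    have "U L - U (Suc L) \<le> U (L - d) - U (Suc (L - d)) + d * e" if "d \<le> L" for d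
      using that
    proof (induction d)
      case (Suc d)
      let ?l = "L - Suc d"
      have l: "L - d = Suc ?l" "?l < L" using Suc.prems by auto
      have "0 \<le> a ?l * U (Suc ?l)" using a U(1) by simp
      hence "U (Suc ?l) - U (Suc (Suc ?l)) \<le> U ?l - U (Suc ?l) + e"
        using rec[OF l(2)] by (simp add: abs_le_iff algebra_simps)
      thus ?case using Suc l by (simp add: algebra_simps)
    qed simp
    hence R: "U L - U (Suc L) \<le> U l - U (Suc l) + L * e" if "l < L" for l
    proof -
      have "U L - U (Suc L) \<le> U l - U (Suc l) + real (L - l) * e"
        using \<open>\<And>d. d \<le> L \<Longrightarrow> _\<close>[of "L - l"] that by simp
      also have "real (L - l) * e \<le> real L * e" using e by (intro mult_right_mono) auto
      finally show ?thesis by simp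
    qed
    have "real L * (U L - U (Suc L)) = (\<Sum>l<L. U L - U (Suc L))" by simp
    also have "\<dots> \<le> (\<Sum>l<L. U l - U (Suc l) + L * e)" using R by (intro sum_mono) auto
    also have "\<dots> = U 0 - U L + L * (L * e)" by (simp add: sum.distrib sum_lessThan_telescope')
    also have "\<dots> \<le> B + L * (L * e)" using U(1)[of L] U(3) by simp
    finally show ?thesis using L0 by (simp add: field_simps)
  qed
  define om where "om l = V l * W (Suc l) - W l * V (Suc l)" for l
  have step: "\<bar>om l - om (Suc l)\<bar> \<le> 2 * B * e" if "l < L" for l
  proof -
    define x y where "x = W l - (2 + 2 * a l) * W (Suc l) + W (Suc (Suc l))"
      and "y = V l - (2 + 2 * a l) * V (Suc l) + V (Suc (Suc l))"
    have "om l - om (Suc l) = W (Suc l) * y - V (Suc l) * x"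
      unfolding om_def x_def y_def by (simp add: algebra_simps)
    also have "\<bar>\<dots>\<bar> \<le> W (Suc l) * \<bar>y\<bar> + V (Suc l) * \<bar>x\<bar>"
      using W(1)[of "Suc l"] V(1)[of "Suc l"] by (metis abs_triangle_ineq4 abs_mult abs_of_nonneg)
    also have "\<dots> \<le> B * e + B * e"
      using recW[OF that] recV[OF that] WB VB W(1) V(1) B by (intro add_mono mult_mono) (auto simp: x_def y_def)
    finally show ?thesis by simp
  qed
  have "\<bar>om (L - d)\<bar> \<le> \<bar>om L\<bar> + d * (2 * B * e)" if "d \<le> L" for d
    using that
  proof (induction d)
    case (Suc d)
    have l: "Suc (L - Suc d) = L - d" using Suc.prems by simp
    have "\<bar>om (L - Suc d) - om (L - d)\<bar> \<le> 2 * B * e" using step[of "L - Suc d"] Suc.prems l by simp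
    moreover have "\<bar>om (L - d)\<bar> \<le> \<bar>om L\<bar> + d * (2 * B * e)" using Suc by simp
    moreover have "Suc d * (2 * B * e) = d * (2 * B * e) + 2 * B * e" by (simp add: distrib_right)
    ultimately show ?case by linarith
  qed simp
  from this[of "L - Suc k"] have "\<bar>om (Suc k)\<bar> \<le> \<bar>om L\<bar> + real (L - Suc k) * (2 * B * e)" using L by simp
  also have "real (L - Suc k) * (2 * B * e) \<le> real L * (2 * B * e)" using B e by (intro mult_right_mono) auto
  finally have o1: "\<bar>om (Suc k)\<bar> \<le> \<bar>om L\<bar> + 2 * B * L * e" by (simp add: algebra_simps)
  have o2: "\<bar>om L\<bar> \<le> B * (B / L + L * e)"
  proof -
    have b: "B / L + L * e \<ge> 0" using B L0 e by simp
    have "om L = W (Suc L) * (V L - V (Suc L)) - V (Suc L) * (W L - W (Suc L))" by (simp add: om_def algebra_simps)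
    moreover have "0 \<le> W (Suc L) * (V L - V (Suc L))" "W (Suc L) * (V L - V (Suc L)) \<le> B * (B / L + L * e)"
      using W(1) V(2)[of L] WB tail[of V, OF V recV] B b by (auto intro!: mult_mono)
    moreover have "0 \<le> V (Suc L) * (W L - W (Suc L))" "V (Suc L) * (W L - W (Suc L)) \<le> B * (B / L + L * e)"
      using V(1) W(2)[of L] VB tail[of W, OF W recW] B b by (auto intro!: mult_mono)
    ultimately show ?thesis by linarith
  qed
  define D where "D = W (Suc k)"
  let ?w = "W (Suc (Suc k))" and ?v = "V (Suc (Suc k))"
  have om: "om (Suc k) = D * (?w - ?v)" unfolding om_def D_def eq by (simp add: algebra_simps)
  have D: "0 \<le> D" "?w \<le> D" "?v \<le> D" "0 \<le> ?w" "0 \<le> ?v" 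
    using W(1,2)[of "Suc k"] V(1,2)[of "Suc k"] W(1)[of "Suc (Suc k)"] V(1)[of "Suc (Suc k)"] eq
    by (auto simp: D_def)
  have "(?w - ?v)\<^sup>2 = \<bar>?w - ?v\<bar> * \<bar>?w - ?v\<bar>" by (simp add: power2_eq_square)
  also have "\<dots> \<le> D * \<bar>?w - ?v\<bar>" using D by (intro mult_right_mono) auto
  also have "\<dots> = \<bar>om (Suc k)\<bar>" using D by (simp add: om abs_mult)
  also have "\<dots> \<le> B * (B / L + L * e) + 2 * B * L * e" using o1 o2 by simp
  also have "\<dots> = B\<^sup>2 / L + 3 * B * L * e" by (simp add: power2_eq_square algebra_simps)
  finally have "sqrt ((?w - ?v)\<^sup>2) \<le> sqrt (B\<^sup>2 / L + 3 * B * L * e)" by (rule real_sqrt_le_mono)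
  thus ?thesis by simp
qed

text \<open>Consequently two windows that agree at level \<open>k + 1\<close> have almost the same length at level \<open>0\<close>:
  choose \<open>L\<close> large first and then \<open>\<epsilon>\<close> small.\<close>

lemma window_stability:
  fixes a :: "nat \<Rightarrow> real"
  assumes a: "\<And>l. 0 \<le> a l" and A: "0 \<le> A" and \<delta>: "0 < \<delta>"
  shows "\<exists>L \<epsilon>. Suc k \<le> L \<and> 0 < \<epsilon> \<and> (\<forall>W V (n::real). 0 \<le> n \<longrightarrow>
    (\<forall>l. 0 \<le> W l) \<longrightarrow> (\<forall>l. W (Suc l) \<le> W l) \<longrightarrow> W 0 \<le> A * n \<longrightarrow>
    (\<forall>l. 0 \<le> V l) \<longrightarrow> (\<forall>l. V (Suc l) \<le> V l) \<longrightarrow> V 0 \<le> A * n \<longrightarrow>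
    (\<forall>l<L. \<bar>W l - (2 + 2 * a l) * W (Suc l) + W (Suc (Suc l))\<bar> \<le> \<epsilon> * n) \<longrightarrow>
    (\<forall>l<L. \<bar>V l - (2 + 2 * a l) * V (Suc l) + V (Suc (Suc l))\<bar> \<le> \<epsilon> * n) \<longrightarrow>
    W (Suc k) = V (Suc k) \<longrightarrow> \<bar>W 0 - V 0\<bar> \<le> \<delta> * n)"
proof -
  obtain K where K: "0 \<le> K" "\<And>\<Delta> \<sigma> e. 0 \<le> \<sigma> \<Longrightarrow> 0 \<le> e \<Longrightarrow> \<Delta> (Suc k) = (0::real) \<Longrightarrow> \<Delta> (Suc (Suc k)) \<le> \<sigma> \<Longrightarrow>
    (\<forall>l\<le>k. \<Delta> l \<le> (2 + 2 * a l) * \<Delta> (Suc l) + \<Delta> (Suc (Suc l)) + 2 * e) \<Longrightarrow> \<Delta> 0 \<le> K * (\<sigma> + e)"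
    using backward_recursion[of a "Suc k" k, OF a] by auto
  define t where "t = \<delta> / (2 * (K + 1))"
  have t0: "0 < t" using \<delta> K(1) by (simp add: t_def)
  have "2 * (K + 1) \<noteq> 0" using K(1) by simp
  hence "(2 * (K + 1)) * t = \<delta>" unfolding t_def times_divide_eq_right by (rule nonzero_mult_div_cancel_left)
  hence "(K + 1) * (t + t) = \<delta>" by (simp add: algebra_simps)
  hence t: "0 < t" "K * (t + t) \<le> \<delta>" using t0 by (simp_all add: distrib_right)
  obtain L0 :: nat where L0: "2 * A\<^sup>2 / t\<^sup>2 \<le> real L0" using real_arch_simple by blast
  define L where "L = max L0 (Suc k)"
  have L: "Suc k \<le> L" "0 < real L" "2 * A\<^sup>2 / t\<^sup>2 \<le> real L" using L0 by (auto simp: L_def)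
  have L2: "A\<^sup>2 / L \<le> t\<^sup>2 / 2" using L(2,3) t(1) by (simp add: field_simps)
  define \<epsilon> where "\<epsilon> = min t (t\<^sup>2 / (6 * (A + 1) * L))"
  have eps: "0 < \<epsilon>" "\<epsilon> \<le> t" using t A L by (auto simp: \<epsilon>_def)
  have "3 * A * L * \<epsilon> \<le> 3 * (A + 1) * L * (t\<^sup>2 / (6 * (A + 1) * L))"
    using A eps by (intro mult_mono) (auto simp: \<epsilon>_def)
  also have "\<dots> = t\<^sup>2 / 2"
  proof -
    have u: "3 * u * (t\<^sup>2 / (6 * u)) = t\<^sup>2 / 2" if "0 < u" for u :: real using that by simp
    have "0 < (A + 1) * L" using A L(2) by simp
    from u[OF this] show ?thesis unfolding mult.assoc[of 3 "A + 1"] mult.assoc[of 6 "A + 1"] .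
  qed
  finally have eps2: "A\<^sup>2 / L + 3 * A * L * \<epsilon> \<le> t\<^sup>2" using L2 by linarith
  show ?thesis
  proof (intro exI[of _ L] exI[of _ \<epsilon>] conjI L(1) eps(1) allI impI)
    fix W V :: "nat \<Rightarrow> real" and n :: real
    assume n: "0 \<le> n" and W: "\<forall>l. 0 \<le> W l" "\<forall>l. W (Suc l) \<le> W l" "W 0 \<le> A * n"
      and V: "\<forall>l. 0 \<le> V l" "\<forall>l. V (Suc l) \<le> V l" "V 0 \<le> A * n"
      and rW: "\<forall>l<L. \<bar>W l - (2 + 2 * a l) * W (Suc l) + W (Suc (Suc l))\<bar> \<le> \<epsilon> * n"
      and rV: "\<forall>l<L. \<bar>V l - (2 + 2 * a l) * V (Suc l) + V (Suc (Suc l))\<bar> \<le> \<epsilon> * n"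
      and eq: "W (Suc k) = V (Suc k)"
    have en: "0 \<le> \<epsilon> * n" using eps n by simp
    have "\<bar>W (Suc (Suc k)) - V (Suc (Suc k))\<bar> \<le> sqrt ((A * n)\<^sup>2 / L + 3 * (A * n) * L * (\<epsilon> * n))"
      by (rule wronskian_bound[OF L(1) en a]) (use W V rW rV eq in auto)
    also have "(A * n)\<^sup>2 / L + 3 * (A * n) * L * (\<epsilon> * n) = (A\<^sup>2 / L + 3 * A * L * \<epsilon>) * n\<^sup>2"
      by (simp add: power2_eq_square algebra_simps)
    also have "sqrt \<dots> \<le> sqrt (t\<^sup>2 * n\<^sup>2)" using eps2 by (intro real_sqrt_le_mono mult_right_mono) auto
    also have "\<dots> = t * n" using t n by (simp add: real_sqrt_mult)
    finally have s: "\<bar>W (Suc (Suc k)) - V (Suc (Suc k))\<bar> \<le> t * n" .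
    define \<Delta> where "\<Delta> l = \<bar>W l - V l\<bar>" for l
    have "\<Delta> 0 \<le> K * (t * n + \<epsilon> * n)"
    proof (rule K(2))
      show "\<forall>l\<le>k. \<Delta> l \<le> (2 + 2 * a l) * \<Delta> (Suc l) + \<Delta> (Suc (Suc l)) + 2 * (\<epsilon> * n)"
      proof (intro allI impI)
        fix l assume "l \<le> k"
        hence "l < L" using L(1) by simp
        have "\<bar>(2 + 2 * a l) * (W (Suc l) - V (Suc l))\<bar> = (2 + 2 * a l) * \<Delta> (Suc l)"
          using a[of l] by (simp add: \<Delta>_def abs_mult)
        moreover have "W l - V l = (W l - (2 + 2 * a l) * W (Suc l) + W (Suc (Suc l)))
          - (V l - (2 + 2 * a l) * V (Suc l) + V (Suc (Suc l)))
          + (2 + 2 * a l) * (W (Suc l) - V (Suc l)) - (W (Suc (Suc l)) - V (Suc (Suc l)))" by (simp add: algebra_simps)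
        ultimately show "\<Delta> l \<le> (2 + 2 * a l) * \<Delta> (Suc l) + \<Delta> (Suc (Suc l)) + 2 * (\<epsilon> * n)"
          using rW[rule_format, OF \<open>l < L\<close>] rV[rule_format, OF \<open>l < L\<close>] unfolding \<Delta>_def by linarith
      qed
    qed (use t n en s eq in \<open>auto simp: \<Delta>_def\<close>)
    also have "\<dots> \<le> K * (t * n + t * n)" using K(1) eps n by (intro mult_left_mono add_mono mult_right_mono) auto
    also have "\<dots> = (K * (t + t)) * n" by (simp add: algebra_simps)
    also have "\<dots> \<le> \<delta> * n" using t n by (intro mult_right_mono) auto
    finally show "\<bar>W 0 - V 0\<bar> \<le> \<delta> * n" by (simp add: \<Delta>_def)
  qed
qed

section \<open>Positions of tagged solitons at all levels\<close>

text \<open>The place of the soliton in slot \<open>J\<close>, of size \<open>k + 1\<close>, at level \<open>l\<close>.  At level \<open>k + 1\<close> it is the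
  label \<open>J\<close>.  Below, it is the first site of the soliton; above, the label of the last slot before
  it.\<close>

definition position :: "(nat \<Rightarrow> int \<Rightarrow> int) \<Rightarrow> nat \<Rightarrow> int \<Rightarrow> nat \<Rightarrow> int" where
  "position s k J l =
     (if l \<le> k then sol_start (\<lambda>m. s (l + m)) (k - l) J
      else rec_nat J (\<lambda>m p. idx (s (Suc k + m)) p) (l - Suc k))"

lemma position_simps:
  "position s k J 0 = sol_start s k J"
  "position s k J k = s k J + 1"
  "position s k J (Suc k) = J"
  "l < k \<Longrightarrow> position s k J l = s l (position s k J (Suc l)) - 1"
  "k < l \<Longrightarrow> position s k J (Suc l) = idx (s l) (position s k J l)"
proof -
  show "position s k J 0 = sol_start s k J" "position s k J k = s k J + 1" "position s k J (Suc k) = J"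
    by (simp_all add: position_def)
  show "position s k J l = s l (position s k J (Suc l)) - 1" if l: "l < k"
  proof -
    have "k - l = Suc (k - Suc l)" using l by simp
    thus ?thesis using l by (simp add: position_def)
  qed
  show "position s k J (Suc l) = idx (s l) (position s k J l)" if l: "k < l"
  proof -
    have "Suc l - Suc k = Suc (l - Suc k)" "Suc k + (l - Suc k) = l" using l by auto
    thus ?thesis using l by (simp add: position_def)
  qed
qed

text \<open>Sum the lengths of the gaps.  The number of changes of letters is the length of the window minus
  its number of slots at the next level.\<close>

lemma gap_sum:
  assumes "tower c s" "a \<le> b"
  shows "s l b - s l a = 2 * (b - a) + 2 * (\<Sum>i\<in>{a..<b}. gap_pairs (s l) i) - (idx (s (Suc l)) b - idx (s (Suc l)) a)"
  using assms(2)
proof (induction b rule: int_ge_induct)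
  case (step b)
  interpret slot_map "c l" "s l" using tower_slot_map[OF assms(1)] .
  interpret N: slot_map "c (Suc l)" "s (Suc l)" using tower_slot_map[OF assms(1)] .
  have w: "\<omega> = c (Suc l)" using tower_omega[OF assms(1)] .
  have "{a..<b + 1} = insert b {a..<b}" using step by auto
  moreover have "s l (b + 1) - s l b = 2 + 2 * gap_pairs (s l) b - (idx (s (Suc l)) (b + 1) - idx (s (Suc l)) b)"
    using gap[of b] N.idx_step[of "b + 1"] by (simp add: w of_bool_def)
  ultimately show ?case using step by simp
qed simp

lemma idx_lip:
  assumes "strict_mono s" "x \<le> y"
  shows "idx s y - idx s x \<le> y - x"
proof (cases "idx s x + 1 \<le> idx s y")
  case True
  from strict_mono_int_diff[OF assms(1) True] idx_le[OF assms(1), of y] less_idx_Suc[OF assms(1), of x]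
  show ?thesis by simp
qed (use assms in simp)

text \<open>The recursion for the lengths of the windows.  At the levels up to \<open>k\<close> the window is bounded by
  two slots and the recursion is exact; above, the ends of the window cut two gaps.\<close>

lemma position_recursion:
  assumes t: "tower c s" and J: "J \<le> J'" "0 < gap_pairs (s k) J" "0 < gap_pairs (s k) J'"
  defines "p \<equiv> position s k J" and "p' \<equiv> position s k J'"
  shows "p l \<le> p' l" "p' (Suc l) - p (Suc l) \<le> p' l - p l"
    "\<bar>(p' l - p l) - (2 * (p' (Suc l) - p (Suc l)) + 2 * (\<Sum>i\<in>{p (Suc l)..<p' (Suc l)}. gap_pairs (s l) i)
        - (p' (Suc (Suc l)) - p (Suc (Suc l))))\<bar>
      \<le> (if l \<le> k then 0 else 2 * gap_pairs (s l) (p (Suc l)) + 2 * gap_pairs (s l) (p' (Suc l)) + 2)"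
proof -
  have sm: "strict_mono (s l)" for l using slot_map.mono[OF tower_slot_map[OF t]] .
  have low: "s l (p' (Suc l)) - s l (p (Suc l)) = p' l - p l" if "l \<le> k" for l
    using that position_simps(2)[of s k] position_simps(3)[of s k] position_simps(4)[of l k s] unfolding p_def p'_def
    by (cases "l = k") auto
  have up: "p (Suc l) \<le> p' (Suc l)" if "p l \<le> p' l" "k < l" for l
    using idx_mono[OF sm that(1)] position_simps(5)[OF that(2)] unfolding p_def p'_def by simp
  have lowle: "p (Suc k - d) \<le> p' (Suc k - d)" if "d \<le> Suc k" for d
    using that
  proof (induction d)
    case 0 thus ?case using J(1) position_simps(3)[of s k] unfolding p_def p'_def by simp
  next
    case (Suc d)
    let ?l = "Suc k - Suc d"
    have l: "Suc ?l = Suc k - d" "?l \<le> k" using Suc.prems by auto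
    have "p (Suc ?l) \<le> p' (Suc ?l)" using Suc l(1) by simp
    hence "s ?l (p (Suc ?l)) \<le> s ?l (p' (Suc ?l))" using sm by (simp add: strict_mono_less_eq)
    thus ?case using low[OF l(2)] by simp
  qed
  have le: "p l \<le> p' l" for l
  proof (induction l)
    case 0 show ?case using lowle[of "Suc k"] by simp
  next
    case (Suc l)
    show ?case
    proof (cases "l \<le> k")
      case True thus ?thesis using lowle[of "k - l"] by (simp add: Suc_diff_le)
    qed (use up Suc in auto)
  qed
  show "p l \<le> p' l" by (rule le)
  show "p' (Suc l) - p (Suc l) \<le> p' l - p l"
  proof (cases "l \<le> k")
    case True
    thus ?thesis using low[OF True] strict_mono_int_diff[OF sm le] by metis
  next
    case False
    thus ?thesis using idx_lip[OF sm le] position_simps(5)[of k l s] unfolding p_def p'_def by simp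
  qed
  note gs = gap_sum[OF t le[of "Suc l"], of l]
  show "\<bar>(p' l - p l) - (2 * (p' (Suc l) - p (Suc l)) + 2 * (\<Sum>i\<in>{p (Suc l)..<p' (Suc l)}. gap_pairs (s l) i)
        - (p' (Suc (Suc l)) - p (Suc (Suc l))))\<bar>
      \<le> (if l \<le> k then 0 else 2 * gap_pairs (s l) (p (Suc l)) + 2 * gap_pairs (s l) (p' (Suc l)) + 2)"
  proof (cases "l \<le> k")
    case True
    have top: "idx (s k) (position s k J k) = J" if "0 < gap_pairs (s k) J" for J
    proof -
      interpret slot_map "c k" "s k" using tower_slot_map[OF t] .
      show ?thesis using that gap[of J] position_simps(2)[of s k J] by (intro idx_unique[OF mono]) (auto simp: of_bool_def)
    qed
    have "idx (s (Suc l)) (p' (Suc l)) - idx (s (Suc l)) (p (Suc l)) = p' (Suc (Suc l)) - p (Suc (Suc l))"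
    proof -
      consider "l = k" | "Suc l = k" | "Suc l < k" using True by linarith
      thus ?thesis
      proof cases
        case 1 thus ?thesis using position_simps(5)[of k "Suc l" s] unfolding p_def p'_def by simp
      next
        case 2 thus ?thesis using top[OF J(2)] top[OF J(3)] position_simps(3)[of s k] unfolding p_def p'_def by auto
      next
        case 3
        have "idx (s (Suc l)) (s (Suc l) q - 1) = q - 1" for q
          using sm[of "Suc l"] by (intro idx_unique) (auto simp: strict_mono_less zle_diff1_eq)
        thus ?thesis using position_simps(4)[OF 3, of s] unfolding p_def p'_def by simp
      qed
    qed
    thus ?thesis using gs low[OF True] True by simp
  next
    case False
    hence kl: "k < l" by simp
    have b: "s l (q (Suc l)) \<le> q l \<and> q l \<le> s l (q (Suc l)) + 2 * gap_pairs (s l) (q (Suc l)) + 1"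
      if q: "q = position s k I" for q I
    proof -
      interpret slot_map "c l" "s l" using tower_slot_map[OF t] .
      have i: "q (Suc l) = idx (s l) (q l)" using position_simps(5)[OF kl] q by simp
      have "s l (q (Suc l)) \<le> q l" "q l < s l (q (Suc l) + 1)" unfolding i using idx_le[OF sm] less_idx_Suc[OF sm] by auto
      thus ?thesis using gap[of "q (Suc l)"] by (auto simp: of_bool_def split: if_splits)
    qed
    have "idx (s (Suc l)) (p' (Suc l)) - idx (s (Suc l)) (p (Suc l)) = p' (Suc (Suc l)) - p (Suc (Suc l))"
      using position_simps(5)[of k "Suc l" s] kl unfolding p_def p'_def by simp
    moreover have "0 \<le> gap_pairs (s l) i" for i using slot_map.gap_pairs_nonneg[OF tower_slot_map[OF t, of l]] .
    ultimately show ?thesis using gs b[of p J] b[of p' J'] False unfolding p_def p'_def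
      by (smt (verit))
  qed
qed

section \<open>Tagged solitons when all long windows are typical\<close>

text \<open>At scale \<open>m\<close> all window sums at the levels up to \<open>L\<close> are as expected up to \<open>\<epsilon> m\<close>, for windows
  of length at most \<open>A m\<close> that begin within distance \<open>m\<^sup>3\<close> of the origin; the cube leaves room for
  the distance \<open>O(m\<^sup>2)\<close> that tagged solitons travel in time \<open>m\<^sup>2\<close>.  Moreover there are enough occupied
  slots next to the origin at level \<open>k\<close>.\<close>

definition typical :: "real \<Rightarrow> nat \<Rightarrow> real \<Rightarrow> (nat \<Rightarrow> real) \<Rightarrow> nat \<Rightarrow> real \<Rightarrow> (nat \<Rightarrow> int \<Rightarrow> int) \<Rightarrow> nat \<Rightarrow> bool" where
  "typical A L \<epsilon> \<alpha> k \<beta> Z m \<longleftrightarrow>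
     (\<forall>l\<le>L. \<forall>a. \<bar>a\<bar> \<le> int m ^ 3 \<longrightarrow> (\<forall>w. real w \<le> A * real m \<longrightarrow>
        \<bar>real_of_int (\<Sum>i\<in>{a..<a + int w}. Z l i) - \<alpha> l * real w\<bar> \<le> \<epsilon> * real m)) \<and>
     (\<forall>a\<in>{0, - int m}. \<beta> * real m \<le> real (card {i\<in>{a..<a + int m}. 0 < Z k i}))"

text \<open>Counting occupied slots from the origin bounds the label of the \<open>i\<close>-th one linearly in \<open>i\<close>.\<close>

lemma occupied_slots:
  fixes Z :: "int \<Rightarrow> int"
  assumes \<beta>: "0 < \<beta>"
    and occ: "\<And>m a. M \<le> m \<Longrightarrow> a \<in> {0, - int m} \<Longrightarrow> \<beta> * real m \<le> real (card {i\<in>{a..<a + int m}. 0 < Z i})"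
  shows "\<exists>Jn. enumerates Jn {J. 0 < Z J} \<and> Jn 0 < 0 \<and> 0 \<le> Jn 1 \<and>
    (\<forall>i. real_of_int \<bar>Jn i\<bar> \<le> real M + (real_of_int \<bar>i\<bar> + 1) / \<beta>)"
proof -
  let ?S = "{J. 0 < Z J}"
  have far: "\<exists>y\<in>?S. X \<le> y" "\<exists>y\<in>?S. y < - X" if "0 \<le> X" for X
  proof -
    define m where "m = max M (nat \<lceil>(real_of_int X + 1) / \<beta>\<rceil>)"
    have "(real_of_int X + 1) / \<beta> \<le> real m" unfolding m_def by linarith
    hence Xm: "real_of_int X + 1 \<le> \<beta> * real m" using \<beta> by (simp add: field_simps)
    have not: "\<not> {i\<in>{a..<a + int m}. 0 < Z i} \<subseteq> {b..<b + X}" if "a \<in> {0, - int m}" for a b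
    proof
      assume "{i\<in>{a..<a + int m}. 0 < Z i} \<subseteq> {b..<b + X}"
      hence "card {i\<in>{a..<a + int m}. 0 < Z i} \<le> nat X" using card_mono[of "{b..<b + X}"] by fastforce
      hence "real (card {i\<in>{a..<a + int m}. 0 < Z i}) \<le> real_of_int X" using \<open>0 \<le> X\<close> by linarith
      thus False using occ[of m a] that Xm by (simp add: m_def)
    qed
    from not[of 0 0] obtain y where "y \<in> {i\<in>{0..<0 + int m}. 0 < Z i}" "y \<notin> {0..<0 + X}" by blast
    thus "\<exists>y\<in>?S. X \<le> y" by (intro bexI[of _ y]) auto
    from not[of "- int m" "- X"] obtain y
      where "y \<in> {i\<in>{- int m..<- int m + int m}. 0 < Z i}" "y \<notin> {- X..<- X + X}" by blast
    thus "\<exists>y\<in>?S. y < - X" by (intro bexI[of _ y]) auto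
  qed
  obtain x where x: "0 < Z x" "x < 0" using far(2)[of 0] by auto
  define x0 where "x0 = (GREATEST x. 0 < Z x \<and> x < 0)"
  note G = int_Greatest[of "\<lambda>x. 0 < Z x \<and> x < 0" x 0]
  have x0: "0 < Z x0" "x0 < 0" using G(1) x by (auto simp: x0_def)
  have x0m: "y \<le> x0" if "0 < Z y" "y < 0" for y using G(2)[of y] x that by (simp add: x0_def)
  have "\<exists>y\<in>?S. X \<le> y" for X using far(1)[of "\<bar>X\<bar>"] by (auto intro: order_trans)
  moreover have "\<exists>y\<in>?S. y \<le> X" for X
  proof -
    obtain y where "0 < Z y" "y < - \<bar>X\<bar>" using far(2)[of "\<bar>X\<bar>"] by auto
    thus ?thesis by (intro bexI[of _ y]) auto
  qed
  ultimately obtain Jn where Jn: "enumerates Jn ?S" "Jn 0 = x0"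
    using enumerates_exists[of ?S x0] x0 by auto
  have sm: "strict_mono Jn" and ra: "range Jn = ?S" using Jn by (auto simp: enumerates_def)
  have J1: "0 \<le> Jn 1"
  proof (rule ccontr)
    assume "\<not> 0 \<le> Jn 1"
    moreover have "0 < Z (Jn 1)" using ra by auto
    ultimately have "Jn 1 \<le> x0" using x0m by simp
    thus False using sm Jn(2) by (metis not_le strict_mono_less zero_less_one)
  qed
  have count: "card {i\<in>{a..<b}. 0 < Z i} \<le> nat (v - u)"
    if "\<And>i. a \<le> Jn i \<Longrightarrow> Jn i < b \<Longrightarrow> u \<le> i \<and> i < v" for a b u v
  proof -
    have "{i\<in>{a..<b}. 0 < Z i} \<subseteq> Jn ` {u..<v}"
    proof
      fix y assume y: "y \<in> {i\<in>{a..<b}. 0 < Z i}"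
      hence "y \<in> range Jn" using ra by auto
      then obtain i where "y = Jn i" by blast
      thus "y \<in> Jn ` {u..<v}" using that[of i] y by auto
    qed
    hence "card {i\<in>{a..<b}. 0 < Z i} \<le> card (Jn ` {u..<v})" by (intro card_mono) auto
    also have "\<dots> \<le> nat (v - u)" using card_image_le[of "{u..<v}" Jn] by simp
    finally show ?thesis .
  qed
  have bound: "real_of_int \<bar>Jn i\<bar> \<le> real M + (real_of_int \<bar>i\<bar> + 1) / \<beta>" for i
  proof (cases "nat \<bar>Jn i\<bar> \<le> M")
    case True
    have "0 \<le> (real_of_int \<bar>i\<bar> + 1) / \<beta>" using \<beta> by simp
    thus ?thesis using True by linarith
  next
    case False
    define m where "m = nat \<bar>Jn i\<bar>"
    have m: "M \<le> m" using False by (simp add: m_def)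
    have "\<beta> * real m \<le> real_of_int \<bar>i\<bar> + 1"
    proof (cases "1 \<le> i")
      case True
      have pos: "0 \<le> Jn i" using J1 True sm by (meson order_trans strict_mono_less_eq)
      have "card {j\<in>{0..<0 + int m}. 0 < Z j} \<le> nat (i - 1)"
      proof (rule count)
        fix j assume j: "0 \<le> Jn j" "Jn j < 0 + int m"
        have "Jn 0 < Jn j" using j x0 Jn(2) by simp
        hence "0 < j" using sm by (simp add: strict_mono_less)
        moreover have "Jn j < Jn i" using j pos by (simp add: m_def)
        hence "j < i" using sm by (simp add: strict_mono_less)
        ultimately show "1 \<le> j \<and> j < i" by simp
      qed
      hence "real (card {j\<in>{0..<0 + int m}. 0 < Z j}) \<le> real_of_int \<bar>i\<bar> + 1" using True by linarith
      thus ?thesis using occ[OF m, of 0] by simp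
    next
      case False
      have neg: "Jn i < 0" using False sm x0 Jn(2) strict_mono_less_eq[of Jn i 0] by simp
      have "card {j\<in>{- int m..<- int m + int m}. 0 < Z j} \<le> nat (1 - i)"
      proof (rule count)
        fix j assume j: "- int m \<le> Jn j" "Jn j < - int m + int m"
        have "Jn j < Jn 1" using j J1 by simp
        hence "j < 1" using sm by (simp add: strict_mono_less)
        moreover have "Jn i \<le> Jn j" using j neg by (simp add: m_def)
        hence "i \<le> j" using sm by (simp add: strict_mono_less_eq)
        ultimately show "i \<le> j \<and> j < 1" by simp
      qed
      hence "real (card {j\<in>{- int m..<- int m + int m}. 0 < Z j}) \<le> real_of_int \<bar>i\<bar> + 1" using False by linarith
      thus ?thesis using occ[OF m, of "- int m"] by simp
    qed
    hence "real m \<le> (real_of_int \<bar>i\<bar> + 1) / \<beta>" using \<beta> by (simp add: field_simps)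
    thus ?thesis by (simp add: m_def)
  qed
  show ?thesis using Jn x0 J1 bound by auto
qed

text \<open>A configuration at time \<open>0\<close> with a record at the origin, which is then a record of all its
  contractions.\<close>

locale anchored_tower =
  fixes c :: "nat \<Rightarrow> config" and s :: "nat \<Rightarrow> int \<Rightarrow> int"
  assumes tower: "tower c s" and sloped: "sloped (c 0)" and record_0: "is_record (c 0) 0"
    and anchor: "\<And>l. s l 0 = 0"
begin

lemma s_mono: "strict_mono (s l)"
  using slot_map.mono[OF tower_slot_map[OF tower]] .

lemma nonneg: "0 \<le> gap_pairs (s l) i"
  using slot_map.gap_pairs_nonneg[OF tower_slot_map[OF tower]] .

lemma tower_t: "tower (\<lambda>l. (bbs ^^ t) (c l)) (move c s t)"
  by (rule tower_move(1)[OF tower sloped])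

lemma gap_pairs_t: "gap_pairs (move c s t l) = gap_pairs (s l)"
  by (rule tower_move(3)[OF tower sloped])

lemma move_mono: "strict_mono (move c s t l)"
  using slot_map.mono[OF tower_slot_map[OF tower_t]] .

lemma idx_bound: "\<bar>idx (move c s t l) p\<bar> \<le> \<bar>p\<bar> + int t + 1"
proof -
  define q where "q = idx (move c s t l) p"
  have q: "move c s t l q \<le> p" "p < move c s t l (q + 1)"
    using idx_le[OF move_mono] less_idx_Suc[OF move_mono] by (auto simp: q_def)
  note mb = move_bounds[of s l _ c t]
  show ?thesis
  proof (cases "0 \<le> q")
    case True
    have "q \<le> s l q" using strict_mono_int_diff[OF s_mono True, of l] anchor by simp
    thus ?thesis using q(1) mb[of q] True by (simp add: q_def)
  next
    case False
    hence "q + 1 \<le> 0" by simp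
    from strict_mono_int_diff[OF s_mono this, of l] have "s l (q + 1) \<le> q + 1" using anchor by simp
    hence "p < q + 1 + int t" using q(2) mb[of "q + 1"] by linarith
    thus ?thesis using False by (simp add: q_def[symmetric])
  qed
qed

lemma sum_bound:
  assumes "a \<le> b"
  shows "s l b - s l a \<le> 2 * (b - a) + 2 * (\<Sum>i\<in>{a..<b}. gap_pairs (s l) i)"
  using gap_sum[OF tower assms, of l] idx_mono[OF s_mono assms, of "Suc l"] by simp

lemma slot_bound:
  assumes sums: "\<And>m a. M \<le> m \<Longrightarrow> a \<in> {0, - int m} \<Longrightarrow>
      real_of_int (\<Sum>i\<in>{a..<a + int m}. gap_pairs (s l) i) \<le> \<gamma> * real m" and \<gamma>: "0 \<le> \<gamma>"
  shows "real_of_int \<bar>s l x\<bar> \<le> (2 + 2 * \<gamma>) * (real_of_int \<bar>x\<bar> + real M)"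
proof -
  define m where "m = max M (nat \<bar>x\<bar>)"
  have m: "M \<le> m" "\<bar>x\<bar> \<le> int m" "real m \<le> real_of_int \<bar>x\<bar> + real M" by (auto simp: m_def)
  have "\<bar>s l x\<bar> \<le> s l (int m) \<or> \<bar>s l x\<bar> \<le> - s l (- int m)"
  proof (cases "0 \<le> x")
    case True
    hence "s l 0 \<le> s l x" "s l x \<le> s l (int m)" using s_mono[of l] m by (simp_all add: strict_mono_less_eq)
    thus ?thesis using anchor by simp
  next
    case False
    hence "s l x \<le> s l 0" "s l (- int m) \<le> s l x" using s_mono[of l] m by (simp_all add: strict_mono_less_eq)
    thus ?thesis using anchor by simp
  qed
  moreover have "real_of_int (s l (int m)) \<le> 2 * real m + 2 * (\<gamma> * real m)"
  proof -
    define S where "S = (\<Sum>i\<in>{0..<0 + int m}. gap_pairs (s l) i)"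
    have "s l (int m) \<le> 2 * int m + 2 * S" using sum_bound[of 0 "int m" l] anchor[of l] by (simp add: S_def)
    hence "real_of_int (s l (int m)) \<le> real_of_int (2 * int m + 2 * S)" by (simp only: of_int_le_iff)
    moreover have "real_of_int S \<le> \<gamma> * real m" unfolding S_def by (rule sums[OF m(1)]) simp
    ultimately show ?thesis by simp
  qed
  moreover have "real_of_int (- s l (- int m)) \<le> 2 * real m + 2 * (\<gamma> * real m)"
  proof -
    define S where "S = (\<Sum>i\<in>{- int m..<- int m + int m}. gap_pairs (s l) i)"
    have "- s l (- int m) \<le> 2 * int m + 2 * S" using sum_bound[of "- int m" 0 l] anchor[of l] by (simp add: S_def)
    hence "real_of_int (- s l (- int m)) \<le> real_of_int (2 * int m + 2 * S)" by (simp only: of_int_le_iff)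
    moreover have "real_of_int S \<le> \<gamma> * real m" unfolding S_def by (rule sums[OF m(1)]) simp
    ultimately show ?thesis by simp
  qed
  ultimately have "real_of_int \<bar>s l x\<bar> \<le> (2 + 2 * \<gamma>) * real m" by (simp add: algebra_simps) linarith
  also have "\<dots> \<le> (2 + 2 * \<gamma>) * (real_of_int \<bar>x\<bar> + real M)" using \<gamma> m(3) by (intro mult_left_mono) auto
  finally show ?thesis .
qed

text \<open>Descending from the label \<open>J\<close>, each level multiplies distances from the origin by a constant,
  because sums of counts over long windows at the origin are at most linear.\<close>

lemma position_bound_low:
  assumes sums: "\<And>l m a. l \<le> k \<Longrightarrow> M \<le> m \<Longrightarrow> a \<in> {0, - int m} \<Longrightarrow>
      real_of_int (\<Sum>i\<in>{a..<a + int m}. gap_pairs (s l) i) \<le> \<gamma> * real m" and \<gamma>: "0 \<le> \<gamma>"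
    and d: "d \<le> Suc k"
  shows "real_of_int \<bar>position (move c s t) k J (Suc k - d)\<bar>
      \<le> (2 * (2 + 2 * \<gamma>)) ^ d * (real_of_int \<bar>J\<bar> + real M + real t + 1)"
  using d
proof (induction d)
  case 0
  show ?case by (simp add: position_simps)
next
  case (Suc d)
  let ?l = "k - d" and ?b = "2 + 2 * \<gamma>" and ?T = "real_of_int \<bar>J\<bar> + real M + real t + 1"
  let ?p = "position (move c s t) k J (Suc k - d)" and ?q = "position (move c s t) k J (Suc k - Suc d)"
  have l: "?l \<le> k" "Suc k - Suc d = ?l" "Suc k - d = Suc ?l" using Suc.prems by auto
  have "?q = move c s t ?l ?p + 1 \<or> ?q = move c s t ?l ?p - 1"
  proof (cases "?l = k")
    case True
    hence "d = 0" using Suc.prems by linarith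
    thus ?thesis using position_simps(2,3)[of "move c s t" k J] by simp
  next
    case False
    thus ?thesis using position_simps(4)[of ?l k "move c s t" J] l by simp
  qed
  moreover have "\<bar>move c s t ?l ?p\<bar> \<le> \<bar>s ?l ?p\<bar> + int t" using move_bounds[of s ?l ?p c t] by linarith
  ultimately have "\<bar>?q\<bar> \<le> \<bar>s ?l ?p\<bar> + int t + 1" by linarith
  hence "real_of_int \<bar>?q\<bar> \<le> real_of_int \<bar>s ?l ?p\<bar> + real t + 1" by linarith
  also have "\<dots> \<le> ?b * (real_of_int \<bar>?p\<bar> + real M) + real t + 1"
    using slot_bound[OF sums[OF l(1)] \<gamma>, of M ?p] by simp
  also have "\<dots> \<le> ?b * (real_of_int \<bar>?p\<bar> + real M) + ?b * (real t + 1)"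
  proof -
    have "0 \<le> \<gamma> * (real t + 1)" using \<gamma> by simp
    thus ?thesis by (simp add: algebra_simps)
  qed
  also have "\<dots> = ?b * (real_of_int \<bar>?p\<bar> + (real M + real t + 1))" by (simp add: algebra_simps)
  also have "\<dots> \<le> ?b * ((2 * ?b) ^ d * ?T + (2 * ?b) ^ d * ?T)"
  proof (intro mult_left_mono add_mono)
    show "real_of_int \<bar>?p\<bar> \<le> (2 * ?b) ^ d * ?T" using Suc by simp
    have "1 * (real M + real t + 1) \<le> (2 * ?b) ^ d * ?T"
      using \<gamma> by (intro mult_mono one_le_power) auto
    thus "real M + real t + 1 \<le> (2 * ?b) ^ d * ?T" by simp
  qed (use \<gamma> in simp)
  also have "\<dots> = (2 * ?b) ^ Suc d * ?T" by (simp add: algebra_simps)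
  finally show ?case .
qed

lemma position_bound_high:
  "\<bar>position (move c s t) k J (Suc k + d)\<bar> \<le> \<bar>J\<bar> + int d * (int t + 1)"
proof (induction d)
  case (Suc d)
  have "position (move c s t) k J (Suc k + Suc d) = idx (move c s t (Suc k + d)) (position (move c s t) k J (Suc k + d))"
    using position_simps(5)[of k "Suc k + d"] by simp
  thus ?case using idx_bound[of t "Suc k + d" "position (move c s t) k J (Suc k + d)"] Suc
    by (simp add: algebra_simps)
qed (simp add: position_simps)

end

lemma typical_window:
  assumes "typical A L \<epsilon> \<alpha> k \<beta> Z n" "l \<le> L" "\<bar>a\<bar> \<le> int n ^ 3" "a \<le> b" "real_of_int (b - a) \<le> A * real n"
  shows "\<bar>real_of_int (\<Sum>i\<in>{a..<b}. Z l i) - \<alpha> l * real_of_int (b - a)\<bar> \<le> \<epsilon> * real n"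
proof -
  have b: "b = a + int (nat (b - a))" "real (nat (b - a)) = real_of_int (b - a)" using assms(4) by auto
  have "\<bar>real_of_int (\<Sum>i\<in>{a..<a + int (nat (b - a))}. Z l i) - \<alpha> l * real (nat (b - a))\<bar> \<le> \<epsilon> * real n"
    using assms unfolding typical_def b(2) by (metis b(2))
  thus ?thesis using b by metis
qed

context anchored_tower begin

text \<open>The assumptions of \<open>window_stability\<close>, for one of the two times.\<close>

lemma window_typical:
  fixes \<alpha> Aq :: "nat \<Rightarrow> real"
  assumes ty: "typical A L \<epsilon> \<alpha> k \<beta> (\<lambda>l. gap_pairs (s l)) n"
    and J: "J \<le> J'" "0 < gap_pairs (s k) J" "0 < gap_pairs (s k) J'"
    and pos: "\<And>l. l \<le> L \<Longrightarrow> \<bar>position (move c s t) k J l\<bar> \<le> int n ^ 3"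
      "\<And>l. l \<le> L \<Longrightarrow> \<bar>position (move c s t) k J' l\<bar> \<le> int n ^ 3"
    and top: "real_of_int (J' - J) \<le> Aq 0 * real n"
    and Aq: "\<And>l d. l \<le> k \<Longrightarrow> 2 * (1 + \<alpha> l) * Aq d + 2 \<le> Aq (Suc d)" "\<And>d. d \<le> Suc k \<Longrightarrow> Aq d \<le> A"
    and par: "k < L" "\<epsilon> \<le> 1" "1 \<le> A * real n" "\<And>l. 0 \<le> \<alpha> l"
  defines "W \<equiv> \<lambda>l. real_of_int (position (move c s t) k J' l - position (move c s t) k J l)"
  shows "0 \<le> W l" "W (Suc l) \<le> W l" "W 0 \<le> A * real n"
    "l < L \<Longrightarrow> \<bar>W l - (2 + 2 * \<alpha> l) * W (Suc l) + W (Suc (Suc l))\<bar> \<le> 6 * \<epsilon> * real n + 4 * \<alpha> l + 2"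
proof -
  define p p' where "p = position (move c s t) k J" and "p' = position (move c s t) k J'"
  define S where "S l = (\<Sum>i\<in>{p (Suc l)..<p' (Suc l)}. gap_pairs (s l) i)" for l
  have J2: "0 < gap_pairs (move c s t k) J" "0 < gap_pairs (move c s t k) J'" using J by (simp_all add: gap_pairs_t)
  note R = position_recursion[OF tower_t J(1) J2, of _ , folded p_def p'_def, unfolded gap_pairs_t]
  have Wp: "W l = real_of_int (p' l - p l)" for l by (simp add: W_def p_def p'_def)
  show nonneg': "0 \<le> W l" for l using R(1)[of l] by (simp add: Wp)
  show anti: "W (Suc l) \<le> W l" for l using R(2)[of l] unfolding Wp by (simp only: of_int_le_iff)
  have Wle: "W l \<le> W m" if "m \<le> l" for l m using lift_Suc_antimono_le[of W, OF anti that] .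
  have Sty: "\<bar>real_of_int (S l) - \<alpha> l * W (Suc l)\<bar> \<le> \<epsilon> * real n" if "l < L" "W (Suc l) \<le> A * real n" for l
    unfolding S_def Wp using that pos(1)[of "Suc l"] R(1)[of "Suc l"]
    by (intro typical_window[OF ty]) (auto simp: p_def[symmetric] Wp)
  have bound: "W (Suc k - d) \<le> Aq d * real n" if "d \<le> Suc k" for d
    using that
  proof (induction d)
    case 0
    show ?case using top by (simp add: W_def position_simps)
  next
    case (Suc d)
    let ?l = "k - d"
    have l: "?l \<le> k" "Suc k - Suc d = ?l" "Suc k - d = Suc ?l" using Suc.prems by auto
    have IH: "W (Suc ?l) \<le> Aq d * real n" using Suc l by simp
    also have "\<dots> \<le> A * real n" using Aq(2)[of d] Suc.prems by (intro mult_right_mono) auto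
    finally have le: "W (Suc ?l) \<le> A * real n" .
    have "p' ?l - p ?l = 2 * (p' (Suc ?l) - p (Suc ?l)) + 2 * S ?l - (p' (Suc (Suc ?l)) - p (Suc (Suc ?l)))"
      using R(3)[of ?l] l(1) unfolding S_def by simp
    hence "W ?l = real_of_int (2 * (p' (Suc ?l) - p (Suc ?l)) + 2 * S ?l - (p' (Suc (Suc ?l)) - p (Suc (Suc ?l))))"
      unfolding Wp by (simp only:)
    hence "W ?l = 2 * W (Suc ?l) + 2 * real_of_int (S ?l) - W (Suc (Suc ?l))" unfolding Wp by simp
    also have "\<dots> \<le> 2 * W (Suc ?l) + 2 * (\<alpha> ?l * W (Suc ?l) + \<epsilon> * real n)"
      using Sty[OF _ le] l par(1) nonneg'[of "Suc (Suc ?l)"] by (simp add: abs_le_iff)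
    also have "\<dots> \<le> 2 * W (Suc ?l) + 2 * (\<alpha> ?l * W (Suc ?l) + 1 * real n)"
      using par(2) mult_right_mono[OF par(2), of "real n"] by simp
    also have "\<dots> = 2 * (1 + \<alpha> ?l) * W (Suc ?l) + 2 * real n" by (simp add: algebra_simps)
    also have "\<dots> \<le> 2 * (1 + \<alpha> ?l) * (Aq d * real n) + 2 * real n"
      using IH par(4)[of ?l] by (intro add_mono mult_left_mono) auto
    also have "\<dots> = (2 * (1 + \<alpha> ?l) * Aq d + 2) * real n" by (simp add: algebra_simps)
    also have "\<dots> \<le> Aq (Suc d) * real n" using Aq(1)[OF l(1)] by (intro mult_right_mono) auto
    finally show ?case using l by simp
  qed
  have "W 0 \<le> Aq (Suc k) * real n" using bound[of "Suc k"] by simp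
  also have "\<dots> \<le> A * real n" using Aq(2)[of "Suc k"] by (intro mult_right_mono) auto
  finally show W0: "W 0 \<le> A * real n" .
  assume l: "l < L"
  have le: "W (Suc l) \<le> A * real n" using Wle[of 0 "Suc l"] W0 by simp
  have Z: "real_of_int (gap_pairs (s l) x) \<le> \<alpha> l + \<epsilon> * real n" if "\<bar>x\<bar> \<le> int n ^ 3" for x
  proof -
    have "{x..<x + 1} = {x}" by auto
    thus ?thesis using typical_window[OF ty _ that, of l "x + 1"] l par(3) by (simp add: abs_le_iff)
  qed
  define E where "E = (if l \<le> k then 0 else 2 * gap_pairs (s l) (p (Suc l)) + 2 * gap_pairs (s l) (p' (Suc l)) + 2)"
  have en: "0 \<le> \<epsilon> * real n" using Sty[OF l le] by linarith
  have E: "real_of_int E \<le> 4 * (\<alpha> l + \<epsilon> * real n) + 2"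
  proof (cases "l \<le> k")
    case True thus ?thesis using en par(4)[of l] by (simp add: E_def)
  next
    case False
    thus ?thesis using Z[of "p (Suc l)"] Z[of "p' (Suc l)"] pos(1)[of "Suc l"] pos(2)[of "Suc l"] l
      by (simp add: E_def p_def p'_def)
  qed
  have "\<bar>(p' l - p l) - (2 * (p' (Suc l) - p (Suc l)) + 2 * S l - (p' (Suc (Suc l)) - p (Suc (Suc l))))\<bar> \<le> E"
    using R(3)[of l] unfolding S_def E_def .
  hence "real_of_int \<bar>(p' l - p l) - (2 * (p' (Suc l) - p (Suc l)) + 2 * S l - (p' (Suc (Suc l)) - p (Suc (Suc l))))\<bar>
      \<le> real_of_int E" by (simp only: of_int_le_iff)
  hence "\<bar>W l - (2 * W (Suc l) + 2 * real_of_int (S l) - W (Suc (Suc l)))\<bar> \<le> real_of_int E" unfolding Wp by simp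
  thus "\<bar>W l - (2 + 2 * \<alpha> l) * W (Suc l) + W (Suc (Suc l))\<bar> \<le> 6 * \<epsilon> * real n + 4 * \<alpha> l + 2"
    using E Sty[OF l le] by (simp add: abs_le_iff algebra_simps)
qed

end

text \<open>The deterministic heart: if all scales from \<open>M\<close> on are typical, the displacements of two tagged
  solitons with indices \<open>O(n)\<close> differ by at most \<open>C (M + n\<^sup>2)\<close>, and by at most \<open>\<delta> n\<close> once \<open>n\<close>
  exceeds \<open>M\<close> and a constant.  The length \<open>A n\<close> of the longest window is fixed before \<open>L\<close> and
  \<open>\<epsilon>\<close>, as it depends on the levels up to \<open>k\<close> only.\<close>

theorem tagged_estimate:
  fixes \<alpha> :: "nat \<Rightarrow> real"
  assumes \<alpha>: "\<And>l. 0 \<le> \<alpha> l" and U: "1 \<le> U" and \<beta>: "0 < \<beta>" and \<delta>: "0 < \<delta>"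
  shows "\<exists>A L \<epsilon> n0 C. 1 \<le> A \<and> 0 < \<epsilon> \<and> 0 \<le> C \<and> (\<forall>c s M. anchored_tower c s \<longrightarrow> 1 \<le> M \<longrightarrow>
    (\<forall>m\<ge>M. typical A L \<epsilon> \<alpha> k \<beta> (\<lambda>l. gap_pairs (s l)) m) \<longrightarrow>
    (\<forall>n i j. 1 \<le> n \<longrightarrow> real_of_int \<bar>i\<bar> \<le> U * real n \<longrightarrow> real_of_int \<bar>j\<bar> \<le> U * real n \<longrightarrow>
      \<bar>real_of_int (Y_disp (Suc k) i (c 0) (n\<^sup>2) - Y_disp (Suc k) j (c 0) (n\<^sup>2))\<bar> \<le> C * (real M + (real n)\<^sup>2) \<and>
      (n0 \<le> n \<longrightarrow> M \<le> n \<longrightarrow>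
        \<bar>real_of_int (Y_disp (Suc k) i (c 0) (n\<^sup>2) - Y_disp (Suc k) j (c 0) (n\<^sup>2))\<bar> \<le> \<delta> * real n)))"
proof -
  define \<gamma> where "\<gamma> = 1 + Max (\<alpha> ` {..k})"
  have \<gamma>: "\<alpha> l + 1 \<le> \<gamma>" if "l \<le> k" for l using that by (simp add: \<gamma>_def)
  have \<gamma>1: "1 \<le> \<gamma>" using \<gamma>[of 0] \<alpha>[of 0] by simp
  define B where "B = (2 * (2 + 2 * \<gamma>)) ^ Suc k"
  have B1: "1 \<le> B" unfolding B_def using \<gamma>1 by (intro one_le_power) auto
  define u where "u = (U + 1) / \<beta>"
  have u0: "0 \<le> u" using U \<beta> by (simp add: u_def)
  \<comment> \<open>\<open>Aq d\<close> bounds the length of the window at level \<open>k + 1 - d\<close>, in units of \<open>n\<close>.\<close>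
  define Aq where "Aq = rec_nat (2 * (1 + u)) (\<lambda>_ x. 2 * \<gamma> * x + 2 :: real)"
  have Aq0: "Aq 0 = 2 * (1 + u)" and AqS: "Aq (Suc d) = 2 * \<gamma> * Aq d + 2" for d by (simp_all add: Aq_def)
  have Aqpos: "2 \<le> Aq d" for d
  proof (induction d)
    case (Suc d)
    have "0 \<le> \<gamma> * Aq d" using Suc \<gamma>1 by simp
    thus ?case by (simp add: AqS)
  qed (use u0 Aq0 in simp)
  have Aqmono: "Aq d \<le> Aq (Suc d)" for d
  proof -
    have "1 * Aq d \<le> \<gamma> * Aq d" using \<gamma>1 Aqpos[of d] by (intro mult_right_mono) auto
    moreover have "Aq (Suc d) = 2 * (\<gamma> * Aq d) + 2" by (simp add: AqS)
    ultimately show ?thesis using Aqpos[of d] by linarith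
  qed
  define A where "A = Aq (Suc k)"
  have A1: "1 \<le> A" using Aqpos[of "Suc k"] by (simp add: A_def)
  have AqA: "Aq d \<le> A" if "d \<le> Suc k" for d unfolding A_def using lift_Suc_mono_le[of Aq, OF Aqmono that] .
  have Aqstep: "2 * (1 + \<alpha> l) * Aq d + 2 \<le> Aq (Suc d)" if "l \<le> k" for l d
  proof -
    have "(1 + \<alpha> l) * Aq d \<le> \<gamma> * Aq d" using \<gamma>[OF that] Aqpos[of d] by (intro mult_right_mono) auto
    hence "2 * ((1 + \<alpha> l) * Aq d) + 2 \<le> 2 * (\<gamma> * Aq d) + 2" by linarith
    thus ?thesis unfolding AqS mult.assoc .
  qed
  obtain L \<epsilon>' where L: "Suc k \<le> L" and \<epsilon>': "0 < \<epsilon>'" and stab: "\<And>W V (n::real). 0 \<le> n \<Longrightarrow>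
    (\<forall>l. 0 \<le> W l) \<Longrightarrow> (\<forall>l. W (Suc l) \<le> W l) \<Longrightarrow> W 0 \<le> A * n \<Longrightarrow>
    (\<forall>l. 0 \<le> V l) \<Longrightarrow> (\<forall>l. V (Suc l) \<le> V l) \<Longrightarrow> V 0 \<le> A * n \<Longrightarrow>
    (\<forall>l<L. \<bar>W l - (2 + 2 * \<alpha> l) * W (Suc l) + W (Suc (Suc l))\<bar> \<le> \<epsilon>' * n) \<Longrightarrow>
    (\<forall>l<L. \<bar>V l - (2 + 2 * \<alpha> l) * V (Suc l) + V (Suc (Suc l))\<bar> \<le> \<epsilon>' * n) \<Longrightarrow>
    W (Suc k) = V (Suc k) \<Longrightarrow> \<bar>W 0 - V 0\<bar> \<le> \<delta> * n"
    using window_stability[of \<alpha> A \<delta> k, OF \<alpha> _ \<delta>] A1 by (auto; metis)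
  \<comment> \<open>The error in the recursion is at most \<open>6 \<epsilon> n\<close> plus a constant; see \<open>window_typical\<close>.\<close>
  define \<epsilon> where "\<epsilon> = min 1 (\<epsilon>' / 7)"
  have \<epsilon>: "0 < \<epsilon>" "\<epsilon> \<le> 1" "7 * \<epsilon> \<le> \<epsilon>'" using \<epsilon>' by (auto simp: \<epsilon>_def)
  \<comment> \<open>\<open>Q n\<^sup>2\<close> bounds all positions; it is at most \<open>n\<^sup>3\<close> for large \<open>n\<close>.\<close>
  define Q where "Q = B * (u + 4) + 1 + u + 2 * real L"
  define C where "C = 4 * B * (4 + u)"
  define am where "am = Max (\<alpha> ` {..L})"
  have am: "\<alpha> l \<le> am" if "l \<le> L" for l using that by (simp add: am_def)
  define n0 where "n0 = nat \<lceil>max Q ((4 * am + 2) / \<epsilon>)\<rceil>"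
  have n0: "Q \<le> real n" "4 * am + 2 \<le> \<epsilon> * real n" if "n0 \<le> n" for n
  proof -
    have "max Q ((4 * am + 2) / \<epsilon>) \<le> real n" using that unfolding n0_def by linarith
    hence "Q \<le> real n" "(4 * am + 2) / \<epsilon> \<le> real n" by auto
    thus "Q \<le> real n" "4 * am + 2 \<le> \<epsilon> * real n" using \<epsilon>(1) by (auto simp: field_simps)
  qed
  have main: "\<bar>real_of_int (Y_disp (Suc k) i (c 0) (n\<^sup>2) - Y_disp (Suc k) j (c 0) (n\<^sup>2))\<bar> \<le> C * (real M + (real n)\<^sup>2) \<and>
      (n0 \<le> n \<longrightarrow> M \<le> n \<longrightarrow>
        \<bar>real_of_int (Y_disp (Suc k) i (c 0) (n\<^sup>2) - Y_disp (Suc k) j (c 0) (n\<^sup>2))\<bar> \<le> \<delta> * real n)"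
    if tow: "anchored_tower c s" and M1: "1 \<le> M"
      and ty: "\<And>m. M \<le> m \<Longrightarrow> typical A L \<epsilon> \<alpha> k \<beta> (\<lambda>l. gap_pairs (s l)) m"
      and n1: "1 \<le> n" and i: "real_of_int \<bar>i\<bar> \<le> U * real n" and j: "real_of_int \<bar>j\<bar> \<le> U * real n" for c s M n i j
  proof -
    interpret anchored_tower c s using tow .
    have occ: "\<beta> * real m \<le> real (card {i\<in>{a..<a + int m}. 0 < gap_pairs (s k) i})"
      if "M \<le> m" "a \<in> {0, - int m}" for m a using ty[OF that(1)] that(2) by (auto simp: typical_def)
    obtain Jn where Jn: "enumerates Jn {J. 0 < gap_pairs (s k) J}" "Jn 0 < 0" "0 \<le> Jn 1"
      and Jb: "\<And>i. real_of_int \<bar>Jn i\<bar> \<le> real M + (real_of_int \<bar>i\<bar> + 1) / \<beta>"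
      using occupied_slots[of \<beta> M "gap_pairs (s k)", OF \<beta> occ] by blast
    have Jocc: "0 < gap_pairs (s k) (Jn i)" for i using Jn(1) by (auto simp: enumerates_def)
    have sums: "real_of_int (\<Sum>i\<in>{a..<a + int m}. gap_pairs (s l) i) \<le> \<gamma> * real m"
      if "l \<le> k" "M \<le> m" "a \<in> {0, - int m}" for l m a
    proof -
      have m1: "1 \<le> m" using that M1 by simp
      have "int m * 1 \<le> int m * (int m * int m)"
      proof (intro mult_left_mono)
        have "1 * 1 \<le> int m * int m" using m1 by (intro mult_mono) auto
        thus "1 \<le> int m * int m" by simp
      qed simp
      hence "\<bar>a\<bar> \<le> int m ^ 3" using that(3) by (auto simp: power3_eq_cube algebra_simps)
      moreover have "real m \<le> A * real m" using A1 mult_right_mono[of 1 A "real m"] by simp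
      ultimately have "\<bar>real_of_int (\<Sum>i\<in>{a..<a + int m}. gap_pairs (s l) i) - \<alpha> l * real_of_int (a + int m - a)\<bar> \<le> \<epsilon> * real m"
        using L that(1) by (intro typical_window[OF ty[OF that(2)]]) auto
      hence "real_of_int (\<Sum>i\<in>{a..<a + int m}. gap_pairs (s l) i) \<le> \<alpha> l * real m + \<epsilon> * real m" by (simp add: abs_le_iff)
      also have "\<dots> \<le> \<alpha> l * real m + 1 * real m" using \<epsilon>(2) by (intro add_mono mult_right_mono) auto
      also have "\<dots> = (\<alpha> l + 1) * real m" by (simp add: algebra_simps)
      also have "\<dots> \<le> \<gamma> * real m" using \<gamma>[OF that(1)] by (intro mult_right_mono) auto
      finally show ?thesis .
    qed
    define N where "N = n\<^sup>2"
    have "n \<le> N" unfolding N_def power2_eq_square by (rule le_square)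
    hence nN: "real n \<le> real N" "1 \<le> real N" "real N = (real n)\<^sup>2"
      using n1 by (simp_all add: N_def)
    have Jle: "real_of_int \<bar>Jn i\<bar> \<le> real M + u * real n" if "real_of_int \<bar>i\<bar> \<le> U * real n" for i
    proof -
      have "(real_of_int \<bar>i\<bar> + 1) / \<beta> \<le> (U * real n + real n) / \<beta>" using that n1 \<beta> by (intro divide_right_mono) auto
      also have "\<dots> = u * real n" by (simp add: u_def algebra_simps)
      finally show ?thesis using Jb[of i] by simp
    qed
    have low: "real_of_int \<bar>position (move c s t) k J l\<bar> \<le> B * (real_of_int \<bar>J\<bar> + real M + real N + 1)"
      if "l \<le> Suc k" "t \<le> N" for l t J
    proof -
      have "real_of_int \<bar>position (move c s t) k J (Suc k - (Suc k - l))\<bar>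
          \<le> (2 * (2 + 2 * \<gamma>)) ^ (Suc k - l) * (real_of_int \<bar>J\<bar> + real M + real t + 1)"
        using \<gamma>1 by (intro position_bound_low[OF sums]) auto
      also have "\<dots> \<le> B * (real_of_int \<bar>J\<bar> + real M + real N + 1)"
        unfolding B_def using \<gamma>1 that(2) by (intro mult_mono power_increasing) auto
      finally show ?thesis using that by simp
    qed
    have Xp: "X_pos (Suc k) i (c 0) t = position (move c s t) k (Jn i) 0 - 1" for i t
      using X_pos_tower[OF tower sloped record_0 anchor Jn] by (simp add: position_simps)
    have Yd: "Y_disp (Suc k) i (c 0) N - Y_disp (Suc k) j (c 0) N =
        (position (move c s N) k (Jn i) 0 - position (move c s N) k (Jn j) 0) -
        (position (move c s 0) k (Jn i) 0 - position (move c s 0) k (Jn j) 0)" for i j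
      unfolding Y_disp_def Xp by simp
    have crude: "\<bar>real_of_int (Y_disp (Suc k) i (c 0) N - Y_disp (Suc k) j (c 0) N)\<bar> \<le> C * (real M + (real n)\<^sup>2)"
    proof -
      have b: "real_of_int \<bar>position (move c s t) k (Jn i) 0\<bar> \<le> B * ((4 + u) * (real M + (real n)\<^sup>2))"
        if "real_of_int \<bar>i\<bar> \<le> U * real n" "t \<le> N" for i t
      proof -
        have "real_of_int \<bar>Jn i\<bar> + real M + real N + 1 \<le> (real M + u * real n) + real M + real N + 1"
          using Jle[OF that(1)] by simp
        also have "\<dots> \<le> (real M + u * real N) + real M + real N + real N"
          using nN u0 mult_left_mono[OF nN(1) u0] by simp
        also have "\<dots> \<le> (4 + u) * (real M + real N)" using u0 mult_nonneg_nonneg[OF u0, of "real M"] by (simp add: algebra_simps)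
        finally have "B * (real_of_int \<bar>Jn i\<bar> + real M + real N + 1) \<le> B * ((4 + u) * (real M + real N))"
          using B1 by (intro mult_left_mono) auto
        thus ?thesis using low[of 0 t "Jn i"] that(2) nN(3) by simp
      qed
      show ?thesis unfolding Yd C_def using b[OF i, of N] b[OF i, of 0] b[OF j, of N] b[OF j, of 0] by simp
    qed
    have fine: "\<bar>real_of_int (Y_disp (Suc k) i (c 0) N - Y_disp (Suc k) j (c 0) N)\<bar> \<le> \<delta> * real n"
      if ij: "i \<le> j" and i: "real_of_int \<bar>i\<bar> \<le> U * real n" and j: "real_of_int \<bar>j\<bar> \<le> U * real n"
        and nn: "n0 \<le> n" and Mn: "M \<le> n" for i j
    proof -
      let ?J = "Jn i" and ?J' = "Jn j"
      have JJ: "?J \<le> ?J'" using Jn(1) ij by (simp add: enumerates_def strict_mono_less_eq)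
      have Jn1: "real_of_int \<bar>Jn l\<bar> \<le> (1 + u) * real n" if "real_of_int \<bar>l\<bar> \<le> U * real n" for l
        using Jle[OF that] Mn by (simp add: algebra_simps)
      have pos: "\<bar>position (move c s t) k (Jn m) l\<bar> \<le> int n ^ 3"
        if "real_of_int \<bar>m\<bar> \<le> U * real n" "l \<le> L" "t \<le> N" for m l t
      proof -
        have Jm: "real_of_int \<bar>Jn m\<bar> \<le> (1 + u) * real N"
        proof -
          have "(1 + u) * real n \<le> (1 + u) * real N" using nN(1) u0 by (intro mult_left_mono) auto
          thus ?thesis using Jn1[OF that(1)] by linarith
        qed
        have "real_of_int \<bar>position (move c s t) k (Jn m) l\<bar> \<le> Q * real N"
        proof (cases "l \<le> Suc k")
          case True
          have "B * (real_of_int \<bar>Jn m\<bar> + real M + real N + 1) \<le> B * ((1 + u) * real N + real N + real N + real N)"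
            using B1 Jm Mn nN by (intro mult_left_mono add_mono) auto
          also have "\<dots> = B * (u + 4) * real N" by (simp add: algebra_simps)
          also have "\<dots> \<le> Q * real N" unfolding Q_def using u0 by (intro mult_right_mono) auto
          finally show ?thesis using low[OF True that(3), of "Jn m"] by simp
        next
          case False
          define d where "d = l - Suc k"
          have d: "l = Suc k + d" "d \<le> L" using False that(2) by (auto simp: d_def)
          have "real_of_int \<bar>position (move c s t) k (Jn m) l\<bar> \<le> real_of_int (\<bar>Jn m\<bar> + int d * (int t + 1))"
            using position_bound_high[of t k "Jn m" d] unfolding d(1) of_int_le_iff .
          also have "\<dots> = real_of_int \<bar>Jn m\<bar> + real d * (real t + 1)" by simp
          also have "\<dots> \<le> (1 + u) * real N + real L * (real N + real N)"
            using Jm d(2) that(3) nN(2) by (intro add_mono mult_mono) auto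
          also have "\<dots> = (1 + u + 2 * real L) * real N" by (simp add: algebra_simps)
          also have "\<dots> \<le> Q * real N" unfolding Q_def using u0 B1 by (intro mult_right_mono) auto
          finally show ?thesis .
        qed
        also have "\<dots> \<le> real n * real N" using n0(1)[OF nn] by (intro mult_right_mono) auto
        also have "\<dots> = real_of_int (int n ^ 3)" by (simp add: nN(3) power2_eq_square power3_eq_cube)
        finally show ?thesis by (simp only: of_int_le_iff)
      qed
      have top: "real_of_int (?J' - ?J) \<le> Aq 0 * real n"
        using Jn1[OF i] Jn1[OF j] unfolding Aq0 by (simp add: algebra_simps)
      have An: "1 \<le> A * real n" using A1 n1 mult_mono[of 1 A 1 "real n"] by simp
      have kL: "k < L" using L by simp
      define W where "W t l = real_of_int (position (move c s t) k ?J' l - position (move c s t) k ?J l)" for t l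
      note WT = window_typical[where ?A = A and ?L = L and ?\<epsilon> = \<epsilon> and ?\<alpha> = \<alpha> and ?k = k and ?\<beta> = \<beta> and ?n = n
          and ?J = ?J and ?J' = ?J' and ?Aq = Aq, OF ty[OF Mn] JJ Jocc Jocc pos[OF i] pos[OF j] top Aqstep AqA kL \<epsilon>(2) An \<alpha>]
      have props: "(\<forall>l. 0 \<le> W t l) \<and> (\<forall>l. W t (Suc l) \<le> W t l) \<and> W t 0 \<le> A * real n \<and>
          (\<forall>l<L. \<bar>W t l - (2 + 2 * \<alpha> l) * W t (Suc l) + W t (Suc (Suc l))\<bar> \<le> \<epsilon>' * real n)" if t: "t \<le> N" for t
      proof -
        have "\<bar>W t l - (2 + 2 * \<alpha> l) * W t (Suc l) + W t (Suc (Suc l))\<bar> \<le> \<epsilon>' * real n" if l: "l < L" for l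
        proof -
          have "\<bar>W t l - (2 + 2 * \<alpha> l) * W t (Suc l) + W t (Suc (Suc l))\<bar> \<le> 6 * \<epsilon> * real n + 4 * \<alpha> l + 2"
            using WT(4)[of t l] t l unfolding W_def by blast
          also have "\<dots> \<le> 7 * \<epsilon> * real n" using am[of l] l n0(2)[OF nn] by simp
          also have "\<dots> \<le> \<epsilon>' * real n" using \<epsilon>(3) by (intro mult_right_mono) auto
          finally show ?thesis .
        qed
        thus ?thesis using WT(1-3)[of t] t unfolding W_def by blast
      qed
      have eq: "W N (Suc k) = W 0 (Suc k)" by (simp add: W_def position_simps)
      have "\<bar>W N 0 - W 0 0\<bar> \<le> \<delta> * real n"
        using props[of N] props[of 0] eq by (intro stab) auto
      thus ?thesis unfolding Yd W_def by simp
    qed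
    have "\<bar>real_of_int (Y_disp (Suc k) i (c 0) N - Y_disp (Suc k) j (c 0) N)\<bar> \<le> \<delta> * real n"
      if "n0 \<le> n" "M \<le> n"
    proof (cases "i \<le> j")
      case False
      thus ?thesis using fine[of j i, OF _ j i that] by simp
    qed (use fine[of i j, OF _ i j that] in blast)
    thus ?thesis using crude unfolding N_def by blast
  qed
  have C0: "0 \<le> C" using B1 u0 by (simp add: C_def)
  show ?thesis
    by (intro exI[of _ A] exI[of _ L] exI[of _ \<epsilon>] exI[of _ n0] exI[of _ C] conjI A1 \<epsilon>(1) C0 allI impI)
      (use main in blast)+
qed

section \<open>Large deviations for sums of independent variables\<close>

text \<open>Compare the slopes at \<open>0\<close> of the moment generating function and of the exponentials.\<close>

lemma mgf_near_zero:
  fixes \<phi> :: "real \<Rightarrow> real"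
  assumes \<phi>: "DERIV \<phi> 0 :> \<mu>" "\<phi> 0 = 1" and c: "0 < c" and \<theta>0: "0 < \<theta>0"
  shows "\<exists>\<theta>>0. \<theta> < \<theta>0 \<and> \<phi> \<theta> \<le> exp (\<theta> * (\<mu> + c)) \<and> \<phi> (- \<theta>) \<le> exp (- \<theta> * (\<mu> - c))"
proof -
  have "DERIV (\<lambda>\<theta>. \<phi> \<theta> - exp (\<theta> * (\<mu> + c))) 0 :> \<mu> - (\<mu> + c)"
    by (rule derivative_eq_intros \<phi> refl)+ simp
  from DERIV_neg_dec_right[OF this] obtain d1 where d1: "0 < d1" "\<And>h. 0 < h \<Longrightarrow> h < d1 \<Longrightarrow>
      \<phi> (0 + h) - exp ((0 + h) * (\<mu> + c)) < \<phi> 0 - exp (0 * (\<mu> + c))" using c by auto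
  have "DERIV (\<lambda>\<theta>. \<phi> \<theta> - exp (\<theta> * (\<mu> - c))) 0 :> \<mu> - (\<mu> - c)"
    by (rule derivative_eq_intros \<phi> refl)+ simp
  from DERIV_pos_inc_left[OF this] obtain d2 where d2: "0 < d2" "\<And>h. 0 < h \<Longrightarrow> h < d2 \<Longrightarrow>
      \<phi> (0 - h) - exp ((0 - h) * (\<mu> - c)) < \<phi> 0 - exp (0 * (\<mu> - c))" using c by auto
  define \<theta> where "\<theta> = min (min d1 d2) \<theta>0 / 2"
  have "0 < \<theta>" "\<theta> < d1" "\<theta> < d2" "\<theta> < \<theta>0" using d1 d2 \<theta>0 by (auto simp: \<theta>_def min_def)
  thus ?thesis using d1(2)[of \<theta>] d2(2)[of \<theta>] \<phi>(2) by (intro exI[of _ \<theta>]) auto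
qed

context prob_space begin

lemma exponential_bound:
  fixes X :: "'i \<Rightarrow> 'a \<Rightarrow> real"
  assumes ind: "indep_vars (\<lambda>_. borel) X I" and fin: "finite I" and \<theta>: "0 < \<theta>"
    and mgf: "\<And>i. i \<in> I \<Longrightarrow> (\<integral>\<^sup>+x. ennreal (exp (\<theta> * X i x)) \<partial>M) = ennreal F" and F: "0 \<le> F"
  shows "prob {x \<in> space M. a \<le> (\<Sum>i\<in>I. X i x)} \<le> exp (- \<theta> * a) * F ^ card I"
proof -
  have [measurable]: "\<And>i. i \<in> I \<Longrightarrow> X i \<in> borel_measurable M" using ind by (simp add: indep_vars_def2)
  have "indep_vars (\<lambda>_. borel) (\<lambda>i x. ennreal (exp (\<theta> * X i x))) I"
    by (rule indep_vars_compose2[OF ind]) measurable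
  from indep_vars_nn_integral[OF fin this]
  have "(\<integral>\<^sup>+x. (\<Prod>i\<in>I. ennreal (exp (\<theta> * X i x))) \<partial>M) = (\<Prod>i\<in>I. ennreal F)" using mgf by simp
  also have "\<dots> = ennreal (F ^ card I)" using F by (simp add: ennreal_power)
  also have "(\<lambda>x. \<Prod>i\<in>I. ennreal (exp (\<theta> * X i x))) = (\<lambda>x. ennreal (exp (\<theta> * (\<Sum>i\<in>I. X i x))))"
    using fin by (simp add: prod_ennreal exp_sum sum_distrib_left)
  finally have E: "(\<integral>\<^sup>+x. ennreal (exp (\<theta> * (\<Sum>i\<in>I. X i x))) \<partial>M) = ennreal (F ^ card I)" .
  have "emeasure M {x \<in> space M. a \<le> (\<Sum>i\<in>I. X i x)} \<le>
      ennreal (exp (- \<theta> * a)) * (\<integral>\<^sup>+x. ennreal (exp (\<theta> * (\<Sum>i\<in>I. X i x))) * indicator (space M) x \<partial>M)"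
    by (rule Chernoff_ineq_nn_integral_ge[OF \<theta>]) simp_all
  also have "(\<integral>\<^sup>+x. ennreal (exp (\<theta> * (\<Sum>i\<in>I. X i x))) * indicator (space M) x \<partial>M) = ennreal (F ^ card I)"
    unfolding E[symmetric] by (intro nn_integral_cong) simp
  also have "ennreal (exp (- \<theta> * a)) * ennreal (F ^ card I) = ennreal (exp (- \<theta> * a) * F ^ card I)"
    using F by (simp add: ennreal_mult)
  finally show ?thesis using F by (simp add: emeasure_eq_measure)
qed

text \<open>The exponential Chebyshev inequality on both sides, with the exponent of \<open>mgf_near_zero\<close> for
  \<open>c = \<epsilon> / (2 A)\<close>: half of the gain \<open>\<epsilon> m\<close> pays for at most \<open>A m\<close> summands.\<close>

lemma large_deviation:
  fixes X :: "'i \<Rightarrow> 'a \<Rightarrow> real"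
  assumes ind: "indep_vars (\<lambda>_. borel) X S" and \<theta>0: "0 < \<theta>0"
    and mgf: "\<And>\<theta> i. \<bar>\<theta>\<bar> < \<theta>0 \<Longrightarrow> i \<in> S \<Longrightarrow> (\<integral>\<^sup>+x. ennreal (exp (\<theta> * X i x)) \<partial>M) = ennreal (\<phi> \<theta>)"
    and nonneg: "\<And>\<theta>. \<bar>\<theta>\<bar> < \<theta>0 \<Longrightarrow> 0 \<le> \<phi> \<theta>"
    and \<phi>: "DERIV \<phi> 0 :> \<mu>" "\<phi> 0 = 1" and A: "0 < A" and \<epsilon>: "0 < \<epsilon>"
  shows "\<exists>\<kappa>>0. \<forall>(m::nat) I. I \<subseteq> S \<longrightarrow> finite I \<longrightarrow> real (card I) \<le> A * real m \<longrightarrow>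
    prob {x \<in> space M. \<epsilon> * real m \<le> \<bar>(\<Sum>i\<in>I. X i x) - \<mu> * real (card I)\<bar>} \<le> 2 * exp (- \<kappa> * real m)"
proof -
  define c where "c = \<epsilon> / (2 * A)"
  have c: "0 < c" using A \<epsilon> by (simp add: c_def)
  obtain \<theta> where \<theta>: "0 < \<theta>" "\<theta> < \<theta>0" "\<phi> \<theta> \<le> exp (\<theta> * (\<mu> + c))" "\<phi> (- \<theta>) \<le> exp (- \<theta> * (\<mu> - c))"
    using mgf_near_zero[OF \<phi> c \<theta>0] by blast
  define \<kappa> where "\<kappa> = \<theta> * \<epsilon> / 2"
  have \<kappa>: "0 < \<kappa>" using \<theta> \<epsilon> by (simp add: \<kappa>_def)
  have main: "prob {x \<in> space M. \<epsilon> * real m \<le> \<bar>(\<Sum>i\<in>I. X i x) - \<mu> * real (card I)\<bar>} \<le> 2 * exp (- \<kappa> * real m)"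
    if I: "I \<subseteq> S" "finite I" "real (card I) \<le> A * real m" for m :: nat and I
  proof -
    define w where "w = real (card I)"
    have indI: "indep_vars (\<lambda>_. borel) X I" using indep_vars_subset[OF ind I(1)] .
    have [measurable]: "\<And>i. i \<in> I \<Longrightarrow> X i \<in> borel_measurable M" using indI by (simp add: indep_vars_def2)
    have indN: "indep_vars (\<lambda>_. borel) (\<lambda>i x. - X i x) I" by (rule indep_vars_compose2[OF indI]) measurable
    have wc: "\<theta> * (w * c) \<le> \<kappa> * real m"
    proof -
      have "w * c \<le> A * real m * c" using I(3) c by (intro mult_right_mono) (auto simp: w_def)
      also have "\<dots> = \<epsilon> * real m / 2" using A by (simp add: c_def field_simps)
      finally have "\<theta> * (w * c) \<le> \<theta> * (\<epsilon> * real m / 2)" using \<theta> by (intro mult_left_mono) auto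
      thus ?thesis by (simp add: \<kappa>_def)
    qed
    have k2: "\<theta> * (\<epsilon> * real m) = 2 * (\<kappa> * real m)" by (simp add: \<kappa>_def)
    have up: "prob {x \<in> space M. \<mu> * w + \<epsilon> * real m \<le> (\<Sum>i\<in>I. X i x)} \<le> exp (- \<kappa> * real m)"
    proof -
      have "prob {x \<in> space M. \<mu> * w + \<epsilon> * real m \<le> (\<Sum>i\<in>I. X i x)}
          \<le> exp (- \<theta> * (\<mu> * w + \<epsilon> * real m)) * \<phi> \<theta> ^ card I"
        using mgf[of \<theta>] \<theta> I(1) nonneg[of \<theta>] by (intro exponential_bound[OF indI I(2)]) auto
      also have "\<dots> \<le> exp (- \<theta> * (\<mu> * w + \<epsilon> * real m)) * exp (\<theta> * (\<mu> + c)) ^ card I"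
        using \<theta> nonneg[of \<theta>] by (intro mult_left_mono power_mono) auto
      also have "exp (\<theta> * (\<mu> + c)) ^ card I = exp (w * (\<theta> * (\<mu> + c)))" unfolding w_def by (rule exp_of_nat_mult[symmetric])
      also have "exp (- \<theta> * (\<mu> * w + \<epsilon> * real m)) * exp (w * (\<theta> * (\<mu> + c))) = exp (\<theta> * (w * c) - \<theta> * (\<epsilon> * real m))"
        by (simp add: exp_add[symmetric] algebra_simps)
      also have "\<dots> \<le> exp (- \<kappa> * real m)"
      proof -
        have "\<theta> * (w * c) - \<theta> * (\<epsilon> * real m) \<le> - (\<kappa> * real m)" using wc k2 by linarith
        thus ?thesis by simp
      qed
      finally show ?thesis .
    qed
    have dn: "prob {x \<in> space M. - \<mu> * w + \<epsilon> * real m \<le> (\<Sum>i\<in>I. - X i x)} \<le> exp (- \<kappa> * real m)"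
    proof -
      have "prob {x \<in> space M. - \<mu> * w + \<epsilon> * real m \<le> (\<Sum>i\<in>I. - X i x)}
          \<le> exp (- \<theta> * (- \<mu> * w + \<epsilon> * real m)) * \<phi> (- \<theta>) ^ card I"
        using mgf[of "- \<theta>"] \<theta> I(1) nonneg[of "- \<theta>"] by (intro exponential_bound[OF indN I(2)]) auto
      also have "\<dots> \<le> exp (- \<theta> * (- \<mu> * w + \<epsilon> * real m)) * exp (- \<theta> * (\<mu> - c)) ^ card I"
        using \<theta> nonneg[of "- \<theta>"] by (intro mult_left_mono power_mono) auto
      also have "exp (- \<theta> * (\<mu> - c)) ^ card I = exp (w * (- \<theta> * (\<mu> - c)))" unfolding w_def by (rule exp_of_nat_mult[symmetric])
      also have "exp (- \<theta> * (- \<mu> * w + \<epsilon> * real m)) * exp (w * (- \<theta> * (\<mu> - c))) = exp (\<theta> * (w * c) - \<theta> * (\<epsilon> * real m))"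
        by (simp add: exp_add[symmetric] algebra_simps)
      also have "\<dots> \<le> exp (- \<kappa> * real m)"
      proof -
        have "\<theta> * (w * c) - \<theta> * (\<epsilon> * real m) \<le> - (\<kappa> * real m)" using wc k2 by linarith
        thus ?thesis by simp
      qed
      finally show ?thesis .
    qed
    have "{x \<in> space M. \<epsilon> * real m \<le> \<bar>(\<Sum>i\<in>I. X i x) - \<mu> * real (card I)\<bar>} \<subseteq>
        {x \<in> space M. \<mu> * w + \<epsilon> * real m \<le> (\<Sum>i\<in>I. X i x)} \<union>
        {x \<in> space M. - \<mu> * w + \<epsilon> * real m \<le> (\<Sum>i\<in>I. - X i x)}"
      by (auto simp: w_def sum_negf abs_if split: if_splits)
    hence "prob {x \<in> space M. \<epsilon> * real m \<le> \<bar>(\<Sum>i\<in>I. X i x) - \<mu> * real (card I)\<bar>} \<le>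
        prob ({x \<in> space M. \<mu> * w + \<epsilon> * real m \<le> (\<Sum>i\<in>I. X i x)} \<union>
        {x \<in> space M. - \<mu> * w + \<epsilon> * real m \<le> (\<Sum>i\<in>I. - X i x)})" by (intro finite_measure_mono) auto
    also have "\<dots> \<le> prob {x \<in> space M. \<mu> * w + \<epsilon> * real m \<le> (\<Sum>i\<in>I. X i x)} +
        prob {x \<in> space M. - \<mu> * w + \<epsilon> * real m \<le> (\<Sum>i\<in>I. - X i x)}" by (intro measure_Un_le) auto
    finally show ?thesis using up dn by simp
  qed
  show ?thesis using \<kappa> main by blast
qed

end

section \<open>The law of the soliton counts\<close>

lemma sum_fibre: "(\<Sum>p\<in>{k} \<times> I. f (fst p) (snd p)) = (\<Sum>i\<in>I. f k i)"
proof -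
  have "{k} \<times> I = Pair k ` I" by auto
  thus ?thesis by (simp add: sum.reindex inj_on_def)
qed

locale soliton_measure =
  fixes q :: "nat \<Rightarrow> real" and \<nu> :: "config measure"
  assumes q: "q \<in> q_params" and nu: "is_nu q \<nu>"

sublocale soliton_measure \<subseteq> prob_space \<nu>
  using nu by (simp add: is_nu_def)

context soliton_measure begin

lemma q_range: "1 \<le> k \<Longrightarrow> 0 \<le> q k \<and> q k < 1"
  using q by (simp add: q_params_def)

lemma space_nu: "space \<nu> = Omega0"
proof -
  have "space \<nu> = space (restrict_space (Pi\<^sub>M UNIV (\<lambda>_. count_space UNIV)) Omega0)"
    by (rule sets_eq_imp_space_eq) (use nu in \<open>simp add: is_nu_def\<close>)
  thus ?thesis by (simp add: space_restrict_space space_PiM)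
qed

lemma zeta_indep:
  assumes "1 \<le> k"
  shows "indep_vars (\<lambda>_. borel) (\<lambda>p \<eta>. (f (zeta (fst p) \<eta> (snd p)) :: real)) ({k} \<times> UNIV)"
proof -
  have "indep_vars (\<lambda>_. count_space UNIV) (\<lambda>(k, i) \<eta>. zeta k \<eta> i) ({1..} \<times> UNIV)"
    using nu by (simp add: is_nu_def)
  hence "indep_vars (\<lambda>_. count_space UNIV) (\<lambda>(k, i) \<eta>. zeta k \<eta> i) ({k} \<times> UNIV)"
    by (rule indep_vars_subset) (use assms in auto)
  from indep_vars_compose2[OF this, of "\<lambda>_. f" "\<lambda>_. borel"] show ?thesis by (simp add: case_prod_beta)
qed

lemma zeta_measurable [measurable]:
  assumes "1 \<le> k"
  shows "(\<lambda>\<eta>. zeta k \<eta> i) \<in> measurable \<nu> (count_space UNIV)"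
proof -
  have "indep_vars (\<lambda>_. count_space UNIV) (\<lambda>(k, i) \<eta>. zeta k \<eta> i) ({1..} \<times> UNIV)"
    using nu by (simp add: is_nu_def)
  hence "(case (k, i) of (k, i) \<Rightarrow> (\<lambda>\<eta>. zeta k \<eta> i)) \<in> measurable \<nu> (count_space UNIV)"
    unfolding indep_vars_def2 using assms by fastforce
  thus ?thesis by simp
qed

lemma zeta_law:
  assumes "1 \<le> k"
  shows "prob {\<eta> \<in> space \<nu>. zeta k \<eta> i = int m} = q k ^ m * (1 - q k)"
  using nu assms by (simp add: is_nu_def)

text \<open>Integrals of functions of one soliton count are series against the geometric law.\<close>

lemma zeta_integral:
  assumes k: "1 \<le> k" and g: "\<And>x. 0 \<le> g x" and sums: "(\<lambda>m. g (int m) * (q k ^ m * (1 - q k))) sums s"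
  shows "(\<integral>\<^sup>+\<eta>. ennreal (g (zeta k \<eta> i)) \<partial>\<nu>) = ennreal s"
proof -
  let ?E = "\<lambda>m. {\<eta> \<in> space \<nu>. zeta k \<eta> i = int m}"
  have [measurable]: "(\<lambda>\<eta>. zeta k \<eta> i) \<in> measurable \<nu> (count_space UNIV)" by (rule zeta_measurable[OF k])
  have E[measurable]: "?E m \<in> sets \<nu>" for m by measurable
  have q: "0 \<le> q k" "q k < 1" using q_range[OF k] by auto
  have dis: "disjoint_family ?E" by (auto simp: disjoint_family_on_def)
  have tot: "(\<lambda>m. prob (?E m)) sums 1"
  proof -
    have "(\<lambda>m. q k ^ m * (1 - q k)) sums (1 / (1 - q k) * (1 - q k))"
      using q by (intro sums_mult2 geometric_sums) auto
    thus ?thesis using q zeta_law[OF k] by simp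
  qed
  have "(\<lambda>m. prob (?E m)) sums prob (\<Union>m. ?E m)"
    by (rule finite_measure_UNION) (use E dis in auto)
  hence "prob (\<Union>m. ?E m) = 1" using tot sums_unique2 by blast
  hence AE: "AE \<eta> in \<nu>. \<eta> \<in> (\<Union>m. ?E m)" by (subst (asm) prob_eq_1) auto
  have "(\<integral>\<^sup>+\<eta>. ennreal (g (zeta k \<eta> i)) \<partial>\<nu>) =
      (\<integral>\<^sup>+\<eta>. (\<Sum>m. ennreal (g (int m)) * indicator (?E m) \<eta>) \<partial>\<nu>)"
  proof (rule nn_integral_cong_AE, use AE in eventually_elim)
    case (elim \<eta>)
    then obtain m where m: "\<eta> \<in> ?E m" by blast
    have "(\<Sum>l. ennreal (g (int l)) * indicator (?E l) \<eta>) = (\<Sum>l\<in>{m}. ennreal (g (int l)) * indicator (?E l) \<eta>)"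
      by (rule suminf_finite) (use m in \<open>auto simp: indicator_def\<close>)
    thus ?case using m by (simp add: indicator_def)
  qed
  also have "\<dots> = (\<Sum>m. ennreal (g (int m)) * emeasure \<nu> (?E m))"
    by (subst nn_integral_suminf) (auto simp: nn_integral_cmult)
  also have "\<dots> = (\<Sum>m. ennreal (g (int m) * (q k ^ m * (1 - q k))))"
    using g q by (simp add: emeasure_eq_measure zeta_law[OF k] ennreal_mult)
  also have "\<dots> = ennreal s"
  proof -
    have "(\<Sum>m. g (int m) * (q k ^ m * (1 - q k))) = s" using sums by (rule sums_unique[symmetric])
    moreover have "(\<Sum>m. ennreal (g (int m) * (q k ^ m * (1 - q k)))) = ennreal (\<Sum>m. g (int m) * (q k ^ m * (1 - q k)))"
      using g q sums by (intro suminf_ennreal2) (auto simp: sums_iff)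
    ultimately show ?thesis by simp
  qed
  finally show ?thesis .
qed

lemma count_deviation:
  assumes k: "1 \<le> k" and A: "0 < A" and \<epsilon>: "0 < \<epsilon>"
  shows "\<exists>\<kappa>>0. \<forall>(m::nat) I. finite I \<longrightarrow> real (card I) \<le> A * real m \<longrightarrow>
    prob {\<eta> \<in> space \<nu>. \<epsilon> * real m \<le> \<bar>(\<Sum>i\<in>I. real_of_int (zeta k \<eta> i)) - q k / (1 - q k) * real (card I)\<bar>}
      \<le> 2 * exp (- \<kappa> * real m)"
proof -
  have q: "0 \<le> q k" "q k < 1" using q_range[OF k] by auto
  define \<phi> where "\<phi> \<theta> = (1 - q k) / (1 - q k * exp \<theta>)" for \<theta> :: real
  obtain \<theta>0 where \<theta>0: "0 < \<theta>0" "\<And>\<theta>. \<theta> < \<theta>0 \<Longrightarrow> q k * exp \<theta> < 1"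
  proof (cases "q k = 0")
    case True
    thus ?thesis using that[of 1] by simp
  next
    case False
    have "q k * exp \<theta> < 1" if "\<theta> < - ln (q k)" for \<theta>
    proof -
      have "exp \<theta> < exp (- ln (q k))" using that by simp
      also have "\<dots> = 1 / q k" using False q by (simp add: exp_minus inverse_eq_divide)
      finally show ?thesis using False q by (simp add: field_simps)
    qed
    moreover have "0 < - ln (q k)" using False q by simp
    ultimately show ?thesis using that by blast
  qed
  have mgf: "(\<integral>\<^sup>+\<eta>. ennreal (exp (\<theta> * real_of_int (zeta k \<eta> i))) \<partial>\<nu>) = ennreal (\<phi> \<theta>) \<and> 0 \<le> \<phi> \<theta>"
    if "\<bar>\<theta>\<bar> < \<theta>0" for \<theta> i
  proof
    have l: "q k * exp \<theta> < 1" using \<theta>0(2) that by simp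
    have "(\<lambda>m. (q k * exp \<theta>) ^ m * (1 - q k)) sums (1 / (1 - q k * exp \<theta>) * (1 - q k))"
      using q l by (intro sums_mult2 geometric_sums) auto
    moreover have "(\<lambda>m. exp (\<theta> * real_of_int (int m)) * (q k ^ m * (1 - q k))) = (\<lambda>m. (q k * exp \<theta>) ^ m * (1 - q k))"
      by (auto simp: power_mult_distrib exp_of_nat2_mult algebra_simps)
    ultimately show "(\<integral>\<^sup>+\<eta>. ennreal (exp (\<theta> * real_of_int (zeta k \<eta> i))) \<partial>\<nu>) = ennreal (\<phi> \<theta>)"
      by (intro zeta_integral[OF k]) (auto simp: \<phi>_def)
    show "0 \<le> \<phi> \<theta>" using q l by (simp add: \<phi>_def)
  qed
  have "DERIV \<phi> 0 :> q k / (1 - q k)"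
    unfolding \<phi>_def using q by (auto intro!: derivative_eq_intros simp: divide_simps)
  note D = this
  have "\<exists>\<kappa>>0. \<forall>(m::nat) I. I \<subseteq> {k} \<times> UNIV \<longrightarrow> finite I \<longrightarrow> real (card I) \<le> A * real m \<longrightarrow>
      prob {\<eta> \<in> space \<nu>. \<epsilon> * real m \<le> \<bar>(\<Sum>p\<in>I. real_of_int (zeta (fst p) \<eta> (snd p))) - q k / (1 - q k) * real (card I)\<bar>}
      \<le> 2 * exp (- \<kappa> * real m)"
  proof (rule large_deviation[OF zeta_indep[OF k] \<theta>0(1) _ _ D _ A \<epsilon>])
    show "\<phi> 0 = 1" using q by (simp add: \<phi>_def)
    show "(\<integral>\<^sup>+\<eta>. ennreal (exp (\<theta> * real_of_int (zeta (fst p) \<eta> (snd p)))) \<partial>\<nu>) = ennreal (\<phi> \<theta>)"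
      if "\<bar>\<theta>\<bar> < \<theta>0" "p \<in> {k} \<times> UNIV" for \<theta> p using mgf[OF that(1)] that(2) by auto
    show "0 \<le> \<phi> \<theta>" if "\<bar>\<theta>\<bar> < \<theta>0" for \<theta> using mgf[OF that] by blast
  qed
  then obtain \<kappa> where \<kappa>: "0 < \<kappa>" and L: "\<And>m I. I \<subseteq> {k} \<times> UNIV \<Longrightarrow> finite I \<Longrightarrow> real (card I) \<le> A * real m \<Longrightarrow>
      prob {\<eta> \<in> space \<nu>. \<epsilon> * real m \<le> \<bar>(\<Sum>p\<in>I. real_of_int (zeta (fst p) \<eta> (snd p))) - q k / (1 - q k) * real (card I)\<bar>}
      \<le> 2 * exp (- \<kappa> * real m)" by blast
  show ?thesis
  proof (intro exI[of _ \<kappa>] conjI allI impI \<kappa>)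
    fix m :: nat and I :: "int set" assume "finite I" "real (card I) \<le> A * real m"
    moreover have "{k} \<times> I \<subseteq> {k} \<times> UNIV" by blast
    ultimately show "prob {\<eta> \<in> space \<nu>. \<epsilon> * real m \<le> \<bar>(\<Sum>i\<in>I. real_of_int (zeta k \<eta> i)) - q k / (1 - q k) * real (card I)\<bar>}
      \<le> 2 * exp (- \<kappa> * real m)"
      using L[of "{k} \<times> I" m] unfolding sum_fibre[of "\<lambda>k i. real_of_int (zeta k \<eta> i)" k I for \<eta>]
      by simp
  qed
qed

lemma empty_deviation:
  assumes k: "1 \<le> k" and A: "0 < A" and \<epsilon>: "0 < \<epsilon>"
  shows "\<exists>\<kappa>>0. \<forall>(m::nat) I. finite I \<longrightarrow> real (card I) \<le> A * real m \<longrightarrow>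
    prob {\<eta> \<in> space \<nu>. \<epsilon> * real m \<le> \<bar>(\<Sum>i\<in>I. of_bool (zeta k \<eta> i = 0)) - (1 - q k) * real (card I)\<bar>}
      \<le> 2 * exp (- \<kappa> * real m)"
proof -
  have q: "0 \<le> q k" "q k < 1" using q_range[OF k] by auto
  define \<phi> where "\<phi> \<theta> = (exp \<theta> - 1) * (1 - q k) + 1" for \<theta> :: real
  have mgf: "(\<integral>\<^sup>+\<eta>. ennreal (exp (\<theta> * of_bool (zeta k \<eta> i = 0))) \<partial>\<nu>) = ennreal (\<phi> \<theta>) \<and> 0 \<le> \<phi> \<theta>" for \<theta> i
  proof
    have "(\<lambda>m. q k ^ m * (1 - q k)) sums (1 / (1 - q k) * (1 - q k))"
      using q by (intro sums_mult2 geometric_sums) auto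
    moreover have "(\<lambda>m. if m = 0 then (exp \<theta> - 1) * (1 - q k) else 0) sums ((exp \<theta> - 1) * (1 - q k))"
      by (rule sums_single)
    ultimately have "(\<lambda>m. (if m = 0 then (exp \<theta> - 1) * (1 - q k) else 0) + q k ^ m * (1 - q k)) sums
        ((exp \<theta> - 1) * (1 - q k) + 1 / (1 - q k) * (1 - q k))" by (rule sums_add[rotated])
    moreover have "(\<lambda>m. exp (\<theta> * of_bool (int m = 0)) * (q k ^ m * (1 - q k))) =
        (\<lambda>m. (if m = 0 then (exp \<theta> - 1) * (1 - q k) else 0) + q k ^ m * (1 - q k))"
      by (auto simp: algebra_simps)
    ultimately show "(\<integral>\<^sup>+\<eta>. ennreal (exp (\<theta> * of_bool (zeta k \<eta> i = 0))) \<partial>\<nu>) = ennreal (\<phi> \<theta>)"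
      using q by (intro zeta_integral[OF k, where g = "\<lambda>z. exp (\<theta> * of_bool (z = 0))"]) (auto simp: \<phi>_def)
    have "\<phi> \<theta> = exp \<theta> * (1 - q k) + q k" by (simp add: \<phi>_def algebra_simps)
    thus "0 \<le> \<phi> \<theta>" using q by simp
  qed
  have "DERIV \<phi> 0 :> 1 - q k" unfolding \<phi>_def by (auto intro!: derivative_eq_intros)
  note D = this
  have "\<exists>\<kappa>>0. \<forall>(m::nat) I. I \<subseteq> {k} \<times> UNIV \<longrightarrow> finite I \<longrightarrow> real (card I) \<le> A * real m \<longrightarrow>
      prob {\<eta> \<in> space \<nu>. \<epsilon> * real m \<le> \<bar>(\<Sum>p\<in>I. of_bool (zeta (fst p) \<eta> (snd p) = 0)) - (1 - q k) * real (card I)\<bar>}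
      \<le> 2 * exp (- \<kappa> * real m)"
  proof (rule large_deviation[OF zeta_indep[OF k, of "\<lambda>z. of_bool (z = 0)"] zero_less_one _ _ D _ A \<epsilon>])
    show "\<phi> 0 = 1" by (simp add: \<phi>_def)
    show "(\<integral>\<^sup>+\<eta>. ennreal (exp (\<theta> * of_bool (zeta (fst p) \<eta> (snd p) = 0))) \<partial>\<nu>) = ennreal (\<phi> \<theta>)"
      if "p \<in> {k} \<times> UNIV" for \<theta> p using mgf that by auto
    show "0 \<le> \<phi> \<theta>" for \<theta> using mgf by blast
  qed
  then obtain \<kappa> where \<kappa>: "0 < \<kappa>" and L: "\<And>m I. I \<subseteq> {k} \<times> UNIV \<Longrightarrow> finite I \<Longrightarrow> real (card I) \<le> A * real m \<Longrightarrow>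
      prob {\<eta> \<in> space \<nu>. \<epsilon> * real m \<le> \<bar>(\<Sum>p\<in>I. of_bool (zeta (fst p) \<eta> (snd p) = 0)) - (1 - q k) * real (card I)\<bar>}
      \<le> 2 * exp (- \<kappa> * real m)" by blast
  show ?thesis
  proof (intro exI[of _ \<kappa>] conjI allI impI \<kappa>)
    fix m :: nat and I :: "int set" assume "finite I" "real (card I) \<le> A * real m"
    moreover have "{k} \<times> I \<subseteq> {k} \<times> UNIV" by blast
    ultimately show "prob {\<eta> \<in> space \<nu>. \<epsilon> * real m \<le> \<bar>(\<Sum>i\<in>I. of_bool (zeta k \<eta> i = 0)) - (1 - q k) * real (card I)\<bar>}
      \<le> 2 * exp (- \<kappa> * real m)"
      using L[of "{k} \<times> I" m] unfolding sum_fibre[of "\<lambda>k i. of_bool (zeta k \<eta> i = 0)" k I for \<eta>]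
      by simp
  qed
qed

end

section \<open>Atypical scales are rare\<close>

lemma Omega0_tower:
  assumes "\<eta> \<in> Omega0"
  shows "anchored_tower (contraction \<eta>) (levels \<eta>)" "zeta (Suc l) \<eta> i = gap_pairs (levels \<eta> l) i"
proof -
  have sl: "sloped \<eta>" using assms Omega_sloped by (simp add: Omega0_def)
  have rec: "recurrent \<eta>" using sloped_recurrent[OF sl] .
  have r0: "is_record \<eta> 0"
    using assms s_inf(2)[OF rec] last_record(1)[OF rec, of 0] by (simp add: Omega0_def)
  note t = tower_contraction[OF rec] and an = contraction_anchor(2)[OF rec r0]
  show "anchored_tower (contraction \<eta>) (levels \<eta>)"
    using t sl r0 an by unfold_locales simp_all
  show "zeta (Suc l) \<eta> i = gap_pairs (levels \<eta> l) i"
    using zeta_tower[OF t _ an, of l i] r0 by simp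
qed

lemma polynomial_exponential_summable:
  assumes "0 < \<kappa>"
  shows "summable (\<lambda>m. (real m + 1) ^ 8 * exp (- \<kappa> * real m))"
proof (rule summable_comparison_test)
  define D where "D = exp \<kappa> * (10 / \<kappa>) ^ 10"
  have "(real m + 1) ^ 8 * exp (- \<kappa> * real m) \<le> D * inverse (real (Suc m) ^ 2)" for m
  proof -
    define x where "x = real m + 1"
    have x: "0 < x" by (simp add: x_def)
    have "\<kappa> * x / 10 \<le> exp (\<kappa> * x / 10)" using exp_ge_add_one_self[of "\<kappa> * x / 10"] by linarith
    hence "(\<kappa> * x / 10) ^ 10 \<le> exp (\<kappa> * x / 10) ^ 10" using assms x by (intro power_mono) auto
    also have "\<dots> = exp (\<kappa> * x)" using exp_of_nat_mult[of 10 "\<kappa> * x / 10"] by simp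
    finally have e: "(\<kappa> * x / 10) ^ 10 \<le> exp (\<kappa> * x)" .
    have "x ^ 8 * exp (- \<kappa> * real m) = exp \<kappa> * (x ^ 8 / exp (\<kappa> * x))"
      by (simp add: x_def exp_minus exp_add algebra_simps divide_inverse)
    also have "\<dots> \<le> exp \<kappa> * (x ^ 8 / (\<kappa> * x / 10) ^ 10)"
      using e assms x by (intro mult_left_mono divide_left_mono) auto
    also have "x ^ 8 / (\<kappa> * x / 10) ^ 10 = (10 / \<kappa>) ^ 10 * inverse (x ^ 2)"
      using assms x by (simp add: power_mult_distrib power_divide field_simps flip: power_add)
    finally show ?thesis by (simp add: D_def x_def add.commute mult.assoc)
  qed
  thus "\<exists>N. \<forall>m\<ge>N. norm ((real m + 1) ^ 8 * exp (- \<kappa> * real m)) \<le> D * inverse (real (Suc m) ^ 2)"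
    by (intro exI[of _ 0]) auto
  have "summable (\<lambda>m. inverse (real m ^ 2))" using inverse_power_summable[of 2, where ?'a = real] by simp
  hence "summable (\<lambda>m. inverse (real (Suc m) ^ 2))" by (subst summable_Suc_iff)
  thus "summable (\<lambda>m. D * inverse (real (Suc m) ^ 2))" by (rule summable_mult)
qed

context soliton_measure begin

text \<open>A union bound over the polynomially many windows at scale \<open>m\<close>.\<close>

lemma atypical_rare:
  assumes A: "1 \<le> A" and \<epsilon>: "0 < \<epsilon>" and qk: "0 < q (Suc k)"
  shows "\<exists>B \<kappa> K. 0 < \<kappa> \<and> 0 \<le> K \<and> (\<forall>m. B m \<in> sets \<nu>) \<and>
    (\<forall>m. \<forall>\<eta>\<in>space \<nu> - B m. typical A L \<epsilon> (\<lambda>l. q (Suc l) / (1 - q (Suc l))) k (q (Suc k) / 2) (\<lambda>l. gap_pairs (levels \<eta> l)) m) \<and>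
    (\<forall>m. prob (B m) \<le> K * (real m + 1) ^ 4 * exp (- \<kappa> * real m))"
proof -
  define \<alpha> where "\<alpha> l = q (Suc l) / (1 - q (Suc l))" for l
  define E where "E m = (\<lambda>(l, a, w). {\<eta> \<in> space \<nu>. \<epsilon> * real m \<le>
      \<bar>(\<Sum>i\<in>{a..<a + int w}. real_of_int (zeta (Suc l) \<eta> i)) - \<alpha> l * real (card {a..<a + int w})\<bar>})" for m
  define F where "F m a = {\<eta> \<in> space \<nu>. q (Suc k) / 2 * real m \<le>
      \<bar>(\<Sum>i\<in>{a..<a + int m}. of_bool (zeta (Suc k) \<eta> i = 0)) - (1 - q (Suc k)) * real (card {a..<a + int m})\<bar>}" for m and a :: int
  have [measurable]: "(\<lambda>\<eta>. zeta (Suc l) \<eta> i) \<in> measurable \<nu> (count_space UNIV)" for l i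
    by (rule zeta_measurable) simp
  have Es: "E m p \<in> sets \<nu>" for m p unfolding E_def by (cases p) (simp, measurable)
  have Fs: "F m a \<in> sets \<nu>" for m a unfolding F_def by measurable
  have "\<forall>l. \<exists>\<kappa>>0. \<forall>(m::nat) I. finite I \<longrightarrow> real (card I) \<le> A * real m \<longrightarrow>
    prob {\<eta> \<in> space \<nu>. \<epsilon> * real m \<le> \<bar>(\<Sum>i\<in>I. real_of_int (zeta (Suc l) \<eta> i)) - \<alpha> l * real (card I)\<bar>}
      \<le> 2 * exp (- \<kappa> * real m)"
    unfolding \<alpha>_def by (intro allI count_deviation) (use A \<epsilon> in auto)
  then obtain \<kappa>1 where \<kappa>1: "\<And>l. 0 < \<kappa>1 l" "\<And>l m I. finite I \<Longrightarrow> real (card I) \<le> A * real m \<Longrightarrow>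
    prob {\<eta> \<in> space \<nu>. \<epsilon> * real m \<le> \<bar>(\<Sum>i\<in>I. real_of_int (zeta (Suc l) \<eta> i)) - \<alpha> l * real (card I)\<bar>}
      \<le> 2 * exp (- \<kappa>1 l * real m)" unfolding choice_iff by blast
  obtain \<kappa>2 where \<kappa>2: "0 < \<kappa>2" "\<And>m I. finite I \<Longrightarrow> real (card I) \<le> A * real m \<Longrightarrow>
    prob {\<eta> \<in> space \<nu>. q (Suc k) / 2 * real m \<le> \<bar>(\<Sum>i\<in>I. of_bool (zeta (Suc k) \<eta> i = 0)) - (1 - q (Suc k)) * real (card I)\<bar>}
      \<le> 2 * exp (- \<kappa>2 * real m)"
  proof -
    have "\<exists>\<kappa>>0. \<forall>(m::nat) I. finite I \<longrightarrow> real (card I) \<le> A * real m \<longrightarrow>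
      prob {\<eta> \<in> space \<nu>. q (Suc k) / 2 * real m \<le> \<bar>(\<Sum>i\<in>I. of_bool (zeta (Suc k) \<eta> i = 0)) - (1 - q (Suc k)) * real (card I)\<bar>}
      \<le> 2 * exp (- \<kappa> * real m)" by (rule empty_deviation) (use A qk in auto)
    thus ?thesis using that by blast
  qed
  define \<kappa> where "\<kappa> = min \<kappa>2 (Min (\<kappa>1 ` {..L}))"
  have \<kappa>: "0 < \<kappa>" "\<kappa> \<le> \<kappa>2" "\<And>l. l \<le> L \<Longrightarrow> \<kappa> \<le> \<kappa>1 l" using \<kappa>1(1) \<kappa>2(1) by (auto simp: \<kappa>_def min_le_iff_disj)
  define Idx where "Idx m = {..L} \<times> {- (int m ^ 3)..int m ^ 3} \<times> {..nat \<lfloor>A * real m\<rfloor>}" for m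
  define B where "B m = (\<Union>p\<in>Idx m. E m p) \<union> (\<Union>a\<in>{0, - int m}. F m a)" for m
  have fin: "finite (Idx m)" for m by (simp add: Idx_def)
  have Bs: "B m \<in> sets \<nu>" for m unfolding B_def using Es Fs fin by (intro sets.Un sets.finite_UN) auto
  have Ep: "prob (E m p) \<le> 2 * exp (- \<kappa> * real m)" if "p \<in> Idx m" for m p
  proof -
    obtain l a w where p: "p = (l, a, w)" by (cases p) auto
    have lw: "l \<le> L" "w \<le> nat \<lfloor>A * real m\<rfloor>" using that p by (auto simp: Idx_def)
    have "real w \<le> A * real m" using lw(2) A by (simp add: le_nat_iff le_floor_iff)
    hence "prob (E m p) \<le> 2 * exp (- \<kappa>1 l * real m)"
      using \<kappa>1(2)[of "{a..<a + int w}" m l] by (simp add: E_def p)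
    also have "\<dots> \<le> 2 * exp (- \<kappa> * real m)" using \<kappa>(3)[OF lw(1)] by (simp add: mult_right_mono)
    finally show ?thesis .
  qed
  have Fp: "prob (F m a) \<le> 2 * exp (- \<kappa> * real m)" for m a
  proof -
    have "real m \<le> A * real m" using A mult_right_mono[of 1 A "real m"] by simp
    hence "prob (F m a) \<le> 2 * exp (- \<kappa>2 * real m)" using \<kappa>2(2)[of "{a..<a + int m}" m] by (simp add: F_def)
    also have "\<dots> \<le> 2 * exp (- \<kappa> * real m)" using \<kappa>(2) by (simp add: mult_right_mono)
    finally show ?thesis .
  qed
  define K where "K = 4 * (real L + 1) * (A + 1) + 4"
  have Bp: "prob (B m) \<le> K * (real m + 1) ^ 4 * exp (- \<kappa> * real m)" for m
  proof -
    let ?x = "exp (- \<kappa> * real m)"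
    have "prob (\<Union>p\<in>Idx m. E m p) \<le> (\<Sum>p\<in>Idx m. prob (E m p))"
      using Es fin by (intro finite_measure_subadditive_finite) auto
    also have "\<dots> \<le> (\<Sum>p\<in>Idx m. 2 * ?x)" using Ep by (intro sum_mono)
    also have "\<dots> = real (card (Idx m)) * (2 * ?x)" by simp
    finally have u1: "prob (\<Union>p\<in>Idx m. E m p) \<le> real (card (Idx m)) * (2 * ?x)" .
    have "prob (\<Union>a\<in>{0, - int m}. F m a) \<le> (\<Sum>a\<in>{0, - int m}. prob (F m a))"
      using Fs by (intro finite_measure_subadditive_finite) auto
    also have "\<dots> \<le> (\<Sum>a\<in>{0, - int m}. 2 * ?x)" using Fp by (intro sum_mono)
    also have "\<dots> \<le> 4 * ?x" by (cases "m = 0") auto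
    finally have u2: "prob (\<Union>a\<in>{0, - int m}. F m a) \<le> 4 * ?x" .
    have "real (card (Idx m)) = (real L + 1) * (2 * real m ^ 3 + 1) * (real (nat \<lfloor>A * real m\<rfloor>) + 1)"
      by (simp add: Idx_def card_cartesian_product algebra_simps)
    also have "\<dots> \<le> (real L + 1) * (2 * (real m + 1) ^ 3) * ((A + 1) * (real m + 1))"
    proof (intro mult_mono)
      have "real m ^ 3 + 1 \<le> (real m + 1) ^ 3" by (simp add: power3_eq_cube algebra_simps)
      thus "2 * real m ^ 3 + 1 \<le> 2 * (real m + 1) ^ 3" by simp
      have "real (nat \<lfloor>A * real m\<rfloor>) \<le> A * real m" using A by simp
      moreover have "(A + 1) * (real m + 1) = A * real m + A + real m + 1" by (simp add: algebra_simps)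
      ultimately show "real (nat \<lfloor>A * real m\<rfloor>) + 1 \<le> (A + 1) * (real m + 1)" using A by linarith
    qed (use A in auto)
    also have "\<dots> = 2 * (real L + 1) * (A + 1) * (real m + 1) ^ 4" by (simp add: power4_eq_xxxx power3_eq_cube algebra_simps)
    finally have "real (card (Idx m)) * (2 * ?x) \<le> 2 * (real L + 1) * (A + 1) * (real m + 1) ^ 4 * (2 * ?x)"
      by (intro mult_right_mono) auto
    moreover have "4 * ?x \<le> 4 * (real m + 1) ^ 4 * ?x"
    proof -
      have "1 \<le> (real m + 1) ^ 4" by (rule one_le_power) simp
      thus ?thesis by (intro mult_right_mono) auto
    qed
    moreover have "prob (B m) \<le> prob (\<Union>p\<in>Idx m. E m p) + prob (\<Union>a\<in>{0, - int m}. F m a)"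
      unfolding B_def using Es Fs fin by (intro measure_Un_le sets.finite_UN) auto
    moreover have "K * (real m + 1) ^ 4 * ?x = 2 * (real L + 1) * (A + 1) * (real m + 1) ^ 4 * (2 * ?x) + 4 * (real m + 1) ^ 4 * ?x"
      unfolding K_def by (simp only: distrib_right mult.assoc mult.left_commute)
    ultimately show ?thesis using u1 u2 by linarith
  qed
  have typical_B: "typical A L \<epsilon> \<alpha> k (q (Suc k) / 2) (\<lambda>l. gap_pairs (levels \<eta> l)) m" if "\<eta> \<in> space \<nu> - B m" for \<eta> m
  proof -
    have om: "\<eta> \<in> Omega0" and nB: "\<eta> \<notin> B m" and sp: "\<eta> \<in> space \<nu>" using that space_nu by auto
    note z = Omega0_tower(2)[OF om]
    interpret T: anchored_tower "contraction \<eta>" "levels \<eta>" by (rule Omega0_tower(1)[OF om])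
    show ?thesis unfolding typical_def
    proof (intro conjI allI impI ballI)
      fix l a w assume "l \<le> L" "\<bar>a\<bar> \<le> int m ^ 3" "real w \<le> A * real m"
      hence "(l, a, w) \<in> Idx m" by (auto simp: Idx_def le_nat_floor abs_le_iff)
      hence "\<eta> \<notin> E m (l, a, w)" using nB by (auto simp: B_def)
      thus "\<bar>real_of_int (\<Sum>i\<in>{a..<a + int w}. gap_pairs (levels \<eta> l) i) - \<alpha> l * real w\<bar> \<le> \<epsilon> * real m"
        using sp by (simp add: E_def z)
    next
      fix a :: int assume a: "a \<in> {0, - int m}"
      let ?I = "{a..<a + int m}" and ?Z = "gap_pairs (levels \<eta> k)"
      have "\<eta> \<notin> F m a" using nB a by (auto simp: B_def)
      hence d: "\<bar>(\<Sum>i\<in>?I. of_bool (?Z i = 0)) - (1 - q (Suc k)) * real m\<bar> < q (Suc k) / 2 * real m"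
        using sp by (simp add: F_def z del: sum_of_bool_eq)
      have "?I = {i\<in>?I. 0 < ?Z i} \<union> {i\<in>?I. ?Z i = 0}" using T.nonneg by (auto simp: order_less_le)
      hence "card ?I = card ({i\<in>?I. 0 < ?Z i} \<union> {i\<in>?I. ?Z i = 0})" by (rule arg_cong)
      also have "\<dots> = card {i\<in>?I. 0 < ?Z i} + card {i\<in>?I. ?Z i = 0}" 
        by (rule card_Un_disjoint) (auto intro: finite_subset[of _ ?I])
      finally have c: "real m = real (card {i\<in>?I. 0 < ?Z i}) + real (card {i\<in>?I. ?Z i = 0})" by simp
      have "(\<Sum>i\<in>?I. of_bool (?Z i = 0)) = real (card {i\<in>?I. ?Z i = 0})"
        by (simp add: Int_def)
      thus "q (Suc k) / 2 * real m \<le> real (card {i\<in>?I. 0 < ?Z i})" using d c by (simp add: algebra_simps abs_less_iff)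
    qed
  qed
  have "0 \<le> K" using A by (simp add: K_def)
  thus ?thesis using \<kappa>(1) Bs Bp typical_B unfolding \<alpha>_def by blast
qed

end

section \<open>Tagged solitons share their fluctuations\<close>

lemma floor_index_bound:
  assumes "1 \<le> n" "0 \<le> a" "a \<le> 1" "\<bar>u\<bar> + 1 \<le> U"
  shows "real_of_int \<bar>\<lfloor>real n powr a * u\<rfloor>\<bar> \<le> U * real n"
proof -
  have "real n powr a \<le> real n powr 1" using assms by (intro powr_mono) auto
  hence "\<bar>real n powr a * u\<bar> \<le> real n * \<bar>u\<bar>" using assms by (auto simp: abs_mult intro!: mult_right_mono)
  moreover have "real_of_int \<bar>\<lfloor>real n powr a * u\<rfloor>\<bar> \<le> \<bar>real n powr a * u\<bar> + 1" by linarith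
  moreover have "real n * \<bar>u\<bar> + 1 \<le> (\<bar>u\<bar> + 1) * real n" using assms(1) by (simp add: algebra_simps)
  moreover have "(\<bar>u\<bar> + 1) * real n \<le> U * real n" using assms by (intro mult_right_mono) auto
  ultimately show ?thesis by linarith
qed

theorem theorem4p11:
  fixes q :: "nat \<Rightarrow> real" and \<nu> :: "config measure" and k :: nat and u v a :: real
  assumes "q \<in> q_params"
    and "is_nu q \<nu>"
    and "(\<integral>\<^sup>+ \<eta>. ennreal ((real_of_int (s_inf \<eta> 1))\<^sup>2) \<partial>\<nu>) < \<infinity>"
    and "k \<ge> 1" and "q k > 0"
    and "0 \<le> a" and "a \<le> 1"
  shows "limsup (\<lambda>n::nat. \<integral>\<^sup>+ \<eta>. ennreal (
           \<bar>real_of_int (Y_disp k \<lfloor>real n powr a * u\<rfloor> \<eta> (n\<^sup>2)) / real n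
            - real_of_int (Y_disp k \<lfloor>real n powr a * v\<rfloor> \<eta> (n\<^sup>2)) / real n\<bar>\<^sup>2) \<partial>\<nu>) = 0"
proof -
  interpret soliton_measure q \<nu> using assms(1,2) by unfold_locales
  obtain k' where k: "k = Suc k'" using assms(4) by (cases k) auto
  define \<alpha> where "\<alpha> l = q (Suc l) / (1 - q (Suc l))" for l
  have \<alpha>0: "0 \<le> \<alpha> l" for l using q_range[of "Suc l"] by (simp add: \<alpha>_def)
  \<comment> \<open>Both indices are at most \<open>U n\<close>, as \<open>n powr a \<le> n\<close>.\<close>
  define U where "U = \<bar>u\<bar> + \<bar>v\<bar> + 1"
  have U: "1 \<le> U" "\<bar>u\<bar> + 1 \<le> U" "\<bar>v\<bar> + 1 \<le> U" by (auto simp: U_def)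
  have qk: "0 < q (Suc k')" using assms(5) k by simp
  define f where "f n \<eta> = \<bar>real_of_int (Y_disp k \<lfloor>real n powr a * u\<rfloor> \<eta> (n\<^sup>2)) / real n
            - real_of_int (Y_disp k \<lfloor>real n powr a * v\<rfloor> \<eta> (n\<^sup>2)) / real n\<bar>\<^sup>2" for n :: nat and \<eta>
  have ev: "eventually (\<lambda>n. (\<integral>\<^sup>+ \<eta>. ennreal (f n \<eta>) \<partial>\<nu>) \<le> ennreal e) sequentially" if e: "0 < e" for e :: real
  proof -
    define \<delta> where "\<delta> = sqrt (e / 2)"
    have \<delta>: "0 < \<delta>" "\<delta>\<^sup>2 = e / 2" using e by (simp_all add: \<delta>_def)
    obtain A L \<epsilon> n0 C where A: "1 \<le> A" and \<epsilon>: "0 < \<epsilon>" and C: "0 \<le> C"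
      and est: "\<And>c s M n i j. anchored_tower c s \<Longrightarrow> 1 \<le> M \<Longrightarrow>
        \<forall>m\<ge>M. typical A L \<epsilon> \<alpha> k' (q (Suc k') / 2) (\<lambda>l. gap_pairs (s l)) m \<Longrightarrow>
        1 \<le> n \<Longrightarrow> real_of_int \<bar>i\<bar> \<le> U * real n \<Longrightarrow> real_of_int \<bar>j\<bar> \<le> U * real n \<Longrightarrow>
        \<bar>real_of_int (Y_disp (Suc k') i (c 0) (n\<^sup>2) - Y_disp (Suc k') j (c 0) (n\<^sup>2))\<bar> \<le> C * (real M + (real n)\<^sup>2) \<and>
        (n0 \<le> n \<longrightarrow> M \<le> n \<longrightarrow>
          \<bar>real_of_int (Y_disp (Suc k') i (c 0) (n\<^sup>2) - Y_disp (Suc k') j (c 0) (n\<^sup>2))\<bar> \<le> \<delta> * real n)"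
      using tagged_estimate[of \<alpha> U "q (Suc k') / 2" \<delta> k', OF \<alpha>0 U(1) _ \<delta>(1)] qk by (auto; metis)
    obtain B \<kappa> K where \<kappa>: "0 < \<kappa>" and K: "0 \<le> K" and Bs[measurable]: "\<And>m. B m \<in> sets \<nu>"
      and Bt: "\<And>m \<eta>. \<eta> \<in> space \<nu> - B m \<Longrightarrow> typical A L \<epsilon> \<alpha> k' (q (Suc k') / 2) (\<lambda>l. gap_pairs (levels \<eta> l)) m"
      and Bp: "\<And>m. prob (B m) \<le> K * (real m + 1) ^ 4 * exp (- \<kappa> * real m)"
      using atypical_rare[OF A \<epsilon> qk, of L] unfolding \<alpha>_def by blast
    \<comment> \<open>The summand \<open>1\<close> keeps \<open>c\<close> positive, so that \<open>c * g\<close> is infinite where \<open>g\<close> is.\<close>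
    define c where "c = 4 * C\<^sup>2 + 1"
    have c: "0 < c" by (simp add: c_def add_nonneg_pos)
    \<comment> \<open>\<open>g n\<close> dominates \<open>M ^ 4\<close> where \<open>n < M\<close>, since the scale \<open>M - 1\<close> is then atypical.\<close>
    define g where "g n \<eta> = (\<Sum>m. ennreal ((real (m + n) + 1) ^ 4) * indicator (B (m + n)) \<eta>)" for n \<eta>
    have pw: "ennreal (f n \<eta>) \<le> ennreal (\<delta>\<^sup>2) + ennreal c * g n \<eta>"
      if n: "1 \<le> n" "n0 \<le> n" and \<eta>: "\<eta> \<in> space \<nu>" for n \<eta>
    proof (cases "finite {m. \<eta> \<in> B m}")
      case False
      have "infinite {m. \<eta> \<in> B (m + n)}"
      proof
        assume "finite {m. \<eta> \<in> B (m + n)}"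
        hence "finite ((\<lambda>m. m + n) ` {m. \<eta> \<in> B (m + n)} \<union> {..<n})" by simp
        moreover have "{m. \<eta> \<in> B m} \<subseteq> (\<lambda>m. m + n) ` {m. \<eta> \<in> B (m + n)} \<union> {..<n}"
        proof
          fix m assume m: "m \<in> {m. \<eta> \<in> B m}"
          show "m \<in> (\<lambda>m. m + n) ` {m. \<eta> \<in> B (m + n)} \<union> {..<n}"
            using m by (cases "n \<le> m") (auto intro!: image_eqI[of _ _ "m - n"])
        qed
        ultimately show False using False finite_subset by blast
      qed
      have "of_nat N \<le> g n \<eta>" for N
      proof -
        obtain T where T: "T \<subseteq> {m. \<eta> \<in> B (m + n)}" "finite T" "card T = N"
          using infinite_arbitrarily_large[OF \<open>infinite {m. \<eta> \<in> B (m + n)}\<close>] by blast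
        have "of_nat N = (\<Sum>m\<in>T. (1::ennreal))" using T(3) by simp
        also have "\<dots> \<le> (\<Sum>m\<in>T. ennreal ((real (m + n) + 1) ^ 4) * indicator (B (m + n)) \<eta>)"
        proof (rule sum_mono)
          fix m assume "m \<in> T"
          hence "\<eta> \<in> B (m + n)" using T(1) by auto
          moreover have "1 \<le> (real (m + n) + 1) ^ 4" by (rule one_le_power) simp
          hence "ennreal 1 \<le> ennreal ((real (m + n) + 1) ^ 4)" by (rule ennreal_leI)
          ultimately show "1 \<le> ennreal ((real (m + n) + 1) ^ 4) * indicator (B (m + n)) \<eta>"
            by (simp del: of_nat_add)
        qed
        also have "\<dots> \<le> g n \<eta>" unfolding g_def by (rule sum_le_suminf) (use T in auto)
        finally show ?thesis .
      qed
      hence "g n \<eta> = top" using ennreal_Ex_less_of_nat[of "g n \<eta>"] by (metis less_top not_less)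
      thus ?thesis using c by (simp add: ennreal_mult_top)
    next
      case True
      define Good where "Good M \<longleftrightarrow> 1 \<le> M \<and> (\<forall>m\<ge>M. \<eta> \<notin> B m)" for M
      obtain N where N: "\<forall>m\<in>{m. \<eta> \<in> B m}. m < N" using True finite_nat_set_iff_bounded by blast
      have "Good (max 1 N)" unfolding Good_def using N by (auto simp: not_less[symmetric])
      define M where "M = (LEAST M. Good M)"
      have M: "Good M" unfolding M_def by (rule LeastI[of Good]) fact
      have "M - 1 < M" using M by (simp add: Good_def)
      hence Mmin: "\<not> Good (M - 1)" using not_less_Least[of "M - 1" Good] by (simp only: M_def[symmetric] simp_thms)
      define i j where "i = \<lfloor>real n powr a * u\<rfloor>" and "j = \<lfloor>real n powr a * v\<rfloor>"
      define \<Delta> where "\<Delta> = \<bar>real_of_int (Y_disp k i \<eta> (n\<^sup>2) - Y_disp k j \<eta> (n\<^sup>2))\<bar>"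
      have om: "\<eta> \<in> Omega0" using \<eta> space_nu by simp
      have ty: "\<forall>m\<ge>M. typical A L \<epsilon> \<alpha> k' (q (Suc k') / 2) (\<lambda>l. gap_pairs (levels \<eta> l)) m"
        using Bt M \<eta> by (auto simp: Good_def)
      have M1: "1 \<le> M" using M by (simp add: Good_def)
      note E = est[OF Omega0_tower(1)[OF om] M1 ty n(1) floor_index_bound[OF n(1) assms(6,7) U(2)]
          floor_index_bound[OF n(1) assms(6,7) U(3)], folded i_def j_def, folded k, unfolded contraction.simps]
      have \<Delta>: "\<Delta> \<le> C * (real M + (real n)\<^sup>2)" "M \<le> n \<Longrightarrow> \<Delta> \<le> \<delta> * real n"
        using E n(2) by (auto simp: \<Delta>_def)
      have \<Delta>0: "0 \<le> \<Delta>" by (simp add: \<Delta>_def)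
      have fn: "f n \<eta> = (\<Delta> / real n)\<^sup>2"
        using n(1) by (simp add: f_def \<Delta>_def i_def j_def power_divide flip: diff_divide_distrib)
      show ?thesis
      proof (cases "M \<le> n")
        case True
        have "\<Delta> / real n \<le> \<delta>" using \<Delta>(2)[OF True] n(1) by (simp add: field_simps)
        hence "f n \<eta> \<le> \<delta>\<^sup>2" unfolding fn using \<Delta>0 by (intro power_mono) auto
        hence "ennreal (f n \<eta>) \<le> ennreal (\<delta>\<^sup>2)" by (rule ennreal_leI)
        also have "\<dots> \<le> ennreal (\<delta>\<^sup>2) + ennreal c * g n \<eta>" by simp
        finally show ?thesis .
      next
        case False
        hence nM: "n < M" by simp
        hence "1 \<le> M - 1" using n(1) by simp
        then obtain m where m: "M - 1 \<le> m" "\<eta> \<in> B m" using Mmin by (auto simp: Good_def)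
        have "m = M - 1" using m M by (cases "M \<le> m") (auto simp: Good_def)
        hence BM: "\<eta> \<in> B (M - 1)" using m by simp
        define m0 where "m0 = M - 1 - n"
        have m0: "m0 + n = M - 1" "real (m0 + n) + 1 = real M" using nM by (auto simp: m0_def)
        have "ennreal ((real M) ^ 4) = (\<Sum>m\<in>{m0}. ennreal ((real (m + n) + 1) ^ 4) * indicator (B (m + n)) \<eta>)"
          using BM by (simp add: m0(1) m0(2)[symmetric] del: of_nat_add)
        also have "\<dots> \<le> g n \<eta>" unfolding g_def by (rule sum_le_suminf) auto
        finally have gM: "ennreal ((real M) ^ 4) \<le> g n \<eta>" .
        have "real M + (real n)\<^sup>2 \<le> 2 * (real M)\<^sup>2"
        proof -
          have "real M * 1 \<le> real M * real M" using M1 by (intro mult_left_mono) auto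
          moreover have "(real n)\<^sup>2 \<le> (real M)\<^sup>2" using nM by (intro power_mono) auto
          ultimately show ?thesis by (simp add: power2_eq_square)
        qed
        hence "\<Delta> \<le> C * (2 * (real M)\<^sup>2)" using \<Delta>(1) C mult_left_mono by fastforce
        moreover have "\<Delta> / real n \<le> \<Delta>" using \<Delta>0 n(1) by (simp add: divide_le_eq mult_le_cancel_left1)
        ultimately have "\<Delta> / real n \<le> C * (2 * (real M)\<^sup>2)" by linarith
        hence "f n \<eta> \<le> (C * (2 * (real M)\<^sup>2))\<^sup>2" unfolding fn using \<Delta>0 by (intro power_mono) auto
        also have "\<dots> = 4 * C\<^sup>2 * (real M) ^ 4" by (simp add: power2_eq_square power4_eq_xxxx)
        also have "\<dots> \<le> c * (real M) ^ 4" unfolding c_def by (intro mult_right_mono) auto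
        finally have "ennreal (f n \<eta>) \<le> ennreal (c * (real M) ^ 4)" by (rule ennreal_leI)
        also have "\<dots> = ennreal c * ennreal ((real M) ^ 4)" using c by (simp add: ennreal_mult)
        also have "\<dots> \<le> ennreal c * g n \<eta>" using gM by (rule mult_left_mono) simp
        also have "\<dots> \<le> ennreal (\<delta>\<^sup>2) + ennreal c * g n \<eta>" by simp
        finally show ?thesis .
      qed
    qed
    define t where "t m = K * ((real m + 1) ^ 8 * exp (- \<kappa> * real m))" for m
    have t: "summable t" "\<And>m. 0 \<le> t m"
      unfolding t_def using polynomial_exponential_summable[OF \<kappa>] K by (auto intro: summable_mult)
    have gm[measurable]: "g n \<in> borel_measurable \<nu>" for n unfolding g_def by measurable
    have gi: "(\<integral>\<^sup>+ \<eta>. g n \<eta> \<partial>\<nu>) \<le> ennreal (\<Sum>m. t (m + n))" for n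
    proof -
      have "(\<integral>\<^sup>+ \<eta>. g n \<eta> \<partial>\<nu>) = (\<Sum>m. \<integral>\<^sup>+ \<eta>. ennreal ((real (m + n) + 1) ^ 4) * indicator (B (m + n)) \<eta> \<partial>\<nu>)"
        unfolding g_def by (rule nn_integral_suminf) measurable
      also have "\<dots> = (\<Sum>m. ennreal ((real (m + n) + 1) ^ 4) * emeasure \<nu> (B (m + n)))"
        by (simp add: nn_integral_cmult_indicator)
      also have "\<dots> \<le> (\<Sum>m. ennreal (t (m + n)))"
      proof (rule suminf_le)
        fix m
        have "(real (m + n) + 1) ^ 4 * prob (B (m + n)) \<le>
            (real (m + n) + 1) ^ 4 * (K * (real (m + n) + 1) ^ 4 * exp (- \<kappa> * real (m + n)))"
          using Bp[of "m + n"] by (rule mult_left_mono) simp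
        also have "\<dots> = t (m + n)" unfolding t_def by (simp add: power_add[symmetric] algebra_simps del: of_nat_add)
        finally have "ennreal ((real (m + n) + 1) ^ 4 * prob (B (m + n))) \<le> ennreal (t (m + n))" by (rule ennreal_leI)
        thus "ennreal ((real (m + n) + 1) ^ 4) * emeasure \<nu> (B (m + n)) \<le> ennreal (t (m + n))"
          by (simp add: emeasure_eq_measure ennreal_mult del: of_nat_add)
      qed auto
      also have "\<dots> = ennreal (\<Sum>m. t (m + n))"
        using t by (intro suminf_ennreal2) (auto simp: summable_iff_shift)
      finally show ?thesis .
    qed
    obtain N where N: "\<And>n. N \<le> n \<Longrightarrow> norm (\<Sum>m. t (m + n)) < e / (2 * c)"
      using suminf_exist_split[of "e / (2 * c)" t] e c t(1) by auto
    have "(\<integral>\<^sup>+ \<eta>. ennreal (f n \<eta>) \<partial>\<nu>) \<le> ennreal e" if n: "max (max 1 n0) N \<le> n" for n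
    proof -
      have "(\<integral>\<^sup>+ \<eta>. ennreal (f n \<eta>) \<partial>\<nu>) \<le> (\<integral>\<^sup>+ \<eta>. ennreal (\<delta>\<^sup>2) + ennreal c * g n \<eta> \<partial>\<nu>)"
        using pw n by (intro nn_integral_mono) auto
      also have "\<dots> = ennreal (\<delta>\<^sup>2) + ennreal c * (\<integral>\<^sup>+ \<eta>. g n \<eta> \<partial>\<nu>)"
        by (simp add: nn_integral_add nn_integral_cmult emeasure_space_1)
      also have "\<dots> \<le> ennreal (\<delta>\<^sup>2) + ennreal c * ennreal (e / (2 * c))"
      proof (intro add_left_mono mult_left_mono)
        have "ennreal (\<Sum>m. t (m + n)) \<le> ennreal (e / (2 * c))" using N[of n] n by (intro ennreal_leI) simp
        thus "(\<integral>\<^sup>+ \<eta>. g n \<eta> \<partial>\<nu>) \<le> ennreal (e / (2 * c))" using gi[of n] by (rule order_trans[rotated])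
      qed simp
      also have "\<dots> = ennreal (e / 2 + c * (e / (2 * c)))"
        using c e \<delta>(2) by (simp add: ennreal_mult[symmetric] ennreal_plus[symmetric] del: ennreal_plus)
      also have "e / 2 + c * (e / (2 * c)) = e" using c by (simp add: field_simps)
      finally show ?thesis .
    qed
    thus ?thesis unfolding eventually_sequentially by blast
  qed
  let ?F = "\<lambda>n. \<integral>\<^sup>+ \<eta>. ennreal (f n \<eta>) \<partial>\<nu>"
  have "limsup ?F \<le> 0"
  proof (rule ennreal_le_epsilon)
    fix e :: real assume "0 < e"
    from Limsup_bounded[OF ev[OF this]] show "limsup ?F \<le> 0 + ennreal e" unfolding add_0_left .
  qed
  hence "limsup ?F = 0" by (simp only: le_zero_eq)
  thus ?thesis unfolding f_def .
qed

end
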